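(* Let $\ell\ge 1$, $m\ge 1$ be integers and let $n\in\{0,\dots,m-1\}$. Let $p_{\ell,m,n}\in\mathbb P$ be the linear path $\tau\mapsto \tau(m\omega+n\delta)$, $\tau\in[0,1]$, connecting the origin to $m\omega+n\delta$. Then the formal character of the subcrystal $\mathcal A\,p_{\ell,m,n}$ of Littelmann's path crystal $\mathbb P$ generated by $p_{\ell,m,n}$ equals the formal character of the $\widehat{\mathfrak{sl}_{\ell+1}}$-module $L(\ell,m;n)$: $$\sum_{b\in \mathcal A p_{\ell,m,n}} e^{b(1)}=\sum_{\nu\in P(\pi)}\bigl(\dim L(\ell,m;n)_\nu\bigr)e^{\nu}.$$
   Context: **Affine data.** $I=\{0,\dots,\ell\}$ is identified with $\mathbb Z/(\ell+1)\mathbb Z$ (indices mod $\ell+1$). $\mathfrak g=\widehat{\mathfrak{sl}_{\ell+1}}=(\mathfrak{sl}_{\ell+1}\otimes\mathbb C[z,z^{-1}])\oplus\mathbb CK\oplus\mathbb CD$ is the untwisted affine Kac–Moody algebra ($K$ central, $D=z\frac{d}{dz}$), with Cartan subalgebra $\mathfrak h=\mathfrak h_0\oplus\mathbb CK\oplus\mathbb CD$, where $\mathfrak h_0$ is a Cartan subalgebra of $\mathfrak{sl}_{\ell+1}$, and simple coroots $\alpha_i^\vee$, $i\in I$. $\delta\in\mathfrak h^*$ is defined by $\delta(D)=1$, $\delta|_{\mathfrak h_0\oplus\mathbb CK}=0$; the fundamental weights $\Lambda_i$ satisfy $\alpha_i^\vee(\Lambda_j)=\delta_{i,j}$, $\Lambda_j(D)=0$;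 the weight lattice is $P(\pi)=\bigoplus_{i\in I}\mathbb Z\Lambda_i\oplus\mathbb Z\delta$. The simple roots are $\alpha_i=2\Lambda_i-\Lambda_{i-1}-\Lambda_{i+1}+\delta_{i,0}\,\delta$, so $\alpha_0+\dots+\alpha_\ell=\delta$ and $\alpha_i^\vee(\delta)=0$. $\omega$ is the highest weight of the natural representation $\mathbb C^{\ell+1}$ of $\mathfrak{sl}_{\ell+1}$, extended by $\omega(K)=\omega(D)=0$; thus $\omega=\Lambda_1-\Lambda_0$. **The module $L(\ell,m;n)$.** Let $V=\mathbb C^{\ell+1}$ be the natural $\mathfrak{sl}_{\ell+1}$-module, $v$ a highest weight vector of $V$, $\zeta$ a primitive $m$th root of unity and $a_j=\zeta^j$, $j=1,\dots,m$. The space $V^{\otimes m}\otimes\mathbb C[z,z^{-1}]$ is a $\mathfrak g$-module via: $K$ acts by $0$, $D(u\otimes z^r)=r\,u\otimes z^r$, and $(x\otimes z^k)(u\otimes z^r)=\Bigl(\sum_{j=1}^m a_j^k\,x^{(j)}u\Bigr)\otimes z^{k+r}$ for $x\in\mathfrak{sl}_{\ell+1}$, $k,r\in\mathbb Z$, where $x^{(j)}$ is $x$ acting in the $j$th tensor factor. $L(\ell,m;n)$ is the $\mathfrak g$-submodule generated by $v^{\otimes m}\otimes z^n$; $L(\ell,m;n)_\nu$ denotes its $\nu$-weight space with respect to $\mathfrak h$. **Littelmann's path crystal.** $\mathbb P$ is the set of piecewise-linear continuous paths $b:[0,1]\to\mathbb R P(\pi)$ with $b(0)=0$, $b(1)\in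 P(\pi)$, taken up to reparametrization. For $i\in I$ put $h^i_b(\tau)=-\alpha_i^\vee(b(\tau))$, and $\epsilon_i(b)=\max(\mathbb Z\cap h^i_b([0,1]))$; let $s_i\lambda=\lambda-\alpha_i^\vee(\lambda)\alpha_i$ and $\operatorname{wt}b=b(1)$. - Let $e_+=\min\{\tau: h^i_b(\tau)=\epsilon_i(b)\}$. If $e_+=0$ then $e_ib=0$. Otherwise let $e_-=\max\{\tau\in[0,e_+]: h^i_b(\tau)=\epsilon_i(b)-1\}$ and $(e_ib)(\tau)=b(\tau)$ on $[0,e_-]$, $=s_i(b(\tau)-b(e_-))+b(e_-)$ on $[e_-,e_+]$, $=b(\tau)+\alpha_i$ on $[e_+,1]$. - Let $f_+=\max\{\tau: h^i_b(\tau)=\epsilon_i(b)\}$. If $f_+=1$ then $f_ib=0$. Otherwise let $f_-=\min\{\tau\in[f_+,1]: h^i_b(\tau)=\epsilon_i(b)-1\}$ and $(f_ib)(\tau)=b(\tau)$ on $[0,f_+]$, $=s_i(b(\tau)-b(f_+))+b(f_+)$ on $[f_+,f_-]$, $=b(\tau)-\alpha_i$ on $[f_-,1]$. Here $0$ is an extra symbol with $e_i0=f_i0=0$. $\mathcal A$ is the monoid generated by all $e_i,f_i$, $i\in I$, and $\mathcal A b=\{ab: a\in\mathcal A\}\setminus\{0\}$. *)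

theory Defs
  imports
    "HOL-Analysis.Product_Vector"
    "HOL-Library.Function_Algebras"
    "Jordan_Normal_Form.Matrix"
begin

section \<open>Pointwise vector space structures on functions\<close>

instantiation "fun" :: (type, real_vector) real_vector
begin

definition scaleR_fun :: "real \<Rightarrow> ('a \<Rightarrow> 'b) \<Rightarrow> 'a \<Rightarrow> 'b"
  where "scaleR_fun c f = (\<lambda>x. c *\<^sub>R f x)"

instance
  by standard (simp_all add: scaleR_fun_def fun_eq_iff scaleR_add_left scaleR_add_right)

end

section \<open>Weights of the affine Lie algebra\<close>

text \<open>
  The index set \<open>I\<close> is \<open>{0..l}\<close>, read modulo \<open>l + 1\<close>.
  A real weight \<open>\<mu>\<close> is stored as the pair of the function
  \<open>i \<mapsto> \<alpha>\<^sub>i\<^sup>\<or>(\<mu>)\<close> and the number \<open>\<mu>(D)\<close>, that is, by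
  its coordinates with respect to the fundamental weights and \<open>\<delta>\<close>.  The type is independent of
  \<open>l\<close>; the sets \<open>real_weights l\<close> and \<open>weight_lattice l\<close> below are the actual
  \<open>\<real>P(\<pi>)\<close> and \<open>P(\<pi>)\<close>.
\<close>

type_synonym weight = "(nat \<Rightarrow> real) \<times> real"

definition coroot :: "nat \<Rightarrow> weight \<Rightarrow> real"
  where "coroot i \<mu> = fst \<mu> i"

definition fund_weight :: "nat \<Rightarrow> weight"
  where "fund_weight j = ((\<lambda>i. if i = j then 1 else 0), 0)"

definition delta :: weight
  where "delta = (0, 1)"

definition real_weights :: "nat \<Rightarrow> weight set"
  where "real_weights l =
    {(\<Sum>i\<le>l. c i *\<^sub>R fund_weight i) + d *\<^sub>R delta | c d. True}"

definition weight_lattice :: "nat \<Rightarrow> weight set"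
  where "weight_lattice l =
    {(\<Sum>i\<le>l. of_int (c i) *\<^sub>R fund_weight i) + of_int d *\<^sub>R delta | (c :: nat \<Rightarrow> int) (d :: int). True}"

text \<open>\<open>(i + l) mod (l + 1)\<close> is \<open>i - 1\<close> modulo \<open>l + 1\<close>.\<close>

definition simple_root :: "nat \<Rightarrow> nat \<Rightarrow> weight"
  where "simple_root l i =
    2 *\<^sub>R fund_weight i - fund_weight ((i + l) mod (l + 1)) - fund_weight ((i + 1) mod (l + 1))
      + (if i = 0 then delta else 0)"

definition omega :: weight
  where "omega = fund_weight 1 - fund_weight 0"

definition simple_refl :: "nat \<Rightarrow> nat \<Rightarrow> weight \<Rightarrow> weight"
  where "simple_refl l i \<mu> = \<mu> - coroot i \<mu> *\<^sub>R simple_root l i"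

section \<open>Littelmann's path crystal\<close>

text \<open>The pieces are closed intervals, so continuity on the unit interval is included.\<close>

definition piecewise_linear :: "(real \<Rightarrow> 'a::real_vector) \<Rightarrow> bool"
  where "piecewise_linear f \<longleftrightarrow>
    (\<exists>B. finite B \<and>
      (\<forall>s t. 0 \<le> s \<and> s \<le> t \<and> t \<le> 1 \<and> {s<..<t} \<inter> B = {} \<longrightarrow>
        (\<exists>c d. \<forall>\<tau>\<in>{s..t}. f \<tau> = c + \<tau> *\<^sub>R d)))"

definition pl_paths :: "nat \<Rightarrow> (real \<Rightarrow> weight) set"
  where "pl_paths l =
    {b. piecewise_linear b \<and> b ` {0..1} \<subseteq> real_weights l \<and> b 0 = 0 \<and> b 1 \<in> weight_lattice l}"

definition reparametrizes :: "nat \<Rightarrow> (real \<Rightarrow> weight) \<Rightarrow> (real \<Rightarrow> weight) \<Rightarrow> bool"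
  where "reparametrizes l b b' \<longleftrightarrow>
    b \<in> pl_paths l \<and> b' \<in> pl_paths l \<and>
    (\<exists>\<phi> :: real \<Rightarrow> real. piecewise_linear \<phi> \<and> mono_on {0..1} \<phi> \<and> \<phi> 0 = 0 \<and> \<phi> 1 = 1 \<and>
      (\<forall>\<tau>\<in>{0..1}. b' \<tau> = b (\<phi> \<tau>)))"

text \<open>
  Reparametrizations may have intervals of constancy, hence need not be invertible; the relation
  is therefore closed up to an equivalence.  It also identifies functions that agree on the
  unit interval (take \<open>\<phi> = id\<close>).
\<close>

definition path_equiv :: "nat \<Rightarrow> ((real \<Rightarrow> weight) \<times> (real \<Rightarrow> weight)) set"
  where "path_equiv l =
    {(b, b'). b \<in> pl_paths l \<and> b' \<in> pl_paths l \<and> equivclp (reparametrizes l) b b'}"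

type_synonym path_class = "(real \<Rightarrow> weight) set"

lemma equiv_path_equiv: "equiv (pl_paths l) (path_equiv l)"
  by (rule equivI)
    (auto simp: path_equiv_def refl_on_def intro!: symI transI
      intro: equivp_reflp[OF equivp_evquivclp] equivp_symp[OF equivp_evquivclp]
        equivp_transp[OF equivp_evquivclp])

definition path_class :: "nat \<Rightarrow> (real \<Rightarrow> weight) \<Rightarrow> path_class"
  where "path_class l b = path_equiv l `` {b}"

definition PP :: "nat \<Rightarrow> path_class set"
  where "PP l = pl_paths l // path_equiv l"

definition h_fun :: "nat \<Rightarrow> (real \<Rightarrow> weight) \<Rightarrow> real \<Rightarrow> real"
  where "h_fun i b \<tau> = - coroot i (b \<tau>)"

definition eps :: "nat \<Rightarrow> (real \<Rightarrow> weight) \<Rightarrow> real"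
  where "eps i b = Max (\<int> \<inter> h_fun i b ` {0..1})"

text \<open>The root operators on parametrized paths; \<open>None\<close> is the extra symbol \<open>0\<close>.\<close>

definition e_path :: "nat \<Rightarrow> nat \<Rightarrow> (real \<Rightarrow> weight) \<Rightarrow> (real \<Rightarrow> weight) option"
  where "e_path l i b =
    (let e_plus = (LEAST \<tau>. \<tau> \<in> {0..1} \<and> h_fun i b \<tau> = eps i b)
     in if e_plus = 0 then None
        else let e_minus = (GREATEST \<tau>. \<tau> \<in> {0..e_plus} \<and> h_fun i b \<tau> = eps i b - 1)
             in Some (\<lambda>\<tau>. if \<tau> \<le> e_minus then b \<tau>
                          else if \<tau> \<le> e_plus then simple_refl l i (b \<tau> - b e_minus) + b e_minus
                          else b \<tau> + simple_root l i))"

definition f_path :: "nat \<Rightarrow> nat \<Rightarrow> (real \<Rightarrow> weight) \<Rightarrow> (real \<Rightarrow> weight) option"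
  where "f_path l i b =
    (let f_plus = (GREATEST \<tau>. \<tau> \<in> {0..1} \<and> h_fun i b \<tau> = eps i b)
     in if f_plus = 1 then None
        else let f_minus = (LEAST \<tau>. \<tau> \<in> {f_plus..1} \<and> h_fun i b \<tau> = eps i b - 1)
             in Some (\<lambda>\<tau>. if \<tau> \<le> f_plus then b \<tau>
                          else if \<tau> \<le> f_minus then simple_refl l i (b \<tau> - b f_plus) + b f_plus
                          else b \<tau> - simple_root l i))"

text \<open>
  The root operators respect reparametrization, so the image under \<open>the_elem\<close> below is a singleton
  whenever \<open>X\<close> is an element of \<open>PP l\<close>.
\<close>

definition on_classes ::
    "nat \<Rightarrow> ((real \<Rightarrow> weight) \<Rightarrow> (real \<Rightarrow> weight) option) \<Rightarrow> path_class option \<Rightarrow> path_class option"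
  where "on_classes l g x =
    (case x of None \<Rightarrow> None
     | Some X \<Rightarrow> the_elem ((\<lambda>b. map_option (path_class l) (g b)) ` X))"

definition e_op :: "nat \<Rightarrow> nat \<Rightarrow> path_class option \<Rightarrow> path_class option"
  where "e_op l i = on_classes l (e_path l i)"

definition f_op :: "nat \<Rightarrow> nat \<Rightarrow> path_class option \<Rightarrow> path_class option"
  where "f_op l i = on_classes l (f_path l i)"

definition wt :: "path_class \<Rightarrow> weight"
  where "wt X = the_elem ((\<lambda>b. b 1) ` X)"

inductive_set op_monoid :: "nat \<Rightarrow> (path_class option \<Rightarrow> path_class option) set"
  for l :: nat
  where
    one: "id \<in> op_monoid l"
  | e: "i \<le> l \<Longrightarrow> a \<in> op_monoid l \<Longrightarrow> e_op l i \<circ> a \<in> op_monoid l"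
  | f: "i \<le> l \<Longrightarrow> a \<in> op_monoid l \<Longrightarrow> f_op l i \<circ> a \<in> op_monoid l"

definition subcrystal :: "nat \<Rightarrow> path_class \<Rightarrow> path_class set"
  where "subcrystal l X = {Y. \<exists>a\<in>op_monoid l. a (Some X) = Some Y}"

definition p_path :: "nat \<Rightarrow> nat \<Rightarrow> nat \<Rightarrow> path_class"
  where "p_path l m n =
    path_class l (\<lambda>\<tau>. \<tau> *\<^sub>R (real m *\<^sub>R omega + real n *\<^sub>R delta))"

lemma p_path_in_PP:
  assumes "1 \<le> l"
  shows "p_path l m n \<in> PP l"
proof -
  let ?b = "\<lambda>\<tau>. \<tau> *\<^sub>R (real m *\<^sub>R omega + real n *\<^sub>R delta)"
  have line: "?b \<tau> = (\<Sum>i\<le>l. (if i = 0 then - (\<tau> * real m) else if i = 1 then \<tau> * real m else 0)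
      *\<^sub>R fund_weight i) + (\<tau> * real n) *\<^sub>R delta" for \<tau>
  proof -
    have "(\<Sum>i\<le>l. (if i = 0 then - (\<tau> * real m) else if i = 1 then \<tau> * real m else 0)
      *\<^sub>R fund_weight i) = (\<Sum>i\<in>{0, 1}. (if i = 0 then - (\<tau> * real m) else if i = 1 then \<tau> * real m else 0)
      *\<^sub>R fund_weight i)"
      using assms by (intro sum.mono_neutral_right) auto
    then show ?thesis
      by (simp add: omega_def algebra_simps)
  qed
  have "piecewise_linear ?b"
    unfolding piecewise_linear_def
  proof (intro exI[of _ "{}"] conjI allI impI)
    fix s t :: real
    show "\<exists>c d. \<forall>\<tau>\<in>{s..t}. ?b \<tau> = c + \<tau> *\<^sub>R d"
      by (rule exI[of _ 0], rule exI[of _ "real m *\<^sub>R omega + real n *\<^sub>R delta"]) simp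
  qed simp
  moreover have "?b ` {0..1} \<subseteq> real_weights l"
  proof
    fix v assume "v \<in> ?b ` {0..1}"
    then obtain \<tau> where "v = ?b \<tau>"
      by blast
    then show "v \<in> real_weights l"
      unfolding real_weights_def mem_Collect_eq line[of \<tau>]
      by (intro exI[of _ "\<lambda>i. if i = 0 then - (\<tau> * real m) else if i = 1 then \<tau> * real m else 0"]
          exI[of _ "\<tau> * real n"] conjI TrueI)
  qed
  moreover have "?b 1 \<in> weight_lattice l"
  proof -
    have "?b 1 = (\<Sum>i\<le>l. of_int (if i = 0 then - int m else if i = 1 then int m else 0)
      *\<^sub>R fund_weight i) + of_int (int n) *\<^sub>R delta"
      unfolding line by (intro arg_cong2[of _ _ _ _ plus] sum.cong) auto
    then show ?thesis
      unfolding weight_lattice_def mem_Collect_eq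
      by (intro exI[of _ "\<lambda>i. if i = 0 then - int m else if i = 1 then int m else 0"]
          exI[of _ "int n"] conjI TrueI)
  qed
  ultimately have "?b \<in> pl_paths l"
    by (simp add: pl_paths_def)
  then show ?thesis
    unfolding p_path_def path_class_def PP_def by (rule quotientI)
qed

text \<open>A formal character is stored as its coefficient function.\<close>

definition crystal_char :: "path_class set \<Rightarrow> weight \<Rightarrow> nat"
  where "crystal_char S \<nu> = card {X \<in> S. wt X = \<nu>}"

section \<open>The affine Lie algebra\<close>

text \<open>
  \<open>Affine X c d\<close> stands for
  \<open>\<Sum>k. X k \<otimes> z\<^sup>k + c K + d D\<close>.
\<close>

datatype affine = Affine (loop: "int \<Rightarrow> complex mat") (K_coeff: complex) (D_coeff: complex)

definition mat_trace :: "complex mat \<Rightarrow> complex"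
  where "mat_trace A = (\<Sum>a<dim_row A. A $$ (a, a))"

definition sl :: "nat \<Rightarrow> complex mat set"
  where "sl l = {A \<in> carrier_mat (l + 1) (l + 1). mat_trace A = 0}"

abbreviation zero_sl :: "nat \<Rightarrow> complex mat"
  where "zero_sl l \<equiv> 0\<^sub>m (l + 1) (l + 1)"

definition loop_support :: "nat \<Rightarrow> affine \<Rightarrow> int set"
  where "loop_support l x = {k. loop x k \<noteq> zero_sl l}"

definition affine_algebra :: "nat \<Rightarrow> affine set"
  where "affine_algebra l = {x. range (loop x) \<subseteq> sl l \<and> finite (loop_support l x)}"

definition affine_bracket :: "nat \<Rightarrow> affine \<Rightarrow> affine \<Rightarrow> affine"
  where "affine_bracket l x y = Affine
    (\<lambda>k. mat (l + 1) (l + 1) (\<lambda>(a, b).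
        (\<Sum>p\<in>loop_support l x.
           (loop x p * loop y (k - p) - loop y (k - p) * loop x p) $$ (a, b))
        + D_coeff x * of_int k * loop y k $$ (a, b) - D_coeff y * of_int k * loop x k $$ (a, b)))
    (\<Sum>p\<in>loop_support l x. of_int p * mat_trace (loop x p * loop y (- p)))
    0"

definition cartan :: "nat \<Rightarrow> affine set"
  where "cartan l =
    {x \<in> affine_algebra l. loop_support l x \<subseteq> {0} \<and> diagonal_mat (loop x 0)}"

text \<open>
  With rows and columns numbered from \<open>0\<close>, \<open>\<alpha>\<^sub>i\<^sup>\<or>\<close> is
  \<open>E\<^bsub>i-1,i-1\<^esub> - E\<^bsub>i,i\<^esub>\<close> for \<open>i > 0\<close>, and \<open>\<alpha>\<^sub>0\<^sup>\<or>\<close> is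
  \<open>K - (E\<^bsub>0,0\<^esub> - E\<^bsub>l,l\<^esub>)\<close>.
\<close>

definition coroot_elt :: "nat \<Rightarrow> nat \<Rightarrow> affine"
  where "coroot_elt l i = Affine
    (\<lambda>k. if k = 0
         then mat (l + 1) (l + 1) (\<lambda>(a, b). if a \<noteq> b then 0 else
                (if a = (i + l) mod (l + 1) then 1 else 0) - (if a = i then 1 else 0))
         else zero_sl l)
    (if i = 0 then 1 else 0) 0"

definition D_elt :: "nat \<Rightarrow> affine"
  where "D_elt l = Affine (\<lambda>k. zero_sl l) 0 1"

text \<open>
  Evaluation of a weight at \<open>h \<in> \<hh>\<close>: if \<open>h\<^sub>0, \<dots>, h\<^sub>l\<close> are the diagonal entries
  of the \<open>\<hh>\<^sub>0\<close>-part of \<open>h\<close>, the coordinate of \<open>h\<close> at \<open>\<alpha>\<^sub>i\<^sup>\<or>\<close> in the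
  basis \<open>\<alpha>\<^sub>0\<^sup>\<or>, \<dots>, \<alpha>\<^sub>l\<^sup>\<or>, D\<close> of \<open>\<hh>\<close> is
  \<open>K_coeff h + h\<^sub>0 + \<dots> + h\<^bsub>i-1\<^esub>\<close>.
\<close>

definition weight_eval :: "nat \<Rightarrow> weight \<Rightarrow> affine \<Rightarrow> complex"
  where "weight_eval l \<nu> h =
    (\<Sum>i\<le>l. of_real (fst \<nu> i) * (K_coeff h + (\<Sum>a<i. loop h 0 $$ (a, a))))
      + of_real (snd \<nu>) * D_coeff h"

lemma weight_eval_coroot_elt:
  assumes "1 \<le> l" "i \<le> l"
  shows "weight_eval l \<nu> (coroot_elt l i) = of_real (coroot i \<nu>)"
proof -
  have diag: "loop (coroot_elt l i) 0 $$ (a, a) =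
      (if a = (i + l) mod (l + 1) then 1 else 0) - (if a = i then 1 else 0)" if "a < l + 1" for a
    using that by (simp add: coroot_elt_def)
  have pred: "(i + l) mod (l + 1) = (if i = 0 then l else i - 1)"
  proof (cases i)
    case (Suc i')
    then have "i + l = i' + (l + 1)" by simp
    then have "(i + l) mod (l + 1) = i' mod (l + 1)" by (metis mod_add_self2)
    with Suc assms show ?thesis by simp
  qed simp
  have coord: "K_coeff (coroot_elt l i) + (\<Sum>a<k. loop (coroot_elt l i) 0 $$ (a, a)) =
      (if k = i then 1 else 0)" if "k \<le> l" for k
  proof -
    have "(\<Sum>a<k. loop (coroot_elt l i) 0 $$ (a, a)) =
        (\<Sum>a<k. (if a = (i + l) mod (l + 1) then 1 else 0) - (if a = i then 1 else 0))"
      using that by (intro sum.cong refl diag) auto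
    also have "\<dots> = (if (i + l) mod (l + 1) < k then 1 else 0) - (if i < k then 1 else 0)"
      by (simp add: sum_subtractf)
    finally show ?thesis
      using that assms unfolding pred by (auto simp: coroot_elt_def)
  qed
  have "weight_eval l \<nu> (coroot_elt l i) =
      (\<Sum>k\<le>l. of_real (fst \<nu> k) * (if k = i then 1 else 0)) + 0"
    unfolding weight_eval_def
    by (intro arg_cong2[of _ _ _ _ plus] sum.cong refl) (simp_all add: coord, simp add: coroot_elt_def)
  then show ?thesis
    using assms by (simp add: coroot_def if_distrib cong: if_cong)
qed

lemma weight_eval_D_elt: "weight_eval l \<nu> (D_elt l) = of_real (snd \<nu>)"
proof -
  have "(\<Sum>a<i. loop (D_elt l) 0 $$ (a, a)) = 0" if "i \<le> l" for i
    using that by (intro sum.neutral) (auto simp: D_elt_def)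
  then show ?thesis
    by (simp add: weight_eval_def) (simp add: D_elt_def)
qed

section \<open>The loop module and its submodule\<close>

text \<open>
  The standard basis of the \<open>m\<close>-th tensor power of \<open>V\<close> consists of the pure tensors of standard
  basis vectors, indexed by words of length \<open>m\<close> in the letters \<open>0, \<dots>, l\<close>; a tensor is its
  coefficient function.  An element of the tensor product of this space with Laurent polynomials
  is the family of its coefficients at the powers of \<open>z\<close>.
\<close>

type_synonym tensor = "nat list \<Rightarrow> complex"
type_synonym laurent_tensor = "int \<Rightarrow> tensor"

definition words :: "nat \<Rightarrow> nat \<Rightarrow> nat list set"
  where "words l m = {w. length w = m \<and> set w \<subseteq> {..l}}"

definition tensor_power :: "nat \<Rightarrow> nat \<Rightarrow> tensor set"
  where "tensor_power l m = {u. \<forall>w. w \<notin> words l m \<longrightarrow> u w = 0}"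

definition loop_module :: "nat \<Rightarrow> nat \<Rightarrow> laurent_tensor set"
  where "loop_module l m = {U. range U \<subseteq> tensor_power l m \<and> finite {r. U r \<noteq> 0}}"

definition scale_lt :: "complex \<Rightarrow> laurent_tensor \<Rightarrow> laurent_tensor"
  where "scale_lt c U = (\<lambda>r w. c * U r w)"

global_interpretation lt: vector_space scale_lt
  by standard (simp_all add: scale_lt_def fun_eq_iff algebra_simps)

text \<open>The matrix \<open>A\<close> acting in the tensor factor number \<open>j\<close>, where \<open>0 \<le> j < m\<close>.\<close>

definition factor_act :: "nat \<Rightarrow> nat \<Rightarrow> nat \<Rightarrow> complex mat \<Rightarrow> tensor \<Rightarrow> tensor"
  where "factor_act l m j A u =
    (\<lambda>w. if w \<in> words l m then \<Sum>a\<le>l. A $$ (w ! j, a) * u (w[j := a]) else 0)"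

text \<open>
  Factors are numbered from \<open>0\<close> here, so factor \<open>j\<close> carries the parameter
  \<open>a\<^bsub>j+1\<^esub> = \<zeta> ^ (j + 1)\<close>.
\<close>

definition affine_act :: "nat \<Rightarrow> nat \<Rightarrow> complex \<Rightarrow> affine \<Rightarrow> laurent_tensor \<Rightarrow> laurent_tensor"
  where "affine_act l m \<zeta> x U = (\<lambda>r w.
    (\<Sum>k\<in>loop_support l x. \<Sum>j<m.
        ((\<zeta> ^ (j + 1)) powi k) * factor_act l m j (loop x k) (U (r - k)) w)
    + D_coeff x * of_int r * U r w)"

text \<open>The operators \<open>affine_act\<close> define a representation of the affine Lie algebra.\<close>

lemma affine_act_bracket:
  assumes x: "x \<in> affine_algebra l" and y: "y \<in> affine_algebra l" and "\<zeta> \<noteq> 0"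
  shows "affine_act l m \<zeta> (affine_bracket l x y) U =
    affine_act l m \<zeta> x (affine_act l m \<zeta> y U) - affine_act l m \<zeta> y (affine_act l m \<zeta> x U)"
proof (intro ext)
  fix r :: int and w :: "nat list"
  define c where "c j k = (\<zeta> ^ (j + 1)) powi k" for j :: nat and k :: int
  define F where "F = factor_act l m"
  define X where "X = loop x"
  define Y where "Y = loop y"
  define dx where "dx = D_coeff x"
  define dy where "dy = D_coeff y"
  define Sx where "Sx = loop_support l x"
  define Sy where "Sy = loop_support l y"
  define S where "S = (\<lambda>(p, q). p + q) ` (Sx \<times> Sy) \<union> Sx \<union> Sy"
  define Z where "Z = loop (affine_bracket l x y)"
  have c_add: "c j (p + q) = c j p * c j q" for j p q
    using \<open>\<zeta> \<noteq> 0\<close> by (simp add: c_def power_int_add)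
  have finx: "finite Sx" and finy: "finite Sy"
    using x y by (auto simp: affine_algebra_def Sx_def Sy_def)
  then have finS: "finite S"
    by (simp add: S_def)
  have carX: "X k \<in> carrier_mat (l + 1) (l + 1)" and carY: "Y k \<in> carrier_mat (l + 1) (l + 1)" for k
    using x y by (auto simp: affine_algebra_def sl_def X_def Y_def)
  have X0: "X k = zero_sl l" if "k \<notin> Sx" for k
    using that by (simp add: Sx_def X_def loop_support_def)
  have Y0: "Y k = zero_sl l" if "k \<notin> Sy" for k
    using that by (simp add: Sy_def Y_def loop_support_def)
  have words_upd: "v[j := a] \<in> words l m" if "v \<in> words l m" "a \<le> l" for v j a
    using that set_update_subset_insert[of v j a] by (auto simp: words_def)
  have nth_le: "v ! j \<le> l" if "v \<in> words l m" "j < m" for v j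
    using that nth_mem[of j v] by (auto simp: words_def dest!: subsetD)
  have F0: "F j (zero_sl l) u v = 0" if "j < m" for j u v
    using nth_le[OF _ that] by (auto simp: F_def factor_act_def less_Suc_eq_le intro!: sum.neutral)
  have F_add: "F j A (\<lambda>v. u v + u' v) v = F j A u v + F j A u' v" for j A u u' v
    by (simp add: F_def factor_act_def distrib_left sum.distrib)
  have F_scale: "F j A (\<lambda>v. b * u v) v = b * F j A u v" for j A b u v
    by (simp add: F_def factor_act_def sum_distrib_left mult.left_commute)
  have F_sum: "F j A (\<lambda>v. \<Sum>i\<in>I. g i v) v = (\<Sum>i\<in>I. F j A (g i) v)" for j A v and I :: "'i set" and g
    by (simp add: F_def factor_act_def sum_distrib_left sum.swap[of _ I])
  have F_disjoint: "F i A (F j B u) w = F j B (F i A u) w" if "i \<noteq> j" "i < m" "j < m" for i j A B u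
  proof (cases "w \<in> words l m")
    case True
    have "F i A (F j B u) w =
        (\<Sum>a\<le>l. \<Sum>b\<le>l. A $$ (w ! i, a) * (B $$ (w ! j, b) * u (w[i := a, j := b])))"
      using True that by (simp add: F_def factor_act_def words_upd sum_distrib_left)
    also have "\<dots> = (\<Sum>b\<le>l. \<Sum>a\<le>l. A $$ (w ! i, a) * (B $$ (w ! j, b) * u (w[i := a, j := b])))"
      by (rule sum.swap)
    also have "\<dots> = (\<Sum>b\<le>l. \<Sum>a\<le>l. B $$ (w ! j, b) * (A $$ (w ! i, a) * u (w[j := b, i := a])))"
      using that by (simp add: list_update_swap mult.left_commute)
    also have "\<dots> = F j B (F i A u) w"
      using True that by (simp add: F_def factor_act_def words_upd sum_distrib_left)
    finally show ?thesis .
  qed (simp add: F_def factor_act_def)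
  have F_comm: "F j A (F j B u) w - F j B (F j A u) w =
      F j (A * B - B * A) u w"
    if "j < m" and A: "A \<in> carrier_mat (l + 1) (l + 1)" and B: "B \<in> carrier_mat (l + 1) (l + 1)"
    for j A B u
  proof (cases "w \<in> words l m")
    case True
    have FF: "F j A (F j B u) w = (\<Sum>b\<le>l. (A * B) $$ (w ! j, b) * u (w[j := b]))"
      if A: "A \<in> carrier_mat (l + 1) (l + 1)" and B: "B \<in> carrier_mat (l + 1) (l + 1)" for A B
    proof -
      have len: "length w = m"
        using True by (simp add: words_def)
      have ent: "(A * B) $$ (w ! j, b) = (\<Sum>a\<le>l. A $$ (w ! j, a) * B $$ (a, b))" if "b \<le> l" for b
        using A B that nth_le[OF True \<open>j < m\<close>]
        by (auto simp: scalar_prod_def atLeast0LessThan lessThan_Suc_atMost intro!: sum.cong)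
      have "F j A (F j B u) w =
          (\<Sum>a\<le>l. \<Sum>b\<le>l. A $$ (w ! j, a) * (B $$ (a, b) * u (w[j := b])))"
        using True \<open>j < m\<close> len by (simp add: F_def factor_act_def words_upd sum_distrib_left)
      also have "\<dots> = (\<Sum>b\<le>l. \<Sum>a\<le>l. A $$ (w ! j, a) * (B $$ (a, b) * u (w[j := b])))"
        by (rule sum.swap)
      also have "\<dots> = (\<Sum>b\<le>l. (A * B) $$ (w ! j, b) * u (w[j := b]))"
        by (simp add: ent sum_distrib_right mult.assoc)
      finally show ?thesis .
    qed
    have "(A * B - B * A) $$ (w ! j, b) = (A * B) $$ (w ! j, b) - (B * A) $$ (w ! j, b)"
      if "b \<le> l" for b
      using A B that nth_le[OF True \<open>j < m\<close>] by auto
    then show ?thesis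
      unfolding FF[OF A B] FF[OF B A] using True
      by (simp add: F_def factor_act_def left_diff_distrib sum_subtractf)
  qed (simp add: F_def factor_act_def)
  have F_Z: "F j (Z k) u w =
      (\<Sum>p\<in>Sx. F j (X p * Y (k - p) - Y (k - p) * X p) u w)
      + dx * of_int k * F j (Y k) u w - dy * of_int k * F j (X k) u w" if "j < m" for j k u
  proof (cases "w \<in> words l m")
    case True
    have "Z k $$ (w ! j, b) = (\<Sum>p\<in>Sx. (X p * Y (k - p) - Y (k - p) * X p) $$ (w ! j, b))
        + dx * of_int k * Y k $$ (w ! j, b) - dy * of_int k * X k $$ (w ! j, b)" if "b \<le> l" for b
      using that nth_le[OF True \<open>j < m\<close>]
      by (simp add: Z_def affine_bracket_def X_def Y_def Sx_def dx_def dy_def)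
    then have "F j (Z k) u w = (\<Sum>b\<le>l. ((\<Sum>p\<in>Sx. (X p * Y (k - p) - Y (k - p) * X p) $$ (w ! j, b))
        + dx * of_int k * Y k $$ (w ! j, b) - dy * of_int k * X k $$ (w ! j, b)) * u (w[j := b]))"
      using True by (simp add: F_def factor_act_def)
    also have "\<dots> = (\<Sum>b\<le>l. \<Sum>p\<in>Sx. (X p * Y (k - p) - Y (k - p) * X p) $$ (w ! j, b) * u (w[j := b]))
        + dx * of_int k * (\<Sum>b\<le>l. Y k $$ (w ! j, b) * u (w[j := b]))
        - dy * of_int k * (\<Sum>b\<le>l. X k $$ (w ! j, b) * u (w[j := b]))"
      by (simp add: distrib_right left_diff_distrib sum.distrib sum_subtractf sum_distrib_left
          sum_distrib_right mult.assoc)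
    finally show ?thesis
      using True by (simp add: F_def factor_act_def sum.swap[of _ Sx])
  qed (simp add: F_def factor_act_def)
  have actx: "affine_act l m \<zeta> x V r' v = (\<Sum>k\<in>Sx. \<Sum>j<m. c j k * F j (X k) (V (r' - k)) v)
      + dx * of_int r' * V r' v" for V r' v
    by (simp add: affine_act_def Sx_def c_def F_def X_def dx_def)
  have acty: "affine_act l m \<zeta> y V r' v = (\<Sum>k\<in>Sy. \<Sum>j<m. c j k * F j (Y k) (V (r' - k)) v)
      + dy * of_int r' * V r' v" for V r' v
    by (simp add: affine_act_def Sy_def c_def F_def Y_def dy_def)
  define TX where "TX = (\<Sum>k\<in>Sx. \<Sum>j<m. c j k * F j (X k) (U (r - k)) w)"
  define TX' where "TX' = (\<Sum>k\<in>Sx. \<Sum>j<m. of_int k * (c j k * F j (X k) (U (r - k)) w))"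
  define TY where "TY = (\<Sum>k\<in>Sy. \<Sum>j<m. c j k * F j (Y k) (U (r - k)) w)"
  define TY' where "TY' = (\<Sum>k\<in>Sy. \<Sum>j<m. of_int k * (c j k * F j (Y k) (U (r - k)) w))"
  define XY where "XY = (\<Sum>p\<in>Sx. \<Sum>q\<in>Sy. \<Sum>i<m. \<Sum>j<m.
      c i p * c j q * F i (X p) (F j (Y q) (U (r - p - q))) w)"
  define YX where "YX = (\<Sum>p\<in>Sx. \<Sum>q\<in>Sy. \<Sum>i<m. \<Sum>j<m.
      c i p * c j q * F j (Y q) (F i (X p) (U (r - p - q))) w)"
  define G where "G p q = (\<Sum>j<m. c j (p + q) * F j (X p * Y q - Y q * X p) (U (r - (p + q))) w)" for p q
  have xy: "affine_act l m \<zeta> x (affine_act l m \<zeta> y U) r w =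
      XY + dy * (of_int r * TX - TX') + dx * of_int r * (TY + dy * of_int r * U r w)"
  proof -
    have "F j (X k) (affine_act l m \<zeta> y U (r - k)) w =
        (\<Sum>q\<in>Sy. \<Sum>i<m. c i q * F j (X k) (F i (Y q) (U (r - k - q))) w)
        + dy * of_int (r - k) * F j (X k) (U (r - k)) w" for j k
    proof -
      have "affine_act l m \<zeta> y U (r - k) = (\<lambda>v. (\<Sum>q\<in>Sy. \<Sum>i<m. c i q * F i (Y q) (U (r - k - q)) v)
          + dy * of_int (r - k) * U (r - k) v)"
        by (intro ext) (rule acty)
      then show ?thesis
        by (simp only: F_add F_sum F_scale)
    qed
    then have "affine_act l m \<zeta> x (affine_act l m \<zeta> y U) r w =
        (\<Sum>k\<in>Sx. \<Sum>j<m. c j k * ((\<Sum>q\<in>Sy. \<Sum>i<m. c i q * F j (X k) (F i (Y q) (U (r - k - q))) w)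
        + dy * of_int (r - k) * F j (X k) (U (r - k)) w)) + dx * of_int r * (TY + dy * of_int r * U r w)"
      unfolding actx by (simp add: acty TY_def)
    also have "(\<Sum>k\<in>Sx. \<Sum>j<m. c j k * ((\<Sum>q\<in>Sy. \<Sum>i<m. c i q * F j (X k) (F i (Y q) (U (r - k - q))) w)
        + dy * of_int (r - k) * F j (X k) (U (r - k)) w)) =
        (\<Sum>k\<in>Sx. \<Sum>j<m. \<Sum>q\<in>Sy. \<Sum>i<m. c j k * c i q * F j (X k) (F i (Y q) (U (r - k - q))) w)
        + dy * (of_int r * TX - TX')"
      by (simp add: TX_def TX'_def sum_distrib_left sum.distrib sum_subtractf algebra_simps)
    also have "(\<Sum>k\<in>Sx. \<Sum>j<m. \<Sum>q\<in>Sy. \<Sum>i<m. c j k * c i q * F j (X k) (F i (Y q) (U (r - k - q))) w) = XY"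
      unfolding XY_def by (intro sum.cong refl sum.swap)
    finally show ?thesis .
  qed
  have yx: "affine_act l m \<zeta> y (affine_act l m \<zeta> x U) r w =
      YX + dx * (of_int r * TY - TY') + dy * of_int r * (TX + dx * of_int r * U r w)"
  proof -
    have "F j (Y k) (affine_act l m \<zeta> x U (r - k)) w =
        (\<Sum>q\<in>Sx. \<Sum>i<m. c i q * F j (Y k) (F i (X q) (U (r - k - q))) w)
        + dx * of_int (r - k) * F j (Y k) (U (r - k)) w" for j k
    proof -
      have "affine_act l m \<zeta> x U (r - k) = (\<lambda>v. (\<Sum>q\<in>Sx. \<Sum>i<m. c i q * F i (X q) (U (r - k - q)) v)
          + dx * of_int (r - k) * U (r - k) v)"
        by (intro ext) (rule actx)
      then show ?thesis
        by (simp only: F_add F_sum F_scale)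
    qed
    then have "affine_act l m \<zeta> y (affine_act l m \<zeta> x U) r w =
        (\<Sum>k\<in>Sy. \<Sum>j<m. c j k * ((\<Sum>q\<in>Sx. \<Sum>i<m. c i q * F j (Y k) (F i (X q) (U (r - k - q))) w)
        + dx * of_int (r - k) * F j (Y k) (U (r - k)) w)) + dy * of_int r * (TX + dx * of_int r * U r w)"
      unfolding acty by (simp add: actx TX_def)
    also have "(\<Sum>k\<in>Sy. \<Sum>j<m. c j k * ((\<Sum>q\<in>Sx. \<Sum>i<m. c i q * F j (Y k) (F i (X q) (U (r - k - q))) w)
        + dx * of_int (r - k) * F j (Y k) (U (r - k)) w)) =
        (\<Sum>k\<in>Sy. \<Sum>j<m. \<Sum>q\<in>Sx. \<Sum>i<m. c i q * c j k * F j (Y k) (F i (X q) (U (r - q - k))) w)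
        + dx * (of_int r * TY - TY')"
      by (simp add: TY_def TY'_def sum_distrib_left sum.distrib sum_subtractf algebra_simps)
    also have "(\<Sum>k\<in>Sy. \<Sum>j<m. \<Sum>q\<in>Sx. \<Sum>i<m. c i q * c j k * F j (Y k) (F i (X q) (U (r - q - k))) w) =
        (\<Sum>k\<in>Sy. \<Sum>q\<in>Sx. \<Sum>j<m. \<Sum>i<m. c i q * c j k * F j (Y k) (F i (X q) (U (r - q - k))) w)"
      by (intro sum.cong refl sum.swap)
    also have "\<dots> = (\<Sum>q\<in>Sx. \<Sum>k\<in>Sy. \<Sum>j<m. \<Sum>i<m. c i q * c j k * F j (Y k) (F i (X q) (U (r - q - k))) w)"
      by (rule sum.swap)
    also have "\<dots> = YX"
      unfolding YX_def by (intro sum.cong refl sum.swap)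
    finally show ?thesis .
  qed
  have comm: "XY - YX = (\<Sum>p\<in>Sx. \<Sum>q\<in>Sy. G p q)"
  proof -
    have "XY - YX = (\<Sum>p\<in>Sx. \<Sum>q\<in>Sy. \<Sum>i<m. \<Sum>j<m. c i p * c j q *
        (F i (X p) (F j (Y q) (U (r - p - q))) w - F j (Y q) (F i (X p) (U (r - p - q))) w))"
      by (simp add: XY_def YX_def sum_subtractf right_diff_distrib)
    also have "\<dots> = (\<Sum>p\<in>Sx. \<Sum>q\<in>Sy. \<Sum>i<m. \<Sum>j<m. if j = i then c i (p + q) *
        F i (X p * Y q - Y q * X p) (U (r - (p + q))) w else 0)"
    proof (intro sum.cong refl)
      fix p q i j assume "i \<in> {..<m}" "j \<in> {..<m}"
      then show "c i p * c j q *
          (F i (X p) (F j (Y q) (U (r - p - q))) w - F j (Y q) (F i (X p) (U (r - p - q))) w) =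
          (if j = i then c i (p + q) * F i (X p * Y q - Y q * X p) (U (r - (p + q))) w else 0)"
        using F_comm[OF _ carX carY, of i p q "U (r - p - q)"] F_disjoint[of i j]
        by (auto simp: c_add diff_diff_eq)
    qed
    also have "\<dots> = (\<Sum>p\<in>Sx. \<Sum>q\<in>Sy. G p q)"
      unfolding G_def by (intro sum.cong refl) simp
    finally show ?thesis .
  qed
  have G0: "G p q = 0" if "q \<notin> Sy" for p q
  proof -
    have "X p * zero_sl l - zero_sl l * X p = zero_sl l"
      using carX[of p] by auto
    then show ?thesis
      unfolding G_def Y0[OF that] by (intro sum.neutral) (simp add: F0[simplified])
  qed
  have supp: "loop_support l (affine_bracket l x y) \<subseteq> S"
  proof
    fix k assume k: "k \<in> loop_support l (affine_bracket l x y)"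
    show "k \<in> S"
    proof (rule ccontr)
      assume "k \<notin> S"
      then have "k \<notin> Sx" "k \<notin> Sy" and kp: "k - p \<notin> Sy" if "p \<in> Sx" for p
        using that by (force simp: S_def image_iff)+
      have kS: "k \<notin> Sx" "k \<notin> Sy"
        using \<open>k \<notin> S\<close> by (auto simp: S_def)
      have "Z k = zero_sl l"
      proof (rule eq_matI)
        fix a b assume ab: "a < dim_row (zero_sl l)" "b < dim_col (zero_sl l)"
        have "(X p * Y (k - p) - Y (k - p) * X p) $$ (a, b) = 0" if "p \<in> Sx" for p
        proof -
          have "X p * Y (k - p) - Y (k - p) * X p = zero_sl l"
            unfolding Y0[OF kp[OF that]] using carX[of p] by auto
          then show ?thesis
            using ab by simp
        qed
        then show "Z k $$ (a, b) = zero_sl l $$ (a, b)"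
          using ab X0[OF kS(1)] Y0[OF kS(2)]
          by (simp add: Z_def affine_bracket_def flip: X_def Y_def Sx_def)
      qed (simp_all add: Z_def affine_bracket_def)
      with k show False
        by (simp add: loop_support_def Z_def)
    qed
  qed
  have "affine_act l m \<zeta> (affine_bracket l x y) U r w =
      (\<Sum>k\<in>loop_support l (affine_bracket l x y). \<Sum>j<m. c j k * F j (Z k) (U (r - k)) w)"
    by (simp add: affine_act_def c_def F_def Z_def) (simp add: affine_bracket_def)
  also have "\<dots> = (\<Sum>k\<in>S. \<Sum>j<m. c j k * F j (Z k) (U (r - k)) w)"
  proof (rule sum.mono_neutral_left[OF finS supp], rule ballI)
    fix k assume "k \<in> S - loop_support l (affine_bracket l x y)"
    then have "Z k = zero_sl l"
      by (simp add: loop_support_def Z_def)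
    then show "(\<Sum>j<m. c j k * F j (Z k) (U (r - k)) w) = 0"
      by (simp add: F0[simplified])
  qed
  also have "\<dots> = (\<Sum>k\<in>S. \<Sum>p\<in>Sx. G p (k - p))
      + dx * (\<Sum>k\<in>S. \<Sum>j<m. of_int k * (c j k * F j (Y k) (U (r - k)) w))
      - dy * (\<Sum>k\<in>S. \<Sum>j<m. of_int k * (c j k * F j (X k) (U (r - k)) w))"
    by (simp add: F_Z G_def sum.distrib sum_subtractf sum_distrib_left distrib_left
        right_diff_distrib sum.swap[of _ Sx] mult.assoc mult.left_commute)
  also have "(\<Sum>k\<in>S. \<Sum>j<m. of_int k * (c j k * F j (Y k) (U (r - k)) w)) = TY'"
    unfolding TY'_def
    by (rule sum.mono_neutral_right[OF finS]) (auto simp: S_def Y0 F0[simplified])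
  also have "(\<Sum>k\<in>S. \<Sum>j<m. of_int k * (c j k * F j (X k) (U (r - k)) w)) = TX'"
    unfolding TX'_def
    by (rule sum.mono_neutral_right[OF finS]) (auto simp: S_def X0 F0[simplified])
  also have "(\<Sum>k\<in>S. \<Sum>p\<in>Sx. G p (k - p)) = (\<Sum>p\<in>Sx. \<Sum>q\<in>Sy. G p q)"
  proof -
    have "(\<Sum>k\<in>S. G p (k - p)) = (\<Sum>q\<in>Sy. G p q)" if "p \<in> Sx" for p
    proof -
      have "(\<Sum>k\<in>S. G p (k - p)) = (\<Sum>k\<in>(\<lambda>q. p + q) ` Sy. G p (k - p))"
      proof (rule sum.mono_neutral_right[OF finS])
        show "(\<lambda>q. p + q) ` Sy \<subseteq> S"
          using that by (auto simp: S_def)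
        show "\<forall>k\<in>S - (\<lambda>q. p + q) ` Sy. G p (k - p) = 0"
        proof
          fix k assume "k \<in> S - (\<lambda>q. p + q) ` Sy"
          then have "k - p \<notin> Sy"
            by (auto simp: image_iff)
          then show "G p (k - p) = 0"
            by (rule G0)
        qed
      qed
      also have "\<dots> = (\<Sum>q\<in>Sy. G p q)"
        by (simp add: sum.reindex inj_on_def)
      finally show ?thesis .
    qed
    then show ?thesis
      by (subst sum.swap) simp
  qed
  also have "(\<Sum>p\<in>Sx. \<Sum>q\<in>Sy. G p q) + dx * TY' - dy * TX' =
      affine_act l m \<zeta> x (affine_act l m \<zeta> y U) r w - affine_act l m \<zeta> y (affine_act l m \<zeta> x U) r w"
    unfolding xy yx by (simp add: algebra_simps flip: comm)
  finally show "affine_act l m \<zeta> (affine_bracket l x y) U r w =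
      (affine_act l m \<zeta> x (affine_act l m \<zeta> y U) - affine_act l m \<zeta> y (affine_act l m \<zeta> x U)) r w"
    by simp
qed

definition is_submodule :: "nat \<Rightarrow> nat \<Rightarrow> complex \<Rightarrow> laurent_tensor set \<Rightarrow> bool"
  where "is_submodule l m \<zeta> W \<longleftrightarrow>
    W \<subseteq> loop_module l m \<and> lt.subspace W \<and>
    (\<forall>x\<in>affine_algebra l. \<forall>U\<in>W. affine_act l m \<zeta> x U \<in> W)"

text \<open>The first standard basis vector is a highest weight vector of \<open>V\<close>.\<close>

definition hw_generator :: "nat \<Rightarrow> nat \<Rightarrow> laurent_tensor"
  where "hw_generator m n = (\<lambda>r w. if r = int n \<and> w = replicate m 0 then 1 else 0)"

definition L_module :: "nat \<Rightarrow> nat \<Rightarrow> nat \<Rightarrow> complex \<Rightarrow> laurent_tensor set"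
  where "L_module l m n \<zeta> = \<Inter>{W. is_submodule l m \<zeta> W \<and> hw_generator m n \<in> W}"

definition weight_space ::
    "nat \<Rightarrow> nat \<Rightarrow> complex \<Rightarrow> laurent_tensor set \<Rightarrow> weight \<Rightarrow> laurent_tensor set"
  where "weight_space l m \<zeta> W \<nu> =
    {U \<in> W. \<forall>h\<in>cartan l. affine_act l m \<zeta> h U = scale_lt (weight_eval l \<nu> h) U}"

definition finite_dim :: "laurent_tensor set \<Rightarrow> bool"
  where "finite_dim W \<longleftrightarrow> (\<exists>B. finite B \<and> W \<subseteq> lt.span B)"

definition module_char ::
    "nat \<Rightarrow> nat \<Rightarrow> complex \<Rightarrow> laurent_tensor set \<Rightarrow> weight \<Rightarrow> nat"
  where "module_char l m \<zeta> W \<nu> =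
    (if \<nu> \<in> weight_lattice l then lt.dim (weight_space l m \<zeta> W \<nu>) else 0)"

definition primitive_root :: "nat \<Rightarrow> complex \<Rightarrow> bool"
  where "primitive_root m \<zeta> \<longleftrightarrow> \<zeta> ^ m = 1 \<and> (\<forall>k. 0 < k \<and> k < m \<longrightarrow> \<zeta> ^ k \<noteq> 1)"

end

theory Submission
  imports Defs "HOL-Analysis.Elementary_Normed_Spaces" "HOL-Combinatorics.Multiset_Permutations"
    "HOL-Computational_Algebra.Polynomial" "HOL-Number_Theory.Cong"
begin

text \<open>
  Along a path of the subcrystal the direction changes only at multiples of \<open>1 / m\<close>, and the
  displacements over the \<open>m\<close> intervals are \<open>\<epsilon>\<^sub>a + (k + n / m) \<delta>\<close> with
  \<open>\<epsilon>\<^sub>a\<close> a weight of \<open>V\<close> and \<open>k\<close> an integer.  Coding such a displacement by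
  the integer \<open>a - k (l + 1)\<close>, the operator \<open>f\<^sub>i\<close> adds \<open>1\<close> to one entry of an integer
  sequence of length \<open>m\<close>, and the subcrystal becomes the set of sequences whose consecutive
  differences \<open>x\<^sub>j - x\<^bsub>j+1\<^esub>\<close> lie in \<open>{0..l}\<close>.  Such a sequence amounts to a word
  together with an integer in the residue class \<open>n\<close> plus the comajor index of the word, modulo
  \<open>m\<close>.

  On the other side, \<open>L(l, m; n)\<close> is an eigenspace of the cyclic shift of the tensor factors,
  twisted by the degree; its weight multiplicities count the rotation orbits of words on which a
  character of the stabilizer is trivial.

  The two numbers agree because the generating function of the comajor index, a \<open>q\<close>-multinomial
  coefficient, evaluates at an \<open>m\<close>-th root of unity to the number of words fixed by the
  corresponding rotation.
\<close>

section \<open>The comajor index at roots of unity\<close>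

text \<open>No weight-preserving bijection between the two sides is constructed; they are compared
  through characters of the cyclic group of order m. For a weight of degree r put \<theta> =
  \<zeta>^(n - r). The sum over j < m of \<theta>^j times the number of words fixed by rotation j is
  m times the number of orbits with trivial stabilizer character. Averaging over the m-th roots of
  unity picks out the words with comajor index in one residue class and gives the same sum, because
  the comajor index exhibits cyclic sieving. The module side produces \<zeta>^(r - n), the inverse
  character, which is trivial on the same stabilizers. The obstacle on the path side is that a path
  is a class modulo reparametrizations that may be constant on intervals: the root operators have to
  be shown compatible with these, and distinct sequences have to be separated by an invariant of the
  class. That every sequence is reached rests on reversibility: an f-step is undone by an e-step, so
  reachability propagates both ways.\<close>

fun comaj :: "nat list \<Rightarrow> nat" where
  "comaj [] = 0"
| "comaj [a] = 0"
| "comaj (a # b # w) = (if a < b then length (b # w) else 0) + comaj (b # w)"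

section \<open>q-integers and the recursions of q-multinomial coefficients\<close>

definition qint :: "'a::comm_ring_1 \<Rightarrow> nat \<Rightarrow> 'a"
  where "qint q k = (\<Sum>i<k. q ^ i)"

lemma qint_0 [simp]: "qint q 0 = 0"
  by (simp add: qint_def)

lemma qint_add: "qint q (a + b) = qint q a + q ^ a * qint q b"
  by (induction b) (simp_all add: qint_def power_add algebra_simps)

lemma one_minus_qint: "(1 - q) * qint q k = 1 - q ^ k"
  by (simp add: qint_def one_diff_power_eq)

definition above :: "nat \<Rightarrow> nat multiset \<Rightarrow> nat"
  where "above a M = size (filter_mset (\<lambda>b. a < b) M)"

lemma above_diff_self: "above a (M - {#a#}) = above a M"
  by (simp add: above_def filter_diff_mset)

lemma size_filter_neq: "size (filter_mset (\<lambda>b. b \<noteq> a) M) + count M a = size M"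
  for M :: "'a multiset"
  by (induction M) auto

text \<open>Listing the letters in decreasing order cuts the exponents below \<open>size M\<close>
  into consecutive blocks: the block of b starts at \<open>above b M\<close> and has length
  \<open>count M b\<close>. The induction removes the smallest letter, whose block is the last
  one.\<close>

lemma sum_qint_above: "(\<Sum>b\<in>set_mset M. q ^ above b M * qint q (count M b)) = qint q (size M)"
proof (induction M rule: measure_induct_rule[where f = size])
  case (less M)
  show ?case
  proof (cases "M = {#}")
    case False
    define a where "a = Min (set_mset M)"
    have a: "a \<in># M" and le: "a \<le> b" if "b \<in># M" for b
      using False that by (simp_all add: a_def)
    from False a have a: "a \<in># M" by (metis multiset_nonemptyE)
    define N where "N = filter_mset (\<lambda>b. b \<noteq> a) M"
    have sz: "size N + count M a = size M"
      unfolding N_def by (rule size_filter_neq)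
    have set: "set_mset M = insert a (set_mset N)" "a \<notin># N"
      using a by (auto simp: N_def)
    have above_a: "above a M = size N"
      unfolding above_def N_def
      by (intro arg_cong[of _ _ size] filter_mset_cong refl) (use le in force)
    have above: "above b N = above b M" and count: "count N b = count M b" if "b \<in># N" for b
    proof -
      have "a < b" using that le[of b] by (auto simp: N_def)
      then show "above b N = above b M" "count N b = count M b"
        unfolding above_def N_def filter_filter_mset
        by (auto intro!: arg_cong[of _ _ size] filter_mset_cong)
    qed
    have "size N < size M" using sz a by (metis add_eq_self_zero le_add1 le_neq_implies_less not_in_iff)
    then have IH: "(\<Sum>b\<in>set_mset N. q ^ above b N * qint q (count N b)) = qint q (size N)"
      by (rule less)
    have "(\<Sum>b\<in>set_mset M. q ^ above b M * qint q (count M b)) =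
      q ^ size N * qint q (count M a) + (\<Sum>b\<in>set_mset N. q ^ above b N * qint q (count N b))"
      using set above count by (simp add: above_a)
    also have "\<dots> = qint q (size M)"
      unfolding IH using qint_add[of q "size N" "count M a"] sz by simp
    finally show ?thesis .
  qed simp
qed

lemma sum_qint_above_greater:
  "(\<Sum>b | b \<in># M \<and> a < b. q ^ above b M * qint q (count M b)) = qint q (above a M)"
proof -
  have "above b (filter_mset (\<lambda>b. a < b) M) = above b M" if "a < b" for b
    using that unfolding above_def filter_filter_mset
    by (intro arg_cong[of _ _ size] filter_mset_cong) auto
  then show ?thesis
    using sum_qint_above[of q "filter_mset (\<lambda>b. a < b) M"] by (simp add: above_def[of a])
qed

text \<open>The q-multinomial coefficient of the content \<open>M\<close>.\<close>

definition comaj_gf :: "'a::comm_ring_1 \<Rightarrow> nat multiset \<Rightarrow> 'a"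
  where "comaj_gf q M = (\<Sum>w\<in>permutations_of_multiset M. q ^ comaj w)"

text \<open>Whether the prepended letter a creates an ascent depends on the next letter only;
  keeping track of it makes the recursion on first letters close.\<close>

definition comaj_first_gf :: "'a::comm_ring_1 \<Rightarrow> nat \<Rightarrow> nat multiset \<Rightarrow> 'a"
  where "comaj_first_gf q a M = (\<Sum>w\<in>permutations_of_multiset M. q ^ comaj (a # w))"

lemma sum_permutations_of_multiset:
  fixes g :: "'b list \<Rightarrow> 'a::comm_monoid_add"
  assumes "M \<noteq> {#}"
  shows "(\<Sum>w\<in>permutations_of_multiset M. g w) =
    (\<Sum>b\<in>set_mset M. \<Sum>w\<in>permutations_of_multiset (M - {#b#}). g (b # w))"
  unfolding permutations_of_multiset_nonempty[OF assms]
  by (subst sum.UNION_disjoint) (auto simp: sum.reindex intro!: sum.cong)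

lemma comaj_gf_empty [simp]: "comaj_gf q {#} = 1"
  by (simp add: comaj_gf_def)

lemma comaj_gf_first:
  assumes "M \<noteq> {#}"
  shows "comaj_gf q M = (\<Sum>b\<in>set_mset M. comaj_first_gf q b (M - {#b#}))"
  unfolding comaj_gf_def comaj_first_gf_def by (rule sum_permutations_of_multiset[OF assms])

lemma comaj_first_gf_rec:
  assumes "M \<noteq> {#}"
  shows "comaj_first_gf q a M =
    (\<Sum>b\<in>set_mset M. (if a < b then q ^ size M else 1) * comaj_first_gf q b (M - {#b#}))"
proof -
  have "q ^ comaj (a # b # w) = (if a < b then q ^ size M else 1) * q ^ comaj (b # w)"
    if "b \<in># M" "w \<in> permutations_of_multiset (M - {#b#})" for b w
  proof -
    have "size M = Suc (length w)"
      using that by (auto simp: length_finite_permutations_of_multiset size_Diff_singleton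
          dest!: multi_member_split)
    then show ?thesis by (simp add: power_add)
  qed
  then show ?thesis
    unfolding comaj_first_gf_def sum_permutations_of_multiset[OF assms] sum_distrib_left
    by (intro sum.cong refl) simp
qed

text \<open>
  At a root of unity the \<open>q\<close>-integers may vanish, so these identities are obtained for a formal
  \<open>q\<close> first and specialized afterwards.
\<close>

lemma comaj_gf_generic:
  fixes q :: "'a::idom"
  assumes q: "\<And>k. 0 < k \<Longrightarrow> qint q k \<noteq> 0"
  shows "(\<forall>a\<in>#M. qint q (count M a) * comaj_gf q M = qint q (size M) * comaj_gf q (M - {#a#})) \<and>
    (\<forall>a. comaj_first_gf q a M = q ^ above a M * comaj_gf q M)"
proof (induction M rule: measure_induct_rule[where f = size])
  case (less M)
  show ?case
  proof (cases "M = {#}")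
    case True
    then show ?thesis by (simp add: comaj_first_gf_def above_def)
  next
    case False
    have sm: "size (M - {#b#}) < size M" if "b \<in># M" for b
      using that by (simp add: size_Diff1_less)
    have first: "comaj_first_gf q a (M - {#b#}) = q ^ above a (M - {#b#}) * comaj_gf q (M - {#b#})"
      if "b \<in># M" for a b
      using less[OF sm[OF that]] by blast
    have gf: "comaj_gf q M = (\<Sum>b\<in>set_mset M. q ^ above b M * comaj_gf q (M - {#b#}))"
      unfolding comaj_gf_first[OF False] by (intro sum.cong refl) (simp add: first above_diff_self)
    have one: "qint q (count M a) * comaj_gf q M = qint q (size M) * comaj_gf q (M - {#a#})"
      if a: "a \<in># M" for a
    proof -
      \<comment> \<open>For b different from a, both sides equal the q-integer of
        \<open>size M - 1\<close> times the value with one a and one b removed, which is symmetric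
        in a and b.\<close>
      have eq: "qint q (count M a) * comaj_gf q (M - {#b#}) = qint q (count M b) * comaj_gf q (M - {#a#})"
        if b: "b \<in># M" for b
      proof (cases "b = a")
        case False
        then have "a \<in># M - {#b#}" "b \<in># M - {#a#}"
          using a b False by (metis insert_DiffM insert_noteq_member)+
        then have "qint q (count (M - {#b#}) a) * comaj_gf q (M - {#b#}) =
            qint q (size (M - {#b#})) * comaj_gf q (M - {#b#} - {#a#})"
          "qint q (count (M - {#a#}) b) * comaj_gf q (M - {#a#}) =
            qint q (size (M - {#a#})) * comaj_gf q (M - {#a#} - {#b#})"
          using less[OF sm[OF b]] less[OF sm[OF a]] by blast+
        then show ?thesis
          using a b False by (simp add: size_Diff_singleton diff_right_commute add_mset_commute)
      qed simp
      have "qint q (count M a) * comaj_gf q M =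
          (\<Sum>b\<in>set_mset M. q ^ above b M * (qint q (count M a) * comaj_gf q (M - {#b#})))"
        unfolding gf by (simp add: sum_distrib_left mult_ac)
      also have "\<dots> = (\<Sum>b\<in>set_mset M. q ^ above b M * qint q (count M b)) * comaj_gf q (M - {#a#})"
        unfolding sum_distrib_right by (intro sum.cong refl) (simp add: eq mult.assoc)
      finally show ?thesis by (simp only: sum_qint_above)
    qed
    have two: "comaj_first_gf q a M = q ^ above a M * comaj_gf q M" for a
    proof -
      \<comment> \<open>Multiplication by \<open>?s\<close> turns each
        \<open>comaj_gf q (M - {#b#})\<close> into a multiple of \<open>comaj_gf q M\<close>;
        cancelling \<open>?s\<close> at the end is where the hypothesis on \<open>q\<close>
        enters.\<close>
      let ?s = "qint q (size M)"
      let ?t = "\<lambda>b. q ^ above b M * qint q (count M b)"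
      have sum_split: "(\<Sum>b\<in>set_mset M. (if a < b then q ^ size M else 1) * ?t b) =
          (\<Sum>b\<in>set_mset M. ?t b) + (q ^ size M - 1) * (\<Sum>b | b \<in># M \<and> a < b. ?t b)"
        unfolding sum_distrib_left sum.inter_filter[OF finite_set_mset] sum.distrib[symmetric]
        by (intro sum.cong refl) (simp add: algebra_simps)
      have "?s * comaj_first_gf q a M =
          (\<Sum>b\<in>set_mset M. (if a < b then q ^ size M else 1) * ?t b) * comaj_gf q M"
        unfolding comaj_first_gf_rec[OF False] sum_distrib_left sum_distrib_right
      proof (intro sum.cong refl)
        fix b assume b: "b \<in># M"
        let ?c = "if a < b then q ^ size M else 1"
        have "?s * (?c * comaj_first_gf q b (M - {#b#})) =
            ?c * (q ^ above b M * (?s * comaj_gf q (M - {#b#})))"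
          by (simp only: first[OF b] above_diff_self ac_simps)
        then show "?s * (?c * comaj_first_gf q b (M - {#b#})) = ?c * ?t b * comaj_gf q M"
          by (simp only: one[OF b, symmetric] ac_simps)
      qed
      also have "(\<Sum>b\<in>set_mset M. (if a < b then q ^ size M else 1) * ?t b) =
          ?s + (q ^ size M - 1) * qint q (above a M)"
        unfolding sum_split sum_qint_above sum_qint_above_greater ..
      also have "\<dots> = ?s * q ^ above a M"
      proof -
        have "(q ^ size M - 1) * qint q (above a M) = - (?s * ((1 - q) * qint q (above a M)))"
        proof -
          have "q ^ size M - 1 = - ((1 - q) * ?s)"
            by (simp add: one_minus_qint)
          then show ?thesis
            by (simp only:) (simp add: algebra_simps)
        qed
        then show ?thesis
          by (simp only: one_minus_qint) (simp add: algebra_simps)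
      qed
      finally show ?thesis
        using q[of "size M"] False by (simp add: mult.assoc nonempty_has_size)
    qed
    from one two show ?thesis by blast
  qed
qed

lemma poly_qint: "poly (qint [:0, 1:] k) z = qint z k"
  by (simp add: qint_def poly_sum)

lemma poly_comaj_gf: "poly (comaj_gf [:0, 1:] M) z = comaj_gf z M"
  by (simp add: comaj_gf_def poly_sum)

lemma poly_comaj_first_gf: "poly (comaj_first_gf [:0, 1:] a M) z = comaj_first_gf z a M"
  by (simp add: comaj_first_gf_def poly_sum)

text \<open>The constant coefficient is 1.\<close>

lemma qint_pX_neq_0:
  assumes "0 < k"
  shows "qint [:0, 1 :: 'a::idom:] k \<noteq> 0"
proof -
  obtain j where "k = Suc j" using assms by (cases k) auto
  then have "poly (qint [:0, 1 :: 'a:] k) 0 = 1"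
    unfolding poly_qint by (simp add: qint_def sum.lessThan_Suc_shift del: sum.lessThan_Suc)
  then show ?thesis by auto
qed

text \<open>The absorption identity of q-multinomial coefficients, written without division: at a
  root of unity either q-integer may vanish, and this is what the lemmas below exploit.\<close>

lemma count_comaj_gf:
  fixes z :: "'a::idom"
  assumes "a \<in># M"
  shows "qint z (count M a) * comaj_gf z M = qint z (size M) * comaj_gf z (M - {#a#})"
proof -
  have "qint [:0, 1:] (count M a) * comaj_gf [:0, 1:] M =
      qint [:0, 1 :: 'a:] (size M) * comaj_gf [:0, 1:] (M - {#a#})"
    using comaj_gf_generic[of "[:0, 1 :: 'a:]" M] qint_pX_neq_0 assms by blast
  then have "poly (qint [:0, 1:] (count M a) * comaj_gf [:0, 1:] M) z =
      poly (qint [:0, 1 :: 'a:] (size M) * comaj_gf [:0, 1:] (M - {#a#})) z" by simp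
  then show ?thesis by (simp only: poly_mult poly_qint poly_comaj_gf)
qed

text \<open>The q-Pascal recursion, by the first letter.\<close>

lemma comaj_gf_rec:
  fixes z :: "'a::idom"
  assumes "M \<noteq> {#}"
  shows "comaj_gf z M = (\<Sum>b\<in>set_mset M. z ^ above b M * comaj_gf z (M - {#b#}))"
proof -
  have "comaj_first_gf z b (M - {#b#}) = z ^ above b M * comaj_gf z (M - {#b#})" for b
  proof -
    have "comaj_first_gf [:0, 1:] b (M - {#b#}) =
        [:0, 1 :: 'a:] ^ above b (M - {#b#}) * comaj_gf [:0, 1:] (M - {#b#})"
      using comaj_gf_generic[of "[:0, 1 :: 'a:]" "M - {#b#}"] qint_pX_neq_0 by blast
    from arg_cong[OF this, of "\<lambda>p. poly p z"] show ?thesis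
      by (simp add: poly_comaj_first_gf poly_comaj_gf above_diff_self)
  qed
  then show ?thesis unfolding comaj_gf_first[OF assms] by simp
qed

section \<open>Specialization to roots of unity\<close>

lemma power_eq_1_iff_dvd:
  fixes z :: "'a::idom"
  assumes "z ^ d = 1" "0 < d" "\<And>k. 0 < k \<Longrightarrow> k < d \<Longrightarrow> z ^ k \<noteq> 1"
  shows "z ^ k = 1 \<longleftrightarrow> d dvd k"
proof -
  have "z ^ k = z ^ (k mod d)"
    by (metis assms(1) mod_mult_div_eq mult.right_neutral power_add power_mult power_one)
  with assms show ?thesis
    by (metis dvd_eq_mod_eq_0 gr0I mod_less_divisor power_0)
qed

lemma qint_eq_0_iff:
  fixes z :: "'a::idom"
  assumes "z \<noteq> 1" "z ^ d = 1" "0 < d" "\<And>k. 0 < k \<Longrightarrow> k < d \<Longrightarrow> z ^ k \<noteq> 1"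
  shows "qint z k = 0 \<longleftrightarrow> d dvd k"
proof -
  have "(1 - z) * qint z k = 0 \<longleftrightarrow> z ^ k = 1"
    unfolding one_minus_qint by auto
  then show ?thesis
    using power_eq_1_iff_dvd[OF assms(2-4), of k] assms(1) by simp
qed

lemma qint_cong_root:
  fixes z :: "'a::idom"
  assumes "z \<noteq> 1" "z ^ a = z ^ b"
  shows "qint z a = qint z b"
proof -
  have "(1 - z) * qint z a = (1 - z) * qint z b"
    by (simp only: one_minus_qint assms)
  with assms show ?thesis by simp
qed

lemma above_repeat_mset: "above a (repeat_mset d N) = d * above a N"
  by (induction d) (simp_all add: above_def)

text \<open>With k copies of b removed, the absorption identity involves the q-integers of
  \<open>count M b - k\<close> and \<open>size M - k\<close>. Both numbers are congruent to -k
  modulo d, so the q-integers agree, and for 0 < k < d they are nonzero and cancel. For k = 0 both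
  vanish, which is why the chain starts at 1.\<close>

lemma comaj_gf_diff_replicate:
  fixes z :: "'a::idom"
  assumes z: "z \<noteq> 1" "z ^ d = 1" "0 < d" "\<And>k. 0 < k \<Longrightarrow> k < d \<Longrightarrow> z ^ k \<noteq> 1"
    and M: "d dvd size M" "d dvd count M b" "b \<in># M"
    and k: "1 \<le> k" "k \<le> d"
  shows "comaj_gf z (M - {#b#}) = comaj_gf z (M - replicate_mset k b)"
  using k
proof (induction k rule: dec_induct)
  case (step k)
  let ?M = "M - replicate_mset k b"
  have "k < count M b" "replicate_mset k b \<subseteq># M"
    using step.prems M dvd_imp_le[OF M(2)]
    by (auto simp flip: count_le_replicate_mset_subset_eq)
  then have b: "b \<in># ?M" and cnt: "count ?M b = count M b - k" and sz: "size ?M = size M - k"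
    and ks: "k \<le> size M" "k \<le> count M b"
    using count_le_size[of M b] by (simp_all add: in_diff_count size_Diff_submset)
  have "\<not> d dvd k"
    using step by (auto dest: dvd_imp_le)
  then have "\<not> d dvd count M b - k"
    using M ks by (metis dvd_diffD1)
  then have nz: "qint z (count M b - k) \<noteq> 0"
    using qint_eq_0_iff[OF z] by blast
  have "z ^ (count M b - k) * z ^ k = 1" "z ^ (size M - k) * z ^ k = 1"
    using ks M power_eq_1_iff_dvd[OF z(2-4)] by (simp_all flip: power_add)
  then have "z ^ (count M b - k) = z ^ (size M - k)"
    by (metis mult_right_cancel mult_zero_right zero_neq_one)
  then have "qint z (count M b - k) = qint z (size M - k)"
    by (rule qint_cong_root[OF z(1)])
  with count_comaj_gf[OF b, of z] nz have "comaj_gf z ?M = comaj_gf z (?M - {#b#})"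
    by (simp add: cnt sz)
  with step show ?case by simp
qed simp

text \<open>The factors \<open>z ^ above b M\<close> of the q-Pascal recursion are 1 here, and
  removing one letter has the same effect as removing d equal ones; what remains is the recursion
  that counts the words of content \<open>N\<close> by their first letter.\<close>

lemma comaj_gf_repeat_mset:
  fixes z :: "'a::idom"
  assumes z: "z \<noteq> 1" "z ^ d = 1" "0 < d" "\<And>k. 0 < k \<Longrightarrow> k < d \<Longrightarrow> z ^ k \<noteq> 1"
  shows "comaj_gf z (repeat_mset d N) = of_nat (card (permutations_of_multiset N))"
proof (induction N rule: measure_induct_rule[where f = size])
  case (less N)
  show ?case
  proof (cases "N = {#}")
    case False
    let ?M = "repeat_mset d N"
    have ne: "?M \<noteq> {#}" and set: "set_mset ?M = set_mset N"
      using False z(3) by (simp_all add: multiset_eq_iff set_eq_iff flip: count_greater_zero_iff)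
    have "comaj_gf z (?M - {#b#}) = of_nat (card (permutations_of_multiset (N - {#b#})))"
      if b: "b \<in># N" for b
    proof -
      have "comaj_gf z (?M - {#b#}) = comaj_gf z (?M - replicate_mset d b)"
        by (rule comaj_gf_diff_replicate[OF z]) (use z(3) b set in auto)
      also have "?M - replicate_mset d b = repeat_mset d (N - {#b#})"
        by (rule multiset_eqI) (auto simp: diff_mult_distrib2)
      finally show ?thesis
        using less[of "N - {#b#}"] b by (simp add: size_Diff1_less)
    qed
    moreover have "z ^ above b ?M = 1" for b
      by (simp add: above_repeat_mset power_mult z(2))
    ultimately have "comaj_gf z ?M = (\<Sum>b\<in>set_mset N. of_nat (card (permutations_of_multiset (N - {#b#}))))"
      unfolding comaj_gf_rec[OF ne] set by (intro sum.cong refl) simp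
    also have "\<dots> = of_nat (\<Sum>b\<in>set_mset N. card (permutations_of_multiset (N - {#b#})))"
      by simp
    also have "(\<Sum>b\<in>set_mset N. card (permutations_of_multiset (N - {#b#}))) = card (permutations_of_multiset N)"
      using sum_permutations_of_multiset[OF False, of "\<lambda>_. 1 :: nat"] by simp
    finally show ?thesis .
  qed simp
qed

text \<open>In the absorption identity for a, the q-integer of the size vanishes while that of the
  multiplicity does not.\<close>

lemma comaj_gf_eq_0:
  fixes z :: "'a::idom"
  assumes z: "z \<noteq> 1" "z ^ d = 1" "0 < d" "\<And>k. 0 < k \<Longrightarrow> k < d \<Longrightarrow> z ^ k \<noteq> 1"
    and "d dvd size M" "\<not> d dvd count M a"
  shows "comaj_gf z M = 0"
proof -
  have "a \<in># M"
    using assms(6) by (metis dvd_0_right not_in_iff)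
  then show ?thesis
    using count_comaj_gf[of a M z] qint_eq_0_iff[OF z, of "size M"] qint_eq_0_iff[OF z, of "count M a"]
      assms(5,6) by simp
qed

lemma exists_repeat_mset:
  assumes "\<And>a. d dvd count M a"
  shows "\<exists>N. M = repeat_mset d N"
proof
  show "M = repeat_mset d (\<Sum>a\<in>set_mset M. replicate_mset (count M a div d) a)"
    by (rule multiset_eqI)
      (use assms in \<open>auto simp: count_sum sum.delta' not_in_iff dvd_mult_div_cancel\<close>)
qed

section \<open>Words fixed by a rotation\<close>

lemma append_commute_replicate:
  assumes "u @ v = v @ u" "length v = k * length u"
  shows "v = concat (replicate k u)"
  using assms
proof (induction k arbitrary: v)
  case (Suc k)
  then obtain v' where v: "v = u @ v'"
    by (metis append_eq_append_conv_if le_add1 mult_Suc append_take_drop_id)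
  with Suc show ?case by simp
qed simp

lemma concat_replicate_commute: "concat (replicate k u) @ u = u @ concat (replicate k u)"
  by (induction k) auto

text \<open>Rotation by g interchanges \<open>take g w\<close> and \<open>drop g w\<close>, so a
  fixed word is one whose two parts commute, and a word commuting with its prefix of length g is a
  power of that prefix.\<close>

lemma rotate_block_iff:
  assumes "length w = Suc k * g"
  shows "rotate g w = w \<longleftrightarrow> w = concat (replicate (Suc k) (take g w))"
proof -
  let ?u = "take g w" and ?v = "drop g w"
  have lu: "length ?u = g" and lv: "length ?v = k * length ?u"
    using assms by auto
  have rot: "rotate g w = ?v @ ?u"
    by (metis append_take_drop_id lu rotate_append)
  show ?thesis
  proof
    assume "rotate g w = w"
    then have "?u @ ?v = ?v @ ?u"
      by (metis append_take_drop_id rot)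
    from append_commute_replicate[OF this lv] show "w = concat (replicate (Suc k) ?u)"
      by (metis append_take_drop_id concat.simps(2) replicate_Suc)
  next
    assume w: "w = concat (replicate (Suc k) ?u)"
    then have "?u @ ?v = ?u @ concat (replicate k ?u)"
      by (metis append_take_drop_id concat.simps(2) replicate_Suc)
    then have "?v = concat (replicate k ?u)" by (simp only: same_append_eq)
    with rot have "rotate g w = ?u @ concat (replicate k ?u)"
      by (simp add: concat_replicate_commute)
    with w show "rotate g w = w" by simp
  qed
qed

lemma rotate_mult_fixed: "rotate g w = w \<Longrightarrow> rotate (k * g) w = w"
  by (induction k) (simp_all flip: rotate_rotate)

text \<open>By Bezout, the gcd is a multiple of j modulo the length of w.\<close>

lemma rotate_gcd_fixed: "rotate j w = w \<longleftrightarrow> rotate (gcd j (length w)) w = w"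
proof
  assume fixed: "rotate j w = w"
  show "rotate (gcd j (length w)) w = w"
  proof (cases "j = 0")
    case False
    then obtain x y where "j * x = length w * y + gcd j (length w)"
      using bezout_nat by blast
    then have "rotate (gcd j (length w) + y * length w) w = w"
      using rotate_mult_fixed[OF fixed, of x] by (simp add: ac_simps)
    then show ?thesis
      by (metis mod_mult_self1 rotate_conv_mod)
  qed simp
next
  assume "rotate (gcd j (length w)) w = w"
  then show "rotate j w = w"
    by (metis dvd_div_mult_self gcd_dvd1 rotate_mult_fixed)
qed

lemma mset_concat_replicate: "mset (concat (replicate k u)) = repeat_mset k (mset u)"
  by (induction k) simp_all

lemma rotate_fixed_perms:
  assumes "size M = d * g" "0 < d"
  shows "{w \<in> permutations_of_multiset M. rotate g w = w} =
    (\<lambda>u. concat (replicate d u)) ` {u. repeat_mset d (mset u) = M}"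
proof -
  obtain k where d: "d = Suc k" using assms by (cases d) auto
  show ?thesis
  proof (intro equalityI subsetI)
    fix w assume "w \<in> {w \<in> permutations_of_multiset M. rotate g w = w}"
    then have w: "mset w = M" "rotate g w = w" by (auto dest: permutations_of_multisetD)
    then have "length w = Suc k * g"
      using assms d by (metis size_mset)
    with w have "w = concat (replicate d (take g w))"
      using rotate_block_iff d by blast
    moreover from this have "repeat_mset d (mset (take g w)) = M"
      using w(1) by (metis mset_concat_replicate)
    ultimately show "w \<in> (\<lambda>u. concat (replicate d u)) ` {u. repeat_mset d (mset u) = M}"
      by blast
  next
    fix w assume "w \<in> (\<lambda>u. concat (replicate d u)) ` {u. repeat_mset d (mset u) = M}"
    then obtain u where u: "w = concat (replicate d u)" "repeat_mset d (mset u) = M" by blast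
    then have m: "mset w = M" by (simp add: mset_concat_replicate)
    then have lw: "length w = Suc k * g" using assms d by (metis size_mset)
    moreover have "length w = Suc k * length u"
      unfolding u(1) d by (simp add: length_concat sum_list_replicate)
    ultimately have "length u = g" by (metis mult_cancel1 Suc_neq_Zero)
    then have "take g w = u"
      unfolding u(1) d by simp
    with u(1) d have "w = concat (replicate (Suc k) (take g w))" by simp
    with rotate_block_iff[OF lw] have "rotate g w = w" by blast
    with m show "w \<in> {w \<in> permutations_of_multiset M. rotate g w = w}"
      by (simp add: permutations_of_multisetI)
  qed
qed

text \<open>Cyclic sieving for words. With m the size and g the gcd of j and m, the number \<zeta>^j
  has exact order d = m / g, and the words fixed by rotation j are the d-fold repetitions of words
  of length g. If d divides all multiplicities of \<open>M\<close>, both sides count the words of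
  content \<open>M\<close> divided by d; otherwise both are 0.\<close>

lemma comaj_gf_root_of_unity:
  assumes prim: "primitive_root (size M) \<zeta>" and M: "M \<noteq> {#}"
  shows "comaj_gf (\<zeta> ^ j) M = of_nat (card {w \<in> permutations_of_multiset M. rotate j w = w})"
proof -
  let ?m = "size M"
  define g where "g = gcd j ?m"
  define d where "d = ?m div g"
  have m0: "0 < ?m" using M by (simp add: nonempty_has_size)
  then have md: "?m = d * g" and g0: "0 < g" using M by (simp_all add: d_def g_def)
  with m0 have d0: "0 < d" by auto
  have zk: "\<zeta> ^ k = 1 \<longleftrightarrow> ?m dvd k" for k
    using prim m0 by (intro power_eq_1_iff_dvd) (auto simp: primitive_root_def)
  have jg: "j = j div g * g" by (simp add: g_def)
  have cop: "coprime d (j div g)"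
    unfolding d_def g_def using m0 by (metis coprime_commute div_gcd_coprime gr_implies_not0)
  have ord: "(\<zeta> ^ j) ^ k = 1 \<longleftrightarrow> d dvd k" for k
  proof -
    have "(\<zeta> ^ j) ^ k = 1 \<longleftrightarrow> d * g dvd j * k"
      by (simp only: power_mult[symmetric] zk md)
    also have "j * k = (j div g * k) * g" by (subst jg) (simp only: ac_simps)
    also have "d * g dvd (j div g * k) * g \<longleftrightarrow> d dvd k"
      using g0 cop by (simp add: coprime_dvd_mult_right_iff)
    finally show ?thesis .
  qed
  have fixed: "{w \<in> permutations_of_multiset M. rotate j w = w} =
      (\<lambda>u. concat (replicate d u)) ` {u. repeat_mset d (mset u) = M}"
    unfolding rotate_fixed_perms[OF md d0, symmetric] g_def
    by (intro Collect_cong conj_cong refl)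
      (metis rotate_gcd_fixed length_finite_permutations_of_multiset)
  show ?thesis
  proof (cases "\<zeta> ^ j = 1")
    case True
    then have "d = 1" using ord[of 1] by simp
    then have "{u. repeat_mset d (mset u) = M} = permutations_of_multiset M"
      by (simp add: permutations_of_multiset_def)
    then show ?thesis
      unfolding fixed \<open>d = 1\<close> by (simp add: True comaj_gf_def)
  next
    case False
    have z: "\<zeta> ^ j \<noteq> 1" "(\<zeta> ^ j) ^ d = 1" "0 < d" "\<And>k. 0 < k \<Longrightarrow> k < d \<Longrightarrow> (\<zeta> ^ j) ^ k \<noteq> 1"
      using False ord d0 by (auto dest: dvd_imp_le)
    have inj: "inj_on (\<lambda>u. concat (replicate d u)) {u. repeat_mset d (mset u) = M}"
    proof (rule inj_onI)
      fix u v :: "nat list"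
      assume uv: "u \<in> {u. repeat_mset d (mset u) = M}" "v \<in> {u. repeat_mset d (mset u) = M}"
        "concat (replicate d u) = concat (replicate d v)"
      then have "length u = length v"
        using d0 by (metis (mono_tags, lifting) mem_Collect_eq mult_cancel1 nat_neq_iff size_mset size_repeat_mset)
      with uv(3) d0 show "u = v" by (cases d) auto
    qed
    show ?thesis
    proof (cases "\<exists>N. M = repeat_mset d N")
      case True
      then obtain N where N: "M = repeat_mset d N" ..
      then have "{u. repeat_mset d (mset u) = M} = permutations_of_multiset N"
        using d0 by (auto simp: permutations_of_multiset_def multiset_eq_iff)
      then show ?thesis
        unfolding fixed card_image[OF inj] using comaj_gf_repeat_mset[OF z] N by simp
    next
      case False
      then obtain a where "\<not> d dvd count M a"
        using exists_repeat_mset[of d M] by auto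
      then have "comaj_gf (\<zeta> ^ j) M = 0"
        using comaj_gf_eq_0[OF z] md by simp
      moreover have "{u. repeat_mset d (mset u) = M} = {}" using False by blast
      ultimately show ?thesis unfolding fixed by simp
    qed
  qed
qed


text \<open>A set closed under rearrangement is a disjoint union of full content classes, to each of
  which sieving applies.\<close>

lemma sum_comaj_root_of_unity:
  assumes prim: "primitive_root m \<zeta>" and m: "1 \<le> m" and A: "finite A" "\<And>w. w \<in> A \<Longrightarrow> length w = m"
    "\<And>w v. w \<in> A \<Longrightarrow> mset v = mset w \<Longrightarrow> v \<in> A"
  shows "(\<Sum>w\<in>A. (\<zeta> ^ j) ^ comaj w) = of_nat (card {w \<in> A. rotate j w = w})"
proof -
  have fin: "finite (mset ` A)" using A by simp
  have fib: "{w \<in> A. mset w = M} = permutations_of_multiset M"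
    and sz: "size M = m" if "M \<in> mset ` A" for M
    using that A by (auto simp: permutations_of_multiset_def)
  have "(\<Sum>w\<in>A. (\<zeta> ^ j) ^ comaj w) = (\<Sum>M\<in>mset ` A. \<Sum>w | w \<in> A \<and> mset w = M. (\<zeta> ^ j) ^ comaj w)"
    by (rule sum.image_gen[OF A(1)])
  also have "\<dots> = (\<Sum>M\<in>mset ` A. \<Sum>w | w \<in> A \<and> mset w = M. if rotate j w = w then 1 else 0)"
  proof (rule sum.cong[OF refl])
    fix M assume M: "M \<in> mset ` A"
    have "M \<noteq> {#}" using sz[OF M] m by auto
    then show "(\<Sum>w | w \<in> A \<and> mset w = M. (\<zeta> ^ j) ^ comaj w) =
        (\<Sum>w | w \<in> A \<and> mset w = M. if rotate j w = w then 1 else 0)"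
      unfolding fib[OF M] using comaj_gf_root_of_unity[of M \<zeta> j] prim
      by (simp add: sz[OF M] comaj_gf_def sum.If_cases Int_def)
  qed
  also have "\<dots> = (\<Sum>w\<in>A. if rotate j w = w then 1 else 0)"
    by (rule sum.image_gen[OF A(1), symmetric])
  also have "\<dots> = of_nat (card {w \<in> A. rotate j w = w})"
    using A by (simp add: sum.If_cases Int_def)
  finally show ?thesis .
qed

section \<open>Rotation orbits of words\<close>

definition rot_orbit :: "'a list \<Rightarrow> 'a list set"
  where "rot_orbit w = range (\<lambda>i. rotate i w)"

lemma rot_orbit_self: "w \<in> rot_orbit w"
  unfolding rot_orbit_def by (rule range_eqI[of _ _ 0]) simp

lemma rotate_inverse: "i \<le> length w \<Longrightarrow> rotate (length w - i) (rotate i w) = w"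
  by (simp add: rotate_rotate)

lemma rotate_mod_length: "length w = m \<Longrightarrow> rotate (i mod m) w = rotate i w"
  by (metis rotate_conv_mod)

lemma rot_orbit_finite:
  assumes "length w = m" "0 < m"
  shows "rot_orbit w = (\<lambda>i. rotate i w) ` {..<m}"
proof -
  have "rotate i w \<in> (\<lambda>i. rotate i w) ` {..<m}" for i
    by (rule image_eqI[where x = "i mod m"]) (use assms in \<open>simp_all add: rotate_mod_length\<close>)
  then show ?thesis
    by (auto simp: rot_orbit_def)
qed

lemma bij_betw_add_mod:
  fixes m s :: nat
  assumes "0 < m"
  shows "bij_betw (\<lambda>i. (i + s) mod m) {..<m} {..<m}"
proof -
  have "inj_on (\<lambda>i. (i + s) mod m) {..<m}"
  proof (rule inj_onI)
    fix i j assume ij: "i \<in> {..<m}" "j \<in> {..<m}" and "(i + s) mod m = (j + s) mod m"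
    then have "[i + s = j + s] (mod m)" by (simp add: cong_def)
    then have "[i = j] (mod m)" by (simp only: cong_add_rcancel_nat)
    with ij show "i = j" by (simp add: cong_def)
  qed
  moreover have "(\<lambda>i. (i + s) mod m) ` {..<m} \<subseteq> {..<m}" using assms by auto
  ultimately show ?thesis by (simp add: bij_betw_def endo_inj_surj)
qed

lemma sum_rotations_shift:
  assumes "length w = m" "0 < m"
  shows "(\<Sum>i<m. g ((i + s) mod m) (rotate (i + s) w)) = (\<Sum>i<m. g i (rotate i w))"
  using sum.reindex_bij_betw[OF bij_betw_add_mod[OF assms(2)], of "\<lambda>i. g i (rotate i w)" s] assms(1)
  by (simp add: rotate_mod_length)

lemma rot_orbit_rotate: "rot_orbit (rotate i w) = rot_orbit w"
proof (cases "w = []")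
  case False
  have "rotate j (rotate i w) \<in> rot_orbit w" for j
    by (simp add: rot_orbit_def rotate_rotate)
  moreover have "rotate j w \<in> rot_orbit (rotate i w)" for j
  proof -
    let ?i = "i mod length w"
    have "?i \<le> length w" using False by (simp add: less_imp_le)
    then have "rotate j w = rotate j (rotate (length w - ?i) (rotate ?i w))"
      by (simp only: rotate_inverse)
    then have "rotate j w = rotate (j + (length w - ?i)) (rotate i w)"
      by (simp only: rotate_rotate[symmetric] rotate_mod_length[OF refl])
    then show ?thesis
      unfolding rot_orbit_def by (rule range_eqI)
  qed
  ultimately show ?thesis unfolding rot_orbit_def by blast
qed (simp add: rot_orbit_def)

lemma rotate_stabilizer_rotate: "rotate j (rotate i w) = rotate i w \<longleftrightarrow> rotate j w = w"
proof
  assume "rotate j (rotate i w) = rotate i w"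
  then have "rotate i (rotate j w) = rotate i w"
    by (simp add: rotate_rotate add.commute)
  then have "rotate (i mod length w) (rotate j w) = rotate (i mod length w) w"
    by (simp add: rotate_mod_length)
  then have "rotate (length w - i mod length w) (rotate (i mod length w) (rotate j w)) =
      rotate (length w - i mod length w) (rotate (i mod length w) w)"
    by simp
  then show "rotate j w = w"
    using rotate_inverse[of "i mod length w" w] rotate_inverse[of "i mod length w" "rotate j w"]
    by (cases "w = []") (simp_all add: less_imp_le)
next
  assume "rotate j w = w"
  then show "rotate j (rotate i w) = rotate i w"
    by (metis add.commute rotate_rotate)
qed

text \<open>Orbit-stabilizer: every fibre of the orbit map is a translate of the stabilizer.\<close>

lemma card_rotations_to:
  assumes "length w = m" "0 < m"
  shows "card {i. i < m \<and> rotate i w = rotate j w} = card {i. i < m \<and> rotate i w = w}"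
proof -
  have card: "card {i. i < m \<and> P i} = (\<Sum>i<m. if P i then 1 else 0)" for P
    by (simp add: sum.If_cases Int_def)
  have "card {i. i < m \<and> rotate i w = rotate j w} = (\<Sum>i<m. if rotate (i + j) w = rotate j w then 1 else 0)"
    unfolding card by (rule sum_rotations_shift[OF assms, of "\<lambda>_ v. if v = rotate j w then 1 else 0", symmetric])
  also have "\<dots> = card {i. i < m \<and> rotate i w = w}"
    unfolding card by (simp add: rotate_stabilizer_rotate flip: rotate_rotate)
  finally show ?thesis .
qed

text \<open>The character sending j to \<theta>^j is trivial on the stabilizer of w. Since j is
  unbounded, this includes \<open>\<theta> ^ length w = 1\<close>.\<close>

definition rot_good :: "complex \<Rightarrow> 'a list \<Rightarrow> bool"
  where "rot_good \<theta> w \<longleftrightarrow> (\<forall>j. rotate j w = w \<longrightarrow> \<theta> ^ j = 1)"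

lemma rot_good_rotate: "rot_good \<theta> (rotate i w) \<longleftrightarrow> rot_good \<theta> w"
  by (simp add: rot_good_def rotate_stabilizer_rotate)

text \<open>Orthogonality of characters: translation by a stabilizing s with \<theta>^s different
  from 1 multiplies the sum by \<theta>^s, yet only permutes its terms.\<close>

lemma sum_stabilizer_characters:
  assumes "length w = m" "0 < m" "\<theta> ^ m = 1"
  shows "(\<Sum>j | j < m \<and> rotate j w = w. \<theta> ^ j) =
    (if rot_good \<theta> w then of_nat (card {j. j < m \<and> rotate j w = w}) else 0)"
proof (cases "rot_good \<theta> w")
  case False
  let ?S = "\<Sum>j<m. if rotate j w = w then \<theta> ^ j else 0"
  have theta: "\<theta> ^ (j mod m) = \<theta> ^ j" for j
    by (metis assms(3) mod_mult_div_eq mult.right_neutral power_add power_mult power_one)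
  from False obtain s where s: "rotate s w = w" "\<theta> ^ s \<noteq> 1"
    by (auto simp: rot_good_def)
  have "rotate (j + s) w = rotate j w" for j
    by (simp only: rotate_rotate[symmetric] s(1))
  then have "?S = (\<Sum>j<m. if rotate j w = w then \<theta> ^ (j + s) else 0)"
    using sum_rotations_shift[OF assms(1,2), of "\<lambda>i v. if v = w then \<theta> ^ i else 0" s] by (simp add: theta cong: if_cong)
  also have "\<dots> = \<theta> ^ s * ?S"
    by (simp add: sum_distrib_left power_add mult.commute if_distrib cong: if_cong)
  finally have "?S = 0" using s(2) by simp
  with False show ?thesis by (simp add: sum.If_cases Int_def)
qed (auto simp: rot_good_def)

text \<open>Orbit counting with a character: only good words contribute, each the order of its
  stabilizer, and over one orbit these orders add up to m.\<close>

lemma card_rot_orbits: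
  assumes A: "finite A" "\<And>w. w \<in> A \<Longrightarrow> length w = m" "\<And>w i. w \<in> A \<Longrightarrow> rotate i w \<in> A"
    and m: "0 < m" and chi: "\<theta> ^ m = 1"
  shows "of_nat (m * card (rot_orbit ` {w \<in> A. rot_good \<theta> w})) =
    (\<Sum>w\<in>A. \<Sum>j | j < m \<and> rotate j w = w. \<theta> ^ j)"
proof -
  let ?G = "{w \<in> A. rot_good \<theta> w}"
  let ?st = "\<lambda>w. card {j. j < m \<and> rotate j w = w}"
  have finG: "finite ?G" using A by simp
  have orb: "(\<Sum>w | w \<in> ?G \<and> rot_orbit w = O'. ?st w) = m" if O': "O' \<in> rot_orbit ` ?G" for O'
  proof -
    from O' obtain t where t: "t \<in> A" "rot_good \<theta> t" "O' = rot_orbit t" by blast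
    have lt: "length t = m" using A t by blast
    have "{w. w \<in> ?G \<and> rot_orbit w = O'} = (\<lambda>i. rotate i t) ` {..<m}"
    proof (intro equalityI subsetI)
      fix w assume "w \<in> {w. w \<in> ?G \<and> rot_orbit w = O'}"
      then have "w \<in> rot_orbit t" using t rot_orbit_self by auto
      then show "w \<in> (\<lambda>i. rotate i t) ` {..<m}"
        using rot_orbit_finite[OF lt m] by simp
    qed (use t A in \<open>auto simp: rot_good_rotate rot_orbit_rotate\<close>)
    then have "(\<Sum>w | w \<in> ?G \<and> rot_orbit w = O'. ?st w) = (\<Sum>w\<in>(\<lambda>i. rotate i t) ` {..<m}. ?st w)"
      by simp
    also have "\<dots> = (\<Sum>w\<in>(\<lambda>i. rotate i t) ` {..<m}. \<Sum>i | i \<in> {..<m} \<and> rotate i t = w. 1)"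
    proof (intro sum.cong refl)
      fix w assume "w \<in> (\<lambda>i. rotate i t) ` {..<m}"
      then obtain i where i: "w = rotate i t" by blast
      show "?st w = (\<Sum>i | i \<in> {..<m} \<and> rotate i t = w. 1)"
        unfolding i using card_rotations_to[OF lt m, of i] by (simp add: rotate_stabilizer_rotate)
    qed
    also have "\<dots> = (\<Sum>i\<in>{..<m}. 1)"
      by (rule sum.image_gen[symmetric]) simp
    finally show ?thesis by simp
  qed
  have "(\<Sum>w\<in>A. \<Sum>j | j < m \<and> rotate j w = w. \<theta> ^ j) = (\<Sum>w\<in>A. if rot_good \<theta> w then of_nat (?st w) else 0)"
    by (intro sum.cong refl sum_stabilizer_characters A m chi)
  also have "\<dots> = of_nat (\<Sum>w\<in>?G. ?st w)"
    unfolding sum.inter_filter[OF A(1)] of_nat_sum by (intro sum.cong refl) simp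
  also have "(\<Sum>w\<in>?G. ?st w) = (\<Sum>O'\<in>rot_orbit ` ?G. \<Sum>w | w \<in> ?G \<and> rot_orbit w = O'. ?st w)"
    by (rule sum.image_gen[OF finG])
  also have "\<dots> = m * card (rot_orbit ` ?G)"
    by (subst sum.cong[OF refl orb]) (simp_all add: mult.commute)
  finally show ?thesis by simp
qed

text \<open>Multiplied by m, both cardinalities equal the sum over j < m of \<theta>^j times the
  number of words of \<open>A\<close> fixed by rotation j, where \<theta> is
  \<open>\<zeta> powi k\<close>: the left one by averaging over roots of unity and sieving, the
  right one by orbit counting.\<close>

lemma card_comaj_eq_card_rot_orbits:
  fixes k :: int
  assumes prim: "primitive_root m \<zeta>" and m: "1 \<le> m"
    and A: "finite A" "\<And>w. w \<in> A \<Longrightarrow> length w = m" "\<And>w v. w \<in> A \<Longrightarrow> mset v = mset w \<Longrightarrow> v \<in> A"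
  shows "card {w \<in> A. int m dvd k + int (comaj w)} = card (rot_orbit ` {w \<in> A. rot_good (\<zeta> powi k) w})"
proof -
  define \<theta> where "\<theta> = \<zeta> powi k"
  have z: "\<zeta> \<noteq> 0" "\<zeta> ^ m = 1"
    using prim m by (auto simp: primitive_root_def power_0_left split: if_splits)
  have zk: "\<zeta> ^ k = 1 \<longleftrightarrow> m dvd k" for k
    using prim m by (intro power_eq_1_iff_dvd) (auto simp: primitive_root_def)
  have zi: "\<zeta> powi i = 1 \<longleftrightarrow> int m dvd i" for i
    by (cases i rule: int_cases2) (auto simp: power_int_minus zk)
  have zim: "(\<zeta> powi i) ^ m = 1" for i
    using zi[of "i * int m"] by (simp add: power_int_power')
  then have chi: "\<theta> ^ m = 1"
    unfolding \<theta>_def .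
  have geom: "(\<Sum>j<m. (\<zeta> powi i) ^ j) = (if int m dvd i then of_nat m else 0)" for i
  proof (cases "int m dvd i")
    case False
    have "(1 - \<zeta> powi i) * (\<Sum>j<m. (\<zeta> powi i) ^ j) = 0"
      by (simp add: zim flip: one_diff_power_eq)
    then show ?thesis using False zi by simp
  next
    case True
    then have "\<zeta> powi i = 1" by (simp add: zi)
    with True show ?thesis by simp
  qed
  have "of_nat (m * card {w \<in> A. int m dvd k + int (comaj w)}) =
      (\<Sum>w\<in>A. \<Sum>j<m. (\<zeta> powi (k + int (comaj w))) ^ j)"
    using A(1) by (simp add: geom sum.If_cases Int_def)
  also have "\<dots> = (\<Sum>j<m. \<theta> ^ j * (\<Sum>w\<in>A. (\<zeta> ^ j) ^ comaj w))"
  proof -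
    have "(\<zeta> powi (k + int c)) ^ j = \<theta> ^ j * (\<zeta> ^ j) ^ c" for j c
    proof -
      have "(\<zeta> ^ c) ^ j = (\<zeta> ^ j) ^ c"
        by (simp only: power_mult[symmetric] mult.commute)
      then show ?thesis
        using z by (simp add: \<theta>_def power_int_add power_mult_distrib)
    qed
    then show ?thesis
      unfolding sum_distrib_left by (simp only:) (rule sum.swap)
  qed
  also have "\<dots> = (\<Sum>j<m. \<Sum>w\<in>A. if rotate j w = w then \<theta> ^ j else 0)"
  proof -
    have "(\<Sum>w\<in>A. (\<zeta> ^ j) ^ comaj w) = of_nat (card {w \<in> A. rotate j w = w})" for j
      by (rule sum_comaj_root_of_unity[OF prim m A])
    then show ?thesis
      using A(1) by (simp add: sum.If_cases Int_def mult.commute)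
  qed
  also have "\<dots> = (\<Sum>w\<in>A. \<Sum>j<m. if rotate j w = w then \<theta> ^ j else 0)"
    by (rule sum.swap)
  also have "\<dots> = (\<Sum>w\<in>A. \<Sum>j | j < m \<and> rotate j w = w. \<theta> ^ j)"
    by (rule sum.cong[OF refl]) (simp add: sum.If_cases Int_def)
  also have "\<dots> = of_nat (m * card (rot_orbit ` {w \<in> A. rot_good \<theta> w}))"
  proof (rule card_rot_orbits[symmetric])
    have "mset (rotate i w) = mset w" for i and w :: "nat list"
      by (metis append_take_drop_id mset_append rotate_drop_take union_commute)
    then show "rotate i w \<in> A" if "w \<in> A" for w i
      using A(3)[OF that] by blast
  qed (use A m chi in auto)
  finally show ?thesis
    using m by (simp add: \<theta>_def del: of_nat_mult)
qed

section \<open>Piecewise linear paths\<close>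

lemma piecewise_linearE:
  assumes "piecewise_linear f"
  obtains B where "finite B"
    "\<And>s t. 0 \<le> s \<Longrightarrow> s \<le> t \<Longrightarrow> t \<le> 1 \<Longrightarrow> {s<..<t} \<inter> B = {} \<Longrightarrow> \<exists>c d. \<forall>\<tau>\<in>{s..t}. f \<tau> = c + \<tau> *\<^sub>R d"
proof -
  from assms obtain B where B: "finite B"
    "\<forall>s t. 0 \<le> s \<and> s \<le> t \<and> t \<le> 1 \<and> {s<..<t} \<inter> B = {} \<longrightarrow>
      (\<exists>c d. \<forall>\<tau>\<in>{s..t}. f \<tau> = c + \<tau> *\<^sub>R d)"
    unfolding piecewise_linear_def by (elim exE conjE)
  show thesis
  proof (rule that[OF B(1)])
    show "\<exists>c d. \<forall>\<tau>\<in>{s..t}. f \<tau> = c + \<tau> *\<^sub>R d"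
      if "0 \<le> s" "s \<le> t" "t \<le> 1" "{s<..<t} \<inter> B = {}" for s t
      using that B(2) by simp
  qed
qed

lemma piecewise_linearI:
  assumes "finite B"
    "\<And>s t. 0 \<le> s \<Longrightarrow> s \<le> t \<Longrightarrow> t \<le> 1 \<Longrightarrow> {s<..<t} \<inter> B = {} \<Longrightarrow> \<exists>c d. \<forall>\<tau>\<in>{s..t}. f \<tau> = c + \<tau> *\<^sub>R d"
  shows "piecewise_linear f"
  unfolding piecewise_linear_def
proof (rule exI[of _ B], intro conjI allI impI)
  show "finite B" by (rule assms(1))
  fix s t :: real
  assume "0 \<le> s \<and> s \<le> t \<and> t \<le> 1 \<and> {s<..<t} \<inter> B = {}"
  then show "\<exists>c d. \<forall>\<tau>\<in>{s..t}. f \<tau> = c + \<tau> *\<^sub>R d"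
    using assms(2)[of s t] by simp
qed

lemma piecewise_linear_affine: "piecewise_linear (\<lambda>\<tau>. c + \<tau> *\<^sub>R d)"
  by (rule piecewise_linearI[of "{}"]) auto

lemma piecewise_linear_const: "piecewise_linear (\<lambda>\<tau>. c)"
  using piecewise_linear_affine[of c 0] by simp

lemma piecewise_linear_linear_image:
  assumes "piecewise_linear f" "linear T"
  shows "piecewise_linear (\<lambda>\<tau>. T (f \<tau>))"
proof -
  obtain B where B: "finite B" "\<And>s t. 0 \<le> s \<Longrightarrow> s \<le> t \<Longrightarrow> t \<le> 1 \<Longrightarrow> {s<..<t} \<inter> B = {} \<Longrightarrow>
      \<exists>c d. \<forall>\<tau>\<in>{s..t}. f \<tau> = c + \<tau> *\<^sub>R d"
    by (rule piecewise_linearE[OF assms(1)]) (rule that)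
  show ?thesis
  proof (rule piecewise_linearI[OF B(1)])
    fix s t :: real assume "0 \<le> s" "s \<le> t" "t \<le> 1" "{s<..<t} \<inter> B = {}"
    from B(2)[OF this] obtain c d where "\<forall>\<tau>\<in>{s..t}. f \<tau> = c + \<tau> *\<^sub>R d" by blast
    then have "\<forall>\<tau>\<in>{s..t}. T (f \<tau>) = T c + \<tau> *\<^sub>R T d"
      using assms(2) by (simp add: linear_add linear_scale)
    then show "\<exists>c d. \<forall>\<tau>\<in>{s..t}. T (f \<tau>) = c + \<tau> *\<^sub>R d" by blast
  qed
qed

lemma piecewise_linear_add:
  assumes "piecewise_linear f" "piecewise_linear g"
  shows "piecewise_linear (\<lambda>\<tau>. f \<tau> + g \<tau>)"
proof -
  obtain B where B: "finite B" "\<And>s t. 0 \<le> s \<Longrightarrow> s \<le> t \<Longrightarrow> t \<le> 1 \<Longrightarrow> {s<..<t} \<inter> B = {} \<Longrightarrow>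
      \<exists>c d. \<forall>\<tau>\<in>{s..t}. f \<tau> = c + \<tau> *\<^sub>R d"
    by (rule piecewise_linearE[OF assms(1)]) (rule that)
  obtain C where C: "finite C" "\<And>s t. 0 \<le> s \<Longrightarrow> s \<le> t \<Longrightarrow> t \<le> 1 \<Longrightarrow> {s<..<t} \<inter> C = {} \<Longrightarrow>
      \<exists>c d. \<forall>\<tau>\<in>{s..t}. g \<tau> = c + \<tau> *\<^sub>R d"
    by (rule piecewise_linearE[OF assms(2)]) (rule that)
  show ?thesis
  proof (rule piecewise_linearI[of "B \<union> C"])
    fix s t :: real assume st: "0 \<le> s" "s \<le> t" "t \<le> 1" "{s<..<t} \<inter> (B \<union> C) = {}"
    then have "{s<..<t} \<inter> B = {}" "{s<..<t} \<inter> C = {}" by auto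
    with B(2)[OF st(1-3)] C(2)[OF st(1-3)] obtain c d c' d'
      where "\<forall>\<tau>\<in>{s..t}. f \<tau> = c + \<tau> *\<^sub>R d" "\<forall>\<tau>\<in>{s..t}. g \<tau> = c' + \<tau> *\<^sub>R d'" by metis
    then have "\<forall>\<tau>\<in>{s..t}. f \<tau> + g \<tau> = (c + c') + \<tau> *\<^sub>R (d + d')"
      by (simp add: algebra_simps)
    then show "\<exists>c d. \<forall>\<tau>\<in>{s..t}. f \<tau> + g \<tau> = c + \<tau> *\<^sub>R d" by blast
  qed (use B C in simp)
qed

lemma piecewise_linear_sum:
  "finite I \<Longrightarrow> (\<And>i. i \<in> I \<Longrightarrow> piecewise_linear (f i)) \<Longrightarrow> piecewise_linear (\<lambda>\<tau>. \<Sum>i\<in>I. f i \<tau>)"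
proof (induction I rule: finite_induct)
  case empty
  show ?case using piecewise_linear_const[of 0] by simp
next
  case (insert i I)
  then show ?case using piecewise_linear_add[of "f i" "\<lambda>\<tau>. \<Sum>i\<in>I. f i \<tau>"] by simp
qed

text \<open>The gluing point a is added to the break points; on an interval that starts at a,
  \<open>f a = g a\<close> lets the second branch cover the left end too.\<close>

lemma piecewise_linear_if:
  assumes "piecewise_linear f" "piecewise_linear g" "f a = g a"
  shows "piecewise_linear (\<lambda>\<tau>. if \<tau> \<le> a then f \<tau> else g \<tau>)"
proof -
  obtain B where B: "finite B" "\<And>s t. 0 \<le> s \<Longrightarrow> s \<le> t \<Longrightarrow> t \<le> 1 \<Longrightarrow> {s<..<t} \<inter> B = {} \<Longrightarrow>
      \<exists>c d. \<forall>\<tau>\<in>{s..t}. f \<tau> = c + \<tau> *\<^sub>R d"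
    by (rule piecewise_linearE[OF assms(1)]) (rule that)
  obtain C where C: "finite C" "\<And>s t. 0 \<le> s \<Longrightarrow> s \<le> t \<Longrightarrow> t \<le> 1 \<Longrightarrow> {s<..<t} \<inter> C = {} \<Longrightarrow>
      \<exists>c d. \<forall>\<tau>\<in>{s..t}. g \<tau> = c + \<tau> *\<^sub>R d"
    by (rule piecewise_linearE[OF assms(2)]) (rule that)
  show ?thesis
  proof (rule piecewise_linearI[of "insert a (B \<union> C)"])
    fix s t :: real assume st: "0 \<le> s" "s \<le> t" "t \<le> 1" "{s<..<t} \<inter> insert a (B \<union> C) = {}"
    then have BC: "{s<..<t} \<inter> B = {}" "{s<..<t} \<inter> C = {}" and a: "t \<le> a \<or> a \<le> s" by auto
    have "(\<forall>\<tau>\<in>{s..t}. (if \<tau> \<le> a then f \<tau> else g \<tau>) = f \<tau>) \<or>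
        (\<forall>\<tau>\<in>{s..t}. (if \<tau> \<le> a then f \<tau> else g \<tau>) = g \<tau>)"
      using a
    proof
      assume "t \<le> a"
      then show ?thesis by auto
    next
      assume "a \<le> s"
      then have "(if \<tau> \<le> a then f \<tau> else g \<tau>) = g \<tau>" if "\<tau> \<in> {s..t}" for \<tau>
        using that assms(3) by (cases "\<tau> = a") auto
      then show ?thesis by blast
    qed
    then show "\<exists>c d. \<forall>\<tau>\<in>{s..t}. (if \<tau> \<le> a then f \<tau> else g \<tau>) = c + \<tau> *\<^sub>R d"
      using B(2)[OF st(1-3) BC(1)] C(2)[OF st(1-3) BC(2)] by metis
  qed (use B C in simp)
qed

text \<open>The interval is kept general so that the induction over break points can cut it at the
  point just added.\<close>

lemma continuous_on_affine_pieces: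
  fixes f :: "real \<Rightarrow> 'a::real_normed_vector"
  assumes "finite B"
    "\<And>s t. p \<le> s \<Longrightarrow> s \<le> t \<Longrightarrow> t \<le> q \<Longrightarrow> {s<..<t} \<inter> B = {} \<Longrightarrow> \<exists>c d. \<forall>\<tau>\<in>{s..t}. f \<tau> = c + \<tau> *\<^sub>R d"
  shows "continuous_on {p..q} f"
  using assms
proof (induction B arbitrary: p q rule: finite_induct)
  case empty
  show ?case
  proof (cases "p \<le> q")
    case True
    with empty obtain c d where "\<forall>\<tau>\<in>{p..q}. f \<tau> = c + \<tau> *\<^sub>R d"
      by (metis Int_empty_right order_refl)
    moreover have "continuous_on {p..q} (\<lambda>\<tau>. c + \<tau> *\<^sub>R d)" by (intro continuous_intros)
    ultimately show ?thesis by (metis (mono_tags, lifting) continuous_on_cong)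
  qed simp
next
  case (insert b B)
  show ?case
  proof (cases "p < b \<and> b < q")
    case True
    have "continuous_on {p..b} f" "continuous_on {b..q} f"
      using True by (auto intro!: insert.IH insert.prems)
    then have "continuous_on ({p..b} \<union> {b..q}) f"
      by (intro continuous_on_closed_Un) auto
    moreover have "{p..b} \<union> {b..q} = {p..q}" using True by auto
    ultimately show ?thesis by simp
  next
    case False
    then show ?thesis
      by (intro insert.IH insert.prems) auto
  qed
qed

lemma piecewise_linear_continuous:
  fixes f :: "real \<Rightarrow> 'a::real_normed_vector"
  assumes "piecewise_linear f"
  shows "continuous_on {0..1} f"
proof -
  obtain B where "finite B" "\<And>s t. 0 \<le> s \<Longrightarrow> s \<le> t \<Longrightarrow> t \<le> 1 \<Longrightarrow> {s<..<t} \<inter> B = {} \<Longrightarrow>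
      \<exists>c d. \<forall>\<tau>\<in>{s..t}. f \<tau> = c + \<tau> *\<^sub>R d"
    by (rule piecewise_linearE[OF assms]) (rule that)
  then show ?thesis by (rule continuous_on_affine_pieces)
qed

section \<open>Coordinates of weights\<close>

lemma fst_sum_fun: "fst (\<Sum>i\<in>I. f i) k = (\<Sum>i\<in>I. fst (f i) k)"
  for f :: "'i \<Rightarrow> weight"
  by (induction I rule: infinite_finite_induct) auto

lemma snd_sum_weight: "snd (\<Sum>i\<in>I. f i) = (\<Sum>i\<in>I. snd (f i))"
  for f :: "'i \<Rightarrow> weight"
  by (induction I rule: infinite_finite_induct) auto

lemma weight_eq_iff: "\<mu> = \<nu> \<longleftrightarrow> (\<forall>i. fst \<mu> i = fst \<nu> i) \<and> snd \<mu> = snd \<nu>" for \<mu> \<nu> :: weight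
  by (auto simp: prod_eq_iff)

lemma fst_fund_weight_expansion:
  "fst ((\<Sum>i\<le>l. c i *\<^sub>R fund_weight i) + d *\<^sub>R delta) k = (if k \<le> l then c k else 0)"
proof -
  have "fst (\<Sum>i\<le>l. c i *\<^sub>R fund_weight i) k = (\<Sum>i\<le>l. if k = i then c i else 0)"
    unfolding fst_sum_fun by (intro sum.cong refl) (simp add: scaleR_fun_def fund_weight_def)
  then show ?thesis by (simp add: delta_def scaleR_fun_def)
qed

lemma snd_fund_weight_expansion: "snd ((\<Sum>i\<le>l. c i *\<^sub>R fund_weight i) + d *\<^sub>R delta) = d"
  by (simp add: snd_sum_weight fund_weight_def delta_def)

lemma real_weights_iff: "\<mu> \<in> real_weights l \<longleftrightarrow> (\<forall>i>l. fst \<mu> i = 0)"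
proof
  assume "\<mu> \<in> real_weights l"
  then show "\<forall>i>l. fst \<mu> i = 0"
    unfolding real_weights_def by (auto simp: fst_fund_weight_expansion simp del: fst_add)
next
  assume "\<forall>i>l. fst \<mu> i = 0"
  then have "\<mu> = (\<Sum>i\<le>l. fst \<mu> i *\<^sub>R fund_weight i) + snd \<mu> *\<^sub>R delta"
    unfolding weight_eq_iff fst_fund_weight_expansion snd_fund_weight_expansion by auto
  then show "\<mu> \<in> real_weights l" unfolding real_weights_def by blast
qed

lemma weight_lattice_iff:
  "\<mu> \<in> weight_lattice l \<longleftrightarrow> (\<forall>i>l. fst \<mu> i = 0) \<and> (\<forall>i. fst \<mu> i \<in> \<int>) \<and> snd \<mu> \<in> \<int>"
proof
  assume "\<mu> \<in> weight_lattice l"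
  then obtain c d where "\<mu> = (\<Sum>i\<le>l. of_int (c i) *\<^sub>R fund_weight i) + of_int d *\<^sub>R delta"
    unfolding weight_lattice_def by blast
  then show "(\<forall>i>l. fst \<mu> i = 0) \<and> (\<forall>i. fst \<mu> i \<in> \<int>) \<and> snd \<mu> \<in> \<int>"
    by (simp only: fst_fund_weight_expansion snd_fund_weight_expansion) auto
next
  assume *: "(\<forall>i>l. fst \<mu> i = 0) \<and> (\<forall>i. fst \<mu> i \<in> \<int>) \<and> snd \<mu> \<in> \<int>"
  then have "\<mu> = (\<Sum>i\<le>l. of_int \<lfloor>fst \<mu> i\<rfloor> *\<^sub>R fund_weight i) + of_int \<lfloor>snd \<mu>\<rfloor> *\<^sub>R delta"
    unfolding weight_eq_iff fst_fund_weight_expansion snd_fund_weight_expansion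
    by (auto simp: floor_of_int elim!: Ints_cases)
  then show "\<mu> \<in> weight_lattice l" unfolding weight_lattice_def
    by (intro CollectI exI[of _ "\<lambda>i. \<lfloor>fst \<mu> i\<rfloor>"] exI[of _ "\<lfloor>snd \<mu>\<rfloor>"] conjI TrueI)
qed

lemma coroot_add: "coroot i (\<mu> + \<nu>) = coroot i \<mu> + coroot i \<nu>"
  and coroot_diff: "coroot i (\<mu> - \<nu>) = coroot i \<mu> - coroot i \<nu>"
  and coroot_scaleR: "coroot i (c *\<^sub>R \<mu>) = c * coroot i \<mu>"
  and coroot_zero [simp]: "coroot i 0 = 0"
  by (simp_all add: coroot_def scaleR_fun_def)

lemma coroot_sum: "coroot i (\<Sum>j\<in>J. f j) = (\<Sum>j\<in>J. coroot i (f j))"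
  by (simp add: coroot_def fst_sum_fun)

lemma linear_coroot: "linear (coroot i)"
  by (rule linearI) (simp_all add: coroot_add coroot_scaleR)

lemma linear_simple_refl: "linear (simple_refl l i)"
  by (rule linearI) (simp_all add: simple_refl_def coroot_add coroot_scaleR algebra_simps)

lemma fst_simple_root:
  assumes "i \<le> l"
  shows "fst (simple_root l i) j \<in> \<int>" "l < j \<Longrightarrow> fst (simple_root l i) j = 0"
proof -
  show "fst (simple_root l i) j \<in> \<int>"
    by (simp add: simple_root_def fund_weight_def delta_def scaleR_fun_def)
  assume "l < j"
  moreover have "k mod (l + 1) \<le> l" for k
    by (simp add: less_Suc_eq_le[symmetric])
  ultimately have "j \<noteq> k mod (l + 1)" for k
    by (metis not_le)
  with assms \<open>l < j\<close> show "fst (simple_root l i) j = 0"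
    unfolding simple_root_def by (simp add: fund_weight_def delta_def scaleR_fun_def)
qed

lemma snd_simple_root: "snd (simple_root l i) = (if i = 0 then 1 else 0)"
  by (simp add: simple_root_def fund_weight_def delta_def)

text \<open>
  The common form of \<open>e\<^sub>i\<close> and \<open>f\<^sub>i\<close>: the pairing of \<open>b c - b a\<close> with the coroot
  is \<open>-1\<close> for \<open>e\<^sub>i\<close> and \<open>1\<close> for \<open>f\<^sub>i\<close>.
\<close>

definition seg_refl :: "nat \<Rightarrow> nat \<Rightarrow> real \<Rightarrow> real \<Rightarrow> (real \<Rightarrow> weight) \<Rightarrow> real \<Rightarrow> weight"
  where "seg_refl l i a c b \<tau> =
    (if \<tau> \<le> a then b \<tau> else if \<tau> \<le> c then simple_refl l i (b \<tau> - b a) + b a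
     else b \<tau> - coroot i (b c - b a) *\<^sub>R simple_root l i)"

lemma piecewise_linear_seg_refl:
  assumes "piecewise_linear b" "a \<le> c"
  shows "piecewise_linear (seg_refl l i a c b)"
proof -
  have *: "piecewise_linear (\<lambda>\<tau>. b \<tau> - v)" for v
    using piecewise_linear_add[OF assms(1) piecewise_linear_const[of "- v"]] by simp
  show ?thesis
    unfolding seg_refl_def using assms
    by (intro piecewise_linear_if piecewise_linear_add piecewise_linear_const * assms(1)
        piecewise_linear_linear_image[OF _ linear_simple_refl]) (auto simp: simple_refl_def)
qed

lemma seg_refl_in_pl_paths:
  assumes "b \<in> pl_paths l" "i \<le> l" "0 \<le> a" "a \<le> c" "c \<le> 1" "coroot i (b c - b a) \<in> \<int>"
  shows "seg_refl l i a c b \<in> pl_paths l"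
proof -
  have b: "piecewise_linear b" "\<And>\<tau>. \<tau> \<in> {0..1} \<Longrightarrow> b \<tau> \<in> real_weights l" "b 0 = 0" "b 1 \<in> weight_lattice l"
    using assms(1) by (auto simp: pl_paths_def)
  have b01: "fst (b \<tau>) k = 0" if "\<tau> \<in> {0..1}" "l < k" for \<tau> k
    using b(2)[OF that(1)] that(2) by (simp add: real_weights_iff)
  have "seg_refl l i a c b \<tau> \<in> real_weights l" if "\<tau> \<in> {0..1}" for \<tau>
    unfolding real_weights_iff seg_refl_def simple_refl_def
    using that assms(3-5) by (simp add: scaleR_fun_def b01 fst_simple_root(2)[OF assms(2)])
  moreover have eq1: "seg_refl l i a c b 1 = b 1 - coroot i (b c - b a) *\<^sub>R simple_root l i"
  proof (cases "c = 1")
    case True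
    then show ?thesis using assms(4) by (auto simp: seg_refl_def simple_refl_def)
  next
    case False
    then have "\<not> 1 \<le> c" "\<not> 1 \<le> a" using assms(4,5) by auto
    then show ?thesis by (simp add: seg_refl_def)
  qed
  moreover have "b 1 - coroot i (b c - b a) *\<^sub>R simple_root l i \<in> weight_lattice l"
    using b(4) assms(6) fst_simple_root[OF assms(2)] snd_simple_root[of l i]
    by (simp add: weight_lattice_iff scaleR_fun_def)
  moreover have "seg_refl l i a c b 0 = 0"
    using assms(3) b(3) by (simp add: seg_refl_def)
  ultimately show ?thesis
    using piecewise_linear_seg_refl[OF b(1) assms(4)] by (auto simp: pl_paths_def)
qed

text \<open>As \<phi> may be constant next to \<open>a'\<close> or \<open>c'\<close>, the times
  \<open>\<tau>\<close> and \<open>\<phi> \<tau>\<close> can fall into different branches of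
  \<open>seg_refl\<close>; this does no harm because neighbouring branches agree at the break
  points.\<close>

lemma reparametrizes_seg_refl:
  assumes "mono_on {0..1} \<phi>" "\<And>\<tau>. \<tau> \<in> {0..1} \<Longrightarrow> b' \<tau> = b (\<phi> \<tau>)"
    and "0 \<le> a'" "a' \<le> c'" "c' \<le> 1" "\<tau> \<in> {0..1}"
  shows "seg_refl l i a' c' b' \<tau> = seg_refl l i (\<phi> a') (\<phi> c') b (\<phi> \<tau>)"
proof -
  have ba: "b' a' = b (\<phi> a')" "b' c' = b (\<phi> c')" "b' \<tau> = b (\<phi> \<tau>)"
    using assms by auto
  have mono: "\<phi> s \<le> \<phi> t" if "s \<le> t" "0 \<le> s" "t \<le> 1" for s t
    using assms(1) that by (auto simp: mono_on_def)
  have m: "\<tau> \<le> a' \<Longrightarrow> \<phi> \<tau> \<le> \<phi> a'" "a' \<le> \<tau> \<Longrightarrow> \<phi> a' \<le> \<phi> \<tau>" "\<tau> \<le> c' \<Longrightarrow> \<phi> \<tau> \<le> \<phi> c'"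
    "c' \<le> \<tau> \<Longrightarrow> \<phi> c' \<le> \<phi> \<tau>" "\<phi> a' \<le> \<phi> c'"
    using assms by (auto intro: mono)
  consider "\<tau> \<le> a'" | "a' < \<tau>" "\<tau> \<le> c'" | "c' < \<tau>" by linarith
  then show ?thesis
  proof cases
    case 1
    then show ?thesis using m ba by (simp add: seg_refl_def)
  next
    case 2
    then show ?thesis using m(2,3) ba by (auto simp: seg_refl_def simple_refl_def)
  next
    case 3
    then have "\<not> \<tau> \<le> a'" "\<not> \<tau> \<le> c'" using assms by auto
    with 3 show ?thesis using m(4,5) ba by (auto simp: seg_refl_def simple_refl_def)
  qed
qed


section \<open>Root operators on path classes\<close>

lemma equivclp_invariant:
  assumes "equivclp r x y" "\<And>x y. r x y \<Longrightarrow> g x = g y"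
  shows "g x = g y"
  using assms(1)
proof (induction rule: equivclp_induct)
  case (step y z)
  then show ?case using assms(2)[of y z] assms(2)[of z y] by metis
qed simp

lemma path_equiv_invariant:
  assumes "(b, b') \<in> path_equiv l" "\<And>x y. reparametrizes l x y \<Longrightarrow> g x = g y"
  shows "g b = g b'"
proof (rule equivclp_invariant[of "reparametrizes l" b b' g, OF _ assms(2)])
  show "equivclp (reparametrizes l) b b'"
    using assms(1) by (simp add: path_equiv_def)
qed

lemma path_class_self: "b \<in> pl_paths l \<Longrightarrow> b \<in> path_class l b"
  unfolding path_class_def by (rule equiv_class_self[OF equiv_path_equiv])

lemma path_class_eqI:
  assumes "reparametrizes l b b'"
  shows "path_class l b = path_class l b'"
proof -
  have "(b, b') \<in> path_equiv l"
    using assms r_into_equivclp[of "reparametrizes l" b b'] by (auto simp: path_equiv_def reparametrizes_def)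
  then show ?thesis
    unfolding path_class_def by (rule equiv_class_eq[OF equiv_path_equiv])
qed

lemma path_class_invariant:
  assumes "b' \<in> path_class l b" "\<And>x y. reparametrizes l x y \<Longrightarrow> g x = g y"
  shows "g b' = g b"
proof (rule sym, rule path_equiv_invariant[of b b' l g, OF _ assms(2)])
  show "(b, b') \<in> path_equiv l"
    using assms(1) by (simp add: path_class_def)
qed

text \<open>Reduces an operation on classes to a computation with any chosen representative;
  invariance under a single reparametrization passes to the generated equivalence.\<close>

lemma the_elem_path_class:
  assumes "b \<in> pl_paths l" "\<And>x y. reparametrizes l x y \<Longrightarrow> g x = g y"
  shows "the_elem (g ` path_class l b) = g b"
proof -
  have "g b' = g b" if "b' \<in> path_class l b" for b'
    using that by (rule path_class_invariant[of b' l b g]) (rule assms(2))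
  then have "g ` path_class l b = {g b}"
    using path_class_self[OF assms(1)] by blast
  then show ?thesis by simp
qed

lemma wt_path_class: "b \<in> pl_paths l \<Longrightarrow> wt (path_class l b) = b 1"
  unfolding wt_def by (rule the_elem_path_class[of b l "\<lambda>b. b 1"]) (auto simp: reparametrizes_def)

lemma path_class_cong:
  assumes "b \<in> pl_paths l" "b' \<in> pl_paths l" "\<And>\<tau>. \<tau> \<in> {0..1} \<Longrightarrow> b \<tau> = b' \<tau>"
  shows "path_class l b = path_class l b'"
proof (rule path_class_eqI)
  have "piecewise_linear (\<lambda>\<tau> :: real. \<tau>)"
    using piecewise_linear_affine[of "0 :: real" 1] by simp
  then show "reparametrizes l b b'"
    unfolding reparametrizes_def using assms
    by (intro conjI exI[of _ "\<lambda>\<tau>. \<tau>"]) (auto simp: mono_on_def)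
qed

lemma monotone_surj:
  assumes "piecewise_linear \<phi>" "mono_on {0..1} \<phi>" "\<phi> 0 = 0" "\<phi> 1 = (1::real)"
  shows "\<phi> ` {0..1} = {0..1}"
proof
  show "\<phi> ` {0..1} \<subseteq> {0..1}"
  proof (rule image_subsetI)
    fix \<tau> :: real assume "\<tau> \<in> {0..1}"
    then show "\<phi> \<tau> \<in> {0..1}"
      using mono_onD[OF assms(2), of 0 \<tau>] mono_onD[OF assms(2), of \<tau> 1] assms(3,4) by simp
  qed
  show "{0..1} \<subseteq> \<phi> ` {0..1}"
  proof
    fix y :: real assume "y \<in> {0..1}"
    then obtain x where "0 \<le> x" "x \<le> 1" "\<phi> x = y"
      using IVT'[of \<phi> 0 y 1] piecewise_linear_continuous[OF assms(1)] assms(3,4) by auto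
    then show "y \<in> \<phi> ` {0..1}" by (intro image_eqI[of _ _ x]) auto
  qed
qed

lemma h_fun_continuous:
  assumes "b \<in> pl_paths l"
  shows "continuous_on {0..1} (h_fun i b)"
proof -
  have "piecewise_linear (\<lambda>\<tau>. coroot i (b \<tau>))"
    using assms by (intro piecewise_linear_linear_image[OF _ linear_coroot]) (simp add: pl_paths_def)
  then have "continuous_on {0..1} (\<lambda>\<tau>. - coroot i (b \<tau>))"
    by (intro continuous_on_minus piecewise_linear_continuous)
  then show ?thesis by (simp add: h_fun_def[abs_def])
qed

lemma h_fun_0: "b \<in> pl_paths l \<Longrightarrow> h_fun i b 0 = 0"
  by (simp add: pl_paths_def h_fun_def)

lemma h_fun_1_Ints: "b \<in> pl_paths l \<Longrightarrow> h_fun i b 1 \<in> \<int>"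
  by (simp add: pl_paths_def h_fun_def weight_lattice_iff coroot_def)

lemma finite_Ints_bounded:
  assumes "bounded S"
  shows "finite (\<int> \<inter> S :: real set)"
proof -
  obtain c where c: "\<And>x. x \<in> S \<Longrightarrow> \<bar>x\<bar> \<le> c"
    using assms by (auto simp: bounded_iff)
  have "\<int> \<inter> S \<subseteq> of_int ` {- \<lceil>c\<rceil>..\<lceil>c\<rceil>}"
  proof
    fix x assume "x \<in> \<int> \<inter> S"
    then obtain k where k: "x = of_int k" "x \<in> S" by (auto elim: Ints_cases)
    then have "k \<in> {- \<lceil>c\<rceil>..\<lceil>c\<rceil>}"
      using c[OF k(2)] by (simp add: abs_le_iff le_ceiling_iff) linarith
    with k show "x \<in> of_int ` {- \<lceil>c\<rceil>..\<lceil>c\<rceil>}" by blast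
  qed
  then show ?thesis by (rule finite_subset) simp
qed

lemma finite_int_values:
  assumes "b \<in> pl_paths l"
  shows "finite (\<int> \<inter> h_fun i b ` {0..1})"
proof -
  have "compact (h_fun i b ` {0..1})"
    using h_fun_continuous[OF assms] by (intro compact_continuous_image) auto
  then show ?thesis by (intro finite_Ints_bounded compact_imp_bounded)
qed

lemma eps_properties:
  assumes "b \<in> pl_paths l"
  shows "eps i b \<in> \<int>" "eps i b \<in> h_fun i b ` {0..1}" "0 \<le> eps i b"
    "\<And>\<tau>. \<tau> \<in> {0..1} \<Longrightarrow> h_fun i b \<tau> \<in> \<int> \<Longrightarrow> h_fun i b \<tau> \<le> eps i b"
proof -
  let ?S = "\<int> \<inter> h_fun i b ` {0..1}"
  have fin: "finite ?S" by (rule finite_int_values[OF assms])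
  have S: "0 \<in> ?S"
    using h_fun_0[OF assms, of i] by (auto intro!: image_eqI[of _ _ 0])
  then have "eps i b \<in> ?S" unfolding eps_def by (intro Max_in fin) blast
  then show "eps i b \<in> \<int>" "eps i b \<in> h_fun i b ` {0..1}" by auto
  show "0 \<le> eps i b" unfolding eps_def using S by (intro Max_ge fin)
  show "h_fun i b \<tau> \<le> eps i b" if "\<tau> \<in> {0..1}" "h_fun i b \<tau> \<in> \<int>" for \<tau>
    unfolding eps_def using that by (intro Max_ge fin) auto
qed

lemma eps_eqI:
  assumes "b \<in> pl_paths l" "e \<in> \<int>" "e \<in> h_fun i b ` {0..1}" "\<And>\<tau>. \<tau> \<in> {0..1} \<Longrightarrow> h_fun i b \<tau> \<le> e"
  shows "eps i b = e"
  unfolding eps_def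
proof (rule Max_eqI[OF finite_int_values[OF assms(1)]])
  show "e \<in> \<int> \<inter> h_fun i b ` {0..1}" using assms by blast
  show "y \<le> e" if "y \<in> \<int> \<inter> h_fun i b ` {0..1}" for y
    using that assms(4) by blast
qed

text \<open>This and the next three predicates describe the times e_+, e_-, f_+, f_-. Over the
  reals, \<open>LEAST\<close> and \<open>GREATEST\<close> carry information only once the extremum
  is known to be attained, and the predicates include the attainment.\<close>

definition e_end :: "nat \<Rightarrow> (real \<Rightarrow> weight) \<Rightarrow> real \<Rightarrow> bool"
  where "e_end i b c \<longleftrightarrow> c \<in> {0..1} \<and> h_fun i b c = eps i b \<and>
    (\<forall>\<tau>\<in>{0..1}. h_fun i b \<tau> = eps i b \<longrightarrow> c \<le> \<tau>)"

definition e_start :: "nat \<Rightarrow> (real \<Rightarrow> weight) \<Rightarrow> real \<Rightarrow> real \<Rightarrow> bool"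
  where "e_start i b c a \<longleftrightarrow> a \<in> {0..c} \<and> h_fun i b a = eps i b - 1 \<and>
    (\<forall>\<tau>\<in>{0..c}. h_fun i b \<tau> = eps i b - 1 \<longrightarrow> \<tau> \<le> a)"

definition f_start :: "nat \<Rightarrow> (real \<Rightarrow> weight) \<Rightarrow> real \<Rightarrow> bool"
  where "f_start i b a \<longleftrightarrow> a \<in> {0..1} \<and> h_fun i b a = eps i b \<and>
    (\<forall>\<tau>\<in>{0..1}. h_fun i b \<tau> = eps i b \<longrightarrow> \<tau> \<le> a)"

definition f_end :: "nat \<Rightarrow> (real \<Rightarrow> weight) \<Rightarrow> real \<Rightarrow> real \<Rightarrow> bool"
  where "f_end i b a c \<longleftrightarrow> c \<in> {a..1} \<and> h_fun i b c = eps i b - 1 \<and>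
    (\<forall>\<tau>\<in>{a..1}. h_fun i b \<tau> = eps i b - 1 \<longrightarrow> c \<le> \<tau>)"

lemma e_path_eq:
  assumes "e_end i b c"
  shows "c = 0 \<Longrightarrow> e_path l i b = None"
    "c \<noteq> 0 \<Longrightarrow> e_start i b c a \<Longrightarrow> e_path l i b = Some (seg_refl l i a c b)"
proof -
  have c: "(LEAST \<tau>. \<tau> \<in> {0..1} \<and> h_fun i b \<tau> = eps i b) = c"
    using assms by (intro Least_equality) (auto simp: e_end_def)
  then show "c = 0 \<Longrightarrow> e_path l i b = None"
    by (simp add: e_path_def Let_def)
  assume *: "c \<noteq> 0" "e_start i b c a"
  then have a: "(GREATEST \<tau>. \<tau> \<in> {0..c} \<and> h_fun i b \<tau> = eps i b - 1) = a"
    by (intro Greatest_equality) (auto simp: e_start_def)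
  have "coroot i (b c - b a) = - 1"
    using * assms by (simp add: coroot_diff e_end_def e_start_def h_fun_def)
  then show "e_path l i b = Some (seg_refl l i a c b)"
    unfolding e_path_def Let_def c a using * by (auto simp: fun_eq_iff seg_refl_def)
qed

lemma f_path_eq:
  assumes "f_start i b a"
  shows "a = 1 \<Longrightarrow> f_path l i b = None"
    "a \<noteq> 1 \<Longrightarrow> f_end i b a c \<Longrightarrow> f_path l i b = Some (seg_refl l i a c b)"
proof -
  have a: "(GREATEST \<tau>. \<tau> \<in> {0..1} \<and> h_fun i b \<tau> = eps i b) = a"
    using assms by (intro Greatest_equality) (auto simp: f_start_def)
  then show "a = 1 \<Longrightarrow> f_path l i b = None"
    by (simp add: f_path_def Let_def)
  assume *: "a \<noteq> 1" "f_end i b a c"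
  then have c: "(LEAST \<tau>. \<tau> \<in> {a..1} \<and> h_fun i b \<tau> = eps i b - 1) = c"
    by (intro Least_equality) (auto simp: f_end_def)
  have "coroot i (b c - b a) = 1"
    using * assms by (simp add: coroot_diff f_end_def f_start_def h_fun_def)
  then show "f_path l i b = Some (seg_refl l i a c b)"
    unfolding f_path_def Let_def a c using * by (auto simp: fun_eq_iff seg_refl_def)
qed

lemma level_set_extrema:
  fixes h :: "real \<Rightarrow> real"
  assumes "continuous_on {p..q} h" "\<exists>\<tau>\<in>{p..q}. h \<tau> = v"
  shows "\<exists>a\<in>{p..q}. h a = v \<and> (\<forall>\<tau>\<in>{p..q}. h \<tau> = v \<longrightarrow> a \<le> \<tau>)"
    "\<exists>c\<in>{p..q}. h c = v \<and> (\<forall>\<tau>\<in>{p..q}. h \<tau> = v \<longrightarrow> \<tau> \<le> c)"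
proof -
  let ?S = "{\<tau> \<in> {p..q}. h \<tau> = v}"
  have "closed ?S"
    using assms by (intro continuous_closed_preimage_constant) auto
  then have "compact ({p..q} \<inter> ?S)"
    by (intro compact_Int_closed) auto
  moreover have "{p..q} \<inter> ?S = ?S" by auto
  ultimately have S: "compact ?S" "?S \<noteq> {}"
    using assms(2) by auto
  show "\<exists>a\<in>{p..q}. h a = v \<and> (\<forall>\<tau>\<in>{p..q}. h \<tau> = v \<longrightarrow> a \<le> \<tau>)"
    using compact_attains_inf[OF S] by auto
  show "\<exists>c\<in>{p..q}. h c = v \<and> (\<forall>\<tau>\<in>{p..q}. h \<tau> = v \<longrightarrow> \<tau> \<le> c)"
    using compact_attains_sup[OF S] by auto
qed

lemma e_end_exists:
  assumes "b \<in> pl_paths l"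
  shows "\<exists>c. e_end i b c"
proof -
  have "\<exists>\<tau>\<in>{0..1}. h_fun i b \<tau> = eps i b"
    using eps_properties(2)[OF assms, of i] by force
  from level_set_extrema(1)[OF h_fun_continuous[OF assms] this] show ?thesis
    unfolding e_end_def by blast
qed

lemma f_start_exists:
  assumes "b \<in> pl_paths l"
  shows "\<exists>c. f_start i b c"
proof -
  have "\<exists>\<tau>\<in>{0..1}. h_fun i b \<tau> = eps i b"
    using eps_properties(2)[OF assms, of i] by force
  from level_set_extrema(2)[OF h_fun_continuous[OF assms] this] show ?thesis
    unfolding f_start_def by blast
qed

lemma Ints_less_imp_le_diff_one: "x \<in> \<int> \<Longrightarrow> y \<in> \<int> \<Longrightarrow> x < y \<Longrightarrow> x \<le> y - 1" for x y :: real
proof -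
  assume "x \<in> \<int>" "y \<in> \<int>" "x < y"
  then obtain i j where "x = of_int i" "y = of_int j" "i < j"
    by (elim Ints_cases) simp
  then show "x \<le> y - 1" by linarith
qed

text \<open>If the first maximal time is not 0, then \<open>eps\<close> is a positive integer, so
  the level \<open>eps - 1\<close> lies between the initial value 0 and \<open>eps\<close> and is
  crossed.\<close>

lemma e_start_exists:
  assumes b: "b \<in> pl_paths l" and c: "e_end i b c" "c \<noteq> 0"
  shows "\<exists>a. e_start i b c a"
proof -
  have c01: "0 \<le> c" "c \<le> 1" using c(1) by (auto simp: e_end_def)
  have "0 \<noteq> eps i b"
    using c h_fun_0[OF b, of i] by (auto simp: e_end_def)
  then have "0 \<le> eps i b - 1"
    using eps_properties(1,3)[OF b, of i] Ints_less_imp_le_diff_one[of 0 "eps i b"] by auto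
  moreover have cont: "continuous_on {0..c} (h_fun i b)"
    by (rule continuous_on_subset[OF h_fun_continuous[OF b]]) (use c01 in auto)
  ultimately have "\<exists>\<tau>\<ge>0. \<tau> \<le> c \<and> h_fun i b \<tau> = eps i b - 1"
    using IVT'[of "h_fun i b" 0 "eps i b - 1" c] h_fun_0[OF b, of i] c c01 by (auto simp: e_end_def)
  then have "\<exists>\<tau>\<in>{0..c}. h_fun i b \<tau> = eps i b - 1" by auto
  from level_set_extrema(2)[OF cont this] show ?thesis
    unfolding e_start_def by blast
qed

text \<open>The path ends in the lattice, so the final value of \<open>h_fun\<close> is an integer
  below \<open>eps\<close>, hence at most \<open>eps - 1\<close>, and that level is crossed.\<close>

lemma f_end_exists:
  assumes b: "b \<in> pl_paths l" and a: "f_start i b a" "a \<noteq> 1"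
  shows "\<exists>c. f_end i b a c"
proof -
  have a01: "0 \<le> a" "a \<le> 1" using a(1) by (auto simp: f_start_def)
  have "h_fun i b 1 \<noteq> eps i b"
    using a by (auto simp: f_start_def)
  moreover have "h_fun i b 1 \<le> eps i b"
    by (rule eps_properties(4)[OF b]) (auto simp: h_fun_1_Ints[OF b])
  ultimately have "h_fun i b 1 \<le> eps i b - 1"
    using eps_properties(1)[OF b, of i] h_fun_1_Ints[OF b, of i]
      Ints_less_imp_le_diff_one[of "h_fun i b 1" "eps i b"] by linarith
  moreover have cont: "continuous_on {a..1} (h_fun i b)"
    by (rule continuous_on_subset[OF h_fun_continuous[OF b]]) (use a01 in auto)
  ultimately have "\<exists>\<tau>\<ge>a. \<tau> \<le> 1 \<and> h_fun i b \<tau> = eps i b - 1"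
    using IVT2'[of "h_fun i b" 1 "eps i b - 1" a] a a01 by (auto simp: f_start_def)
  then have "\<exists>\<tau>\<in>{a..1}. h_fun i b \<tau> = eps i b - 1" by auto
  from level_set_extrema(1)[OF cont this] show ?thesis
    unfolding f_end_def by blast
qed

lemma reparametrizes_seg_refl_class:
  assumes "reparametrizes l b b'" "i \<le> l"
    and phi: "mono_on {0..1} \<phi>" "piecewise_linear \<phi>" "\<phi> 0 = 0" "\<phi> 1 = (1 :: real)"
      "\<And>\<tau>. \<tau> \<in> {0..1} \<Longrightarrow> b' \<tau> = b (\<phi> \<tau>)"
    and ac: "0 \<le> a'" "a' \<le> c'" "c' \<le> 1" "\<phi> a' = a" "\<phi> c' = c" "coroot i (b c - b a) \<in> \<int>"
  shows "path_class l (seg_refl l i a c b) = path_class l (seg_refl l i a' c' b')"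
proof (rule path_class_eqI)
  have mono: "\<phi> s \<le> \<phi> t" if "s \<le> t" "0 \<le> s" "t \<le> 1" for s t
    using mono_onD[OF phi(1)] that by auto
  have b: "b \<in> pl_paths l" "b' \<in> pl_paths l" using assms(1) by (auto simp: reparametrizes_def)
  have ac': "0 \<le> a" "a \<le> c" "c \<le> 1"
    using mono[of 0 a'] mono[of a' c'] mono[of c' 1] ac phi(3,4) by auto
  have "a' \<in> {0..1}" "c' \<in> {0..1}" using ac by auto
  then have eq: "b' c' - b' a' = b c - b a"
    using phi(5) ac(4,5) by simp
  have "seg_refl l i a c b \<in> pl_paths l" "seg_refl l i a' c' b' \<in> pl_paths l"
    by (rule seg_refl_in_pl_paths; use b assms(2) ac ac' eq in simp)+
  moreover have "\<forall>\<tau>\<in>{0..1}. seg_refl l i a' c' b' \<tau> = seg_refl l i a c b (\<phi> \<tau>)"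
    using reparametrizes_seg_refl[of \<phi> b' b a' c' _ l i, OF phi(1) phi(5) ac(1-3)] ac(4,5) by simp
  ultimately show "reparametrizes l (seg_refl l i a c b) (seg_refl l i a' c' b')"
    unfolding reparametrizes_def using phi(1-4) by blast
qed

lemma reparametrizesE:
  assumes "reparametrizes l b b'"
  obtains \<phi> where "b \<in> pl_paths l" "b' \<in> pl_paths l" "piecewise_linear \<phi>" "mono_on {0..1} \<phi>"
    "\<phi> 0 = 0" "\<phi> 1 = 1" "\<forall>\<tau>\<in>{0..1}. b' \<tau> = b (\<phi> \<tau>)" "\<phi> ` {0..1} = {0..1}"
    "\<forall>i. \<forall>\<tau>\<in>{0..1}. h_fun i b' \<tau> = h_fun i b (\<phi> \<tau>)" "\<forall>i. eps i b' = eps i b"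
proof -
  from assms obtain \<phi> where phi: "b \<in> pl_paths l" "b' \<in> pl_paths l" "piecewise_linear \<phi>"
    "mono_on {0..1} \<phi>" "\<phi> 0 = 0" "\<phi> 1 = 1" "\<forall>\<tau>\<in>{0..1}. b' \<tau> = b (\<phi> \<tau>)"
    unfolding reparametrizes_def by blast
  have surj: "\<phi> ` {0..1} = {0..1}"
    by (rule monotone_surj[OF phi(3-6)])
  have h: "\<forall>i. \<forall>\<tau>\<in>{0..1}. h_fun i b' \<tau> = h_fun i b (\<phi> \<tau>)"
    using phi(7) by (simp add: h_fun_def)
  have "h_fun i b' ` {0..1} = h_fun i b ` (\<phi> ` {0..1})" for i
    using h by (auto simp: image_image)
  then have "\<forall>i. eps i b' = eps i b"
    by (simp add: surj eps_def)
  with phi surj h that show ?thesis by blast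
qed

text \<open>The monotone surjection \<phi> carries the extremal times of \<open>b'\<close> to those
  of \<open>b\<close>: a preimage of the extremal time of \<open>b\<close> gives one inequality, the
  value of \<open>h_fun\<close> at the image of the extremal time of \<open>b'\<close> gives the
  other.\<close>

lemma e_path_reparametrizes:
  assumes "reparametrizes l b b'" "i \<le> l"
  shows "map_option (path_class l) (e_path l i b) = map_option (path_class l) (e_path l i b')"
proof -
  from assms(1) obtain \<phi> where phi: "b \<in> pl_paths l" "b' \<in> pl_paths l" "piecewise_linear \<phi>" "mono_on {0..1} \<phi>"
    "\<phi> 0 = 0" "\<phi> 1 = 1" "\<forall>\<tau>\<in>{0..1}. b' \<tau> = b (\<phi> \<tau>)" "\<phi> ` {0..1} = {0..1}"
    "\<forall>i. \<forall>\<tau>\<in>{0..1}. h_fun i b' \<tau> = h_fun i b (\<phi> \<tau>)" "\<forall>i. eps i b' = eps i b"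
    by (rule reparametrizesE)
  have mono: "\<phi> s \<le> \<phi> t" if "s \<le> t" "0 \<le> s" "t \<le> 1" for s t
    using mono_onD[OF phi(4)] that by auto
  have surj: "\<exists>\<tau>\<in>{0..1}. \<phi> \<tau> = t" if "t \<in> {0..1}" for t
    using phi(8) that by (metis imageE)
  have rng: "\<phi> \<tau> \<in> {0..1}" if "\<tau> \<in> {0..1}" for \<tau>
    using phi(8) that by blast
  obtain c where c: "e_end i b c" using e_end_exists[OF phi(1)] by blast
  obtain c' where c': "e_end i b' c'" using e_end_exists[OF phi(2)] by blast
  have c01: "c \<in> {0..1}" "c' \<in> {0..1}" using c c' by (auto simp: e_end_def)
  obtain t where t: "t \<in> {0..1}" "\<phi> t = c" using surj[OF c01(1)] by blast
  have "h_fun i b' t = eps i b'" using t phi(9,10) c by (simp add: e_end_def)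
  then have "c' \<le> t" using c' t by (auto simp: e_end_def)
  then have "\<phi> c' \<le> c" using mono[of c' t] t c01 by auto
  moreover have "h_fun i b (\<phi> c') = eps i b"
    using c' bspec[OF spec[OF phi(9), of i] c01(2)] phi(10) by (simp add: e_end_def)
  then have "c \<le> \<phi> c'"
    using c rng[OF c01(2)] by (simp add: e_end_def)
  ultimately have pc: "\<phi> c' = c" by simp
  show ?thesis
  proof (cases "c = 0")
    case True
    then have "h_fun i b' 0 = eps i b'" using c phi(5,9,10) by (simp add: e_end_def)
    then have "c' = 0" using c' by (auto simp: e_end_def)
    with True show ?thesis using e_path_eq(1)[OF c] e_path_eq(1)[OF c'] by simp
  next
    case False
    then have c'0: "c' \<noteq> 0" using pc phi(5) by auto
    obtain a where a: "e_start i b c a" using e_start_exists[OF phi(1) c False] by blast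
    obtain a' where a': "e_start i b' c' a'" using e_start_exists[OF phi(2) c' c'0] by blast
    have a01: "0 \<le> a" "a \<le> c" "0 \<le> a'" "a' \<le> c'" using a a' by (auto simp: e_start_def)
    obtain s where s: "s \<in> {0..1}" "\<phi> s = a" using surj[of a] a01 c01 by auto
    \<comment> \<open>\<phi> need not be injective; that the preimage s of \<open>a\<close> lies
      before \<open>c'\<close> depends on \<open>a \<noteq> c\<close>.\<close>
    have "h_fun i b c = eps i b" "h_fun i b a = eps i b - 1"
      using a c by (simp_all add: e_start_def e_end_def)
    then have "a \<noteq> c" by auto
    then have "s \<le> c'"
      using mono[of c' s, unfolded pc s(2)] s(1) c01(2) a01(2) by (cases "c' \<le> s") auto
    moreover have "h_fun i b' s = eps i b' - 1" using s phi(9,10) a by (simp add: e_start_def)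
    ultimately have "s \<le> a'" using a' s by (auto simp: e_start_def)
    then have "a \<le> \<phi> a'" using mono[of s a'] s c01 a01 by auto
    moreover have "\<phi> a' \<le> a"
    proof -
      have "0 \<le> \<phi> a'" "\<phi> a' \<le> c" using mono[of a' c'] mono[of 0 a'] a01 c01 pc phi(5) by auto
      moreover have "h_fun i b (\<phi> a') = eps i b - 1"
        using bspec[OF spec[OF phi(9), of i], of a'] a' phi(10) a01 c01 by (simp add: e_start_def)
      ultimately show ?thesis using a by (simp add: e_start_def)
    qed
    ultimately have pa: "\<phi> a' = a" by simp
    have "coroot i (b c - b a) = - 1"
      using a c by (simp add: coroot_diff e_end_def e_start_def h_fun_def)
    then have "path_class l (seg_refl l i a c b) = path_class l (seg_refl l i a' c' b')"
      using a01 c01 phi(7)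
      by (intro reparametrizes_seg_refl_class[of l b b' i \<phi>, OF assms phi(4,3,5,6) _ _ _ _ pa pc]) auto
    then show ?thesis
      using e_path_eq(2)[OF c False a] e_path_eq(2)[OF c' c'0 a'] by simp
  qed
qed

lemma f_path_reparametrizes:
  assumes "reparametrizes l b b'" "i \<le> l"
  shows "map_option (path_class l) (f_path l i b) = map_option (path_class l) (f_path l i b')"
proof -
  from assms(1) obtain \<phi> where phi: "b \<in> pl_paths l" "b' \<in> pl_paths l" "piecewise_linear \<phi>" "mono_on {0..1} \<phi>"
    "\<phi> 0 = 0" "\<phi> 1 = 1" "\<forall>\<tau>\<in>{0..1}. b' \<tau> = b (\<phi> \<tau>)" "\<phi> ` {0..1} = {0..1}"
    "\<forall>i. \<forall>\<tau>\<in>{0..1}. h_fun i b' \<tau> = h_fun i b (\<phi> \<tau>)" "\<forall>i. eps i b' = eps i b"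
    by (rule reparametrizesE)
  have mono: "\<phi> s \<le> \<phi> t" if "s \<le> t" "0 \<le> s" "t \<le> 1" for s t
    using mono_onD[OF phi(4)] that by auto
  have surj: "\<exists>\<tau>\<in>{0..1}. \<phi> \<tau> = t" if "t \<in> {0..1}" for t
    using phi(8) that by (metis imageE)
  have rng: "\<phi> \<tau> \<in> {0..1}" if "\<tau> \<in> {0..1}" for \<tau>
    using phi(8) that by blast
  obtain a where a: "f_start i b a" using f_start_exists[OF phi(1)] by blast
  obtain a' where a': "f_start i b' a'" using f_start_exists[OF phi(2)] by blast
  have a01: "a \<in> {0..1}" "a' \<in> {0..1}" using a a' by (auto simp: f_start_def)
  obtain t where t: "t \<in> {0..1}" "\<phi> t = a" using surj[OF a01(1)] by blast
  have "h_fun i b' t = eps i b'" using t phi(9,10) a by (simp add: f_start_def)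
  then have "t \<le> a'" using a' t by (auto simp: f_start_def)
  then have "a \<le> \<phi> a'" using mono[of t a'] t a01 by auto
  moreover have "h_fun i b (\<phi> a') = eps i b"
    using a' bspec[OF spec[OF phi(9), of i] a01(2)] phi(10) by (simp add: f_start_def)
  then have "\<phi> a' \<le> a"
    using a rng[OF a01(2)] by (simp add: f_start_def)
  ultimately have pa: "\<phi> a' = a" by simp
  show ?thesis
  proof (cases "a = 1")
    case True
    then have "h_fun i b' 1 = eps i b'" using a phi(6,9,10) by (simp add: f_start_def)
    then have "a' = 1" using a' by (auto simp: f_start_def)
    with True show ?thesis using f_path_eq(1)[OF a] f_path_eq(1)[OF a'] by simp
  next
    case False
    then have a'1: "a' \<noteq> 1" using pa phi(6) by auto
    obtain c where c: "f_end i b a c" using f_end_exists[OF phi(1) a False] by blast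
    obtain c' where c': "f_end i b' a' c'" using f_end_exists[OF phi(2) a' a'1] by blast
    have c01: "a \<le> c" "c \<le> 1" "a' \<le> c'" "c' \<le> 1" using c c' by (auto simp: f_end_def)
    obtain s where s: "s \<in> {0..1}" "\<phi> s = c" using surj[of c] a01 c01 by auto
    have "h_fun i b a = eps i b" "h_fun i b c = eps i b - 1"
      using a c by (simp_all add: f_start_def f_end_def)
    then have "a \<noteq> c" by auto
    have "a' \<le> s"
    proof (rule ccontr)
      assume "\<not> a' \<le> s"
      then have "\<phi> s \<le> \<phi> a'"
        using s(1) a01(2) by (intro mono) auto
      then show False
        using \<open>a \<noteq> c\<close> c01(1) unfolding pa s(2) by linarith
    qed
    moreover have "h_fun i b' s = eps i b' - 1" using s phi(9,10) c by (simp add: f_end_def)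
    ultimately have "c' \<le> s" using c' s by (auto simp: f_end_def)
    then have "\<phi> c' \<le> c" using mono[of c' s] s c01 a01 by auto
    moreover have "c \<le> \<phi> c'"
    proof -
      have "\<phi> c' \<le> 1" "a \<le> \<phi> c'" using mono[of a' c'] mono[of c' 1] a01 c01 pa phi(6) by auto
      moreover have "h_fun i b (\<phi> c') = eps i b - 1"
        using bspec[OF spec[OF phi(9), of i], of c'] c' phi(10) a01 c01 by (simp add: f_end_def)
      ultimately show ?thesis using c by (simp add: f_end_def)
    qed
    ultimately have pc: "\<phi> c' = c" by simp
    have "coroot i (b c - b a) = 1"
      using a c by (simp add: coroot_diff f_end_def f_start_def h_fun_def)
    then have "path_class l (seg_refl l i a c b) = path_class l (seg_refl l i a' c' b')"
      using a01 c01 phi(7)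
      by (intro reparametrizes_seg_refl_class[of l b b' i \<phi>, OF assms phi(4,3,5,6) _ _ _ _ pa pc]) auto
    then show ?thesis
      using f_path_eq(2)[OF a False c] f_path_eq(2)[OF a' a'1 c'] by simp
  qed
qed

lemma e_op_path_class:
  assumes "b \<in> pl_paths l" "i \<le> l"
  shows "e_op l i (Some (path_class l b)) = map_option (path_class l) (e_path l i b)"
proof -
  have inv: "map_option (path_class l) (e_path l i b) = map_option (path_class l) (e_path l i b')"
    if "reparametrizes l b b'" for b b'
    using that assms(2) by (rule e_path_reparametrizes)
  have "the_elem ((\<lambda>b. map_option (path_class l) (e_path l i b)) ` path_class l b) =
      map_option (path_class l) (e_path l i b)"
    using the_elem_path_class[of b l "\<lambda>b. map_option (path_class l) (e_path l i b)", OF assms(1) inv] .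
  then show ?thesis
    by (simp add: e_op_def on_classes_def)
qed

lemma f_op_path_class:
  assumes "b \<in> pl_paths l" "i \<le> l"
  shows "f_op l i (Some (path_class l b)) = map_option (path_class l) (f_path l i b)"
proof -
  have inv: "map_option (path_class l) (f_path l i b) = map_option (path_class l) (f_path l i b')"
    if "reparametrizes l b b'" for b b'
    using that assms(2) by (rule f_path_reparametrizes)
  have "the_elem ((\<lambda>b. map_option (path_class l) (f_path l i b)) ` path_class l b) =
      map_option (path_class l) (f_path l i b)"
    using the_elem_path_class[of b l "\<lambda>b. map_option (path_class l) (f_path l i b)", OF assms(1) inv] .
  then show ?thesis
    by (simp add: f_op_def on_classes_def)
qed

section \<open>Polygonal paths coded by integer sequences\<close>

definition clamp :: "real \<Rightarrow> real"
  where "clamp t = max 0 (min 1 t)"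

text \<open>During the j-th of m equal time intervals the coefficient of \<open>v j\<close> climbs
  from 0 to 1 and all others stand still. Writing the path as one sum makes a change of one
  displacement a change of one summand.\<close>

definition poly_path :: "nat \<Rightarrow> (nat \<Rightarrow> weight) \<Rightarrow> real \<Rightarrow> weight"
  where "poly_path m v \<tau> = (\<Sum>j<m. clamp (real m * \<tau> - real j) *\<^sub>R v j)"

lemma piecewise_linear_clamp:
  assumes "0 < a"
  shows "piecewise_linear (\<lambda>\<tau>. clamp (a * \<tau> - b))"
proof -
  have aff: "piecewise_linear (\<lambda>\<tau>. a * \<tau> - b)"
    using piecewise_linear_affine[of "- b" a] by (simp add: mult.commute)
  have "piecewise_linear (\<lambda>\<tau>. if \<tau> \<le> b / a then 0 else if \<tau> \<le> (b + 1) / a then a * \<tau> - b else 1)"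
  proof (intro piecewise_linear_if piecewise_linear_const aff)
    have "b / a \<le> (b + 1) / a" using assms by (simp add: divide_right_mono)
    then show "0 = (if b / a \<le> (b + 1) / a then a * (b / a) - b else 1)"
      using assms by simp
  qed (use assms in simp)
  also have "(\<lambda>\<tau>. if \<tau> \<le> b / a then 0 else if \<tau> \<le> (b + 1) / a then a * \<tau> - b else 1) =
      (\<lambda>\<tau>. clamp (a * \<tau> - b))"
    using assms by (auto simp: fun_eq_iff clamp_def field_simps max_def min_def)
  finally show ?thesis .
qed

lemma piecewise_linear_poly_path:
  assumes "0 < m"
  shows "piecewise_linear (poly_path m v)"
proof -
  have "piecewise_linear (\<lambda>\<tau>. clamp (real m * \<tau> - real j) *\<^sub>R v j)" for j
  proof (rule piecewise_linear_linear_image[of "\<lambda>\<tau>. clamp (real m * \<tau> - real j)" "\<lambda>x. x *\<^sub>R v j"])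
    show "linear (\<lambda>x. x *\<^sub>R v j)" by (rule linearI) (simp_all add: algebra_simps)
  qed (use assms in \<open>simp add: piecewise_linear_clamp\<close>)
  then show ?thesis
    unfolding poly_path_def[abs_def] by (intro piecewise_linear_sum) auto
qed

lemma poly_path_vertex:
  assumes "k < m" "0 \<le> s" "s \<le> 1"
  shows "poly_path m v ((real k + s) / real m) = (\<Sum>j<k. v j) + s *\<^sub>R v k"
proof -
  have "poly_path m v ((real k + s) / real m) = (\<Sum>j<m. clamp (real k + s - real j) *\<^sub>R v j)"
    using assms by (simp add: poly_path_def)
  also have "\<dots> = (\<Sum>j<Suc k. clamp (real k + s - real j) *\<^sub>R v j)"
    using assms by (intro sum.mono_neutral_right) (auto simp: clamp_def)
  also have "\<dots> = (\<Sum>j<k. v j) + s *\<^sub>R v k"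
  proof -
    have "clamp (real k + s - real j) = 1" if "j < k" for j
    proof -
      have "real j + 1 \<le> real k" using that by linarith
      then show ?thesis using assms by (simp add: clamp_def)
    qed
    then show ?thesis using assms by (simp add: clamp_def)
  qed
  finally show ?thesis .
qed

lemma poly_path_vertex':
  assumes "k \<le> m" "0 < m"
  shows "poly_path m v (real k / real m) = (\<Sum>j<k. v j)"
proof (cases k)
  case 0
  then show ?thesis using poly_path_vertex[of 0 m 0 v] assms by simp
next
  case (Suc k')
  then show ?thesis using poly_path_vertex[of k' m 1 v] assms by (simp add: add.commute)
qed

lemma unit_interval_segment:
  assumes "\<tau> \<in> {0..1}" "0 < m"
  obtains k s where "k < m" "0 \<le> s" "s \<le> 1" "\<tau> = (real k + s) / real m"
proof (cases "\<tau> = 1")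
  case True
  with that[of "m - 1" 1] assms show ?thesis by (simp add: of_nat_diff)
next
  case False
  let ?k = "nat \<lfloor>real m * \<tau>\<rfloor>"
  have "real m * \<tau> < real m * 1" "0 \<le> real m * \<tau>" using assms False by auto
  then show ?thesis
    using assms by (intro that[of ?k "real m * \<tau> - real ?k"]) (auto simp: floor_less_iff nat_less_iff, linarith+)
qed

text \<open>Reflecting a whole segment reflects its displacement; the translation of the rest of the
  path by a multiple of the simple root is the same change, carried along in the sum.\<close>

lemma seg_refl_poly_path:
  assumes "K < m"
  shows "seg_refl l i (real K / real m) (real (Suc K) / real m) (poly_path m v) =
    poly_path m (v(K := simple_refl l i (v K)))"
proof
  fix \<tau>
  let ?b = "poly_path m v"
  have m: "0 < real m" using assms by simp
  have upd: "poly_path m (v(K := simple_refl l i (v K))) \<tau> =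
      ?b \<tau> - (clamp (real m * \<tau> - real K) * coroot i (v K)) *\<^sub>R simple_root l i"
  proof -
    have "clamp (real m * \<tau> - real j) *\<^sub>R (v(K := simple_refl l i (v K))) j =
        clamp (real m * \<tau> - real j) *\<^sub>R v j -
        (if j = K then (clamp (real m * \<tau> - real K) * coroot i (v K)) *\<^sub>R simple_root l i else 0)" for j
      by (simp add: simple_refl_def algebra_simps)
    then show ?thesis
      using assms by (simp add: poly_path_def sum_subtractf)
  qed
  consider "\<tau> \<le> real K / real m" | "real K / real m < \<tau>" "\<tau> \<le> real (Suc K) / real m"
    | "real (Suc K) / real m < \<tau>" by linarith
  then show "seg_refl l i (real K / real m) (real (Suc K) / real m) ?b \<tau> =
      poly_path m (v(K := simple_refl l i (v K))) \<tau>"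
  proof cases
    case 1
    then have "clamp (real m * \<tau> - real K) = 0"
      using m by (simp add: clamp_def field_simps)
    with 1 show ?thesis by (simp add: seg_refl_def upd)
  next
    case 2
    define s where "s = real m * \<tau> - real K"
    have s: "0 \<le> s" "s \<le> 1" "\<tau> = (real K + s) / real m"
      using 2 m by (auto simp: s_def field_simps)
    then have "clamp (real m * \<tau> - real K) = s"
      using m by (simp add: clamp_def)
    moreover have "?b \<tau> - ?b (real K / real m) = s *\<^sub>R v K"
      using poly_path_vertex[OF assms s(1,2), of v] poly_path_vertex'[of K m v] assms
      unfolding s(3) by simp
    moreover have "?b \<tau> = s *\<^sub>R v K + ?b (real K / real m)"
      using calculation(2) by (simp add: algebra_simps)
    ultimately show ?thesis
      unfolding upd using 2 by (simp add: seg_refl_def simple_refl_def coroot_scaleR)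
  next
    case 3
    have "real K / real m \<le> real (Suc K) / real m"
      using m by (simp add: divide_right_mono)
    then have "\<not> \<tau> \<le> real K / real m" "\<not> \<tau> \<le> real (Suc K) / real m" using 3 by linarith+
    moreover have "clamp (real m * \<tau> - real K) = 1"
      using 3 m by (simp add: clamp_def field_simps)
    moreover have "?b (real (Suc K) / real m) - ?b (real K / real m) = v K"
      using poly_path_vertex'[of K m v] poly_path_vertex'[of "Suc K" m v] assms by simp
    ultimately show ?thesis by (simp add: seg_refl_def upd)
  qed
qed

text \<open>The weight of the basis vector number a of V; for a = 0 it is \<omega>, for a = l the
  index wraps around to 0.\<close>

definition letter_weight :: "nat \<Rightarrow> nat \<Rightarrow> weight"
  where "letter_weight l a = fund_weight ((a + 1) mod (l + 1)) - fund_weight a"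

lemma obtain_last_argmax:
  fixes H :: "nat \<Rightarrow> int"
  obtains K where "K \<le> m" "\<And>k. k \<le> m \<Longrightarrow> H k \<le> H K" "\<And>k. K < k \<Longrightarrow> k \<le> m \<Longrightarrow> H k < H K"
proof -
  let ?M = "Max (H ` {..m})" and ?S = "{k. k \<le> m \<and> H k = Max (H ` {..m})}"
  have le: "H k \<le> ?M" if "k \<le> m" for k
    using that by (intro Max_ge) auto
  have "?M \<in> H ` {..m}" by (intro Max_in) auto
  then have ne: "?S \<noteq> {}" by force
  have fin: "finite ?S" by simp
  have K: "Max ?S \<le> m" "H (Max ?S) = ?M" using Max_in[OF fin ne] by auto
  have "H k < ?M" if "Max ?S < k" "k \<le> m" for k
  proof -
    have "k \<notin> ?S" using Max_ge[OF fin, of k] that(1) by linarith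
    then have "H k \<noteq> ?M" using that(2) by blast
    with le[OF that(2)] show ?thesis by linarith
  qed
  with K le that[of "Max ?S"] show ?thesis by simp
qed

lemma obtain_first_argmax:
  fixes H :: "nat \<Rightarrow> int"
  obtains K where "K \<le> m" "\<And>k. k \<le> m \<Longrightarrow> H k \<le> H K" "\<And>k. k < K \<Longrightarrow> H k < H K"
proof -
  let ?M = "Max (H ` {..m})" and ?S = "{k. k \<le> m \<and> H k = Max (H ` {..m})}"
  have le: "H k \<le> ?M" if "k \<le> m" for k
    using that by (intro Max_ge) auto
  have "?M \<in> H ` {..m}" by (intro Max_in) auto
  then have ne: "?S \<noteq> {}" by force
  have fin: "finite ?S" by simp
  have K: "Min ?S \<le> m" "H (Min ?S) = ?M" using Min_in[OF fin ne] by auto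
  have "H k < ?M" if "k < Min ?S" for k
  proof -
    have "k \<notin> ?S" using Min_le[OF fin, of k] that by linarith
    moreover have "k \<le> m" using that K(1) by linarith
    ultimately have "H k \<noteq> ?M" by blast
    with le[OF \<open>k \<le> m\<close>] show ?thesis by linarith
  qed
  with K le that[of "Min ?S"] show ?thesis by simp
qed

locale loop_crystal =
  fixes l m n :: nat
  assumes l: "1 \<le> l" and m: "1 \<le> m"
begin

lemma m_pos: "0 < m"
  using m by simp

text \<open>
  The integer \<open>z = a - k (l + 1)\<close> with \<open>0 \<le> a \<le> l\<close> stands for the displacement
  \<open>\<epsilon>\<^sub>a + (k + n / m) \<delta>\<close>.
\<close>

definition letter :: "int \<Rightarrow> nat"
  where "letter z = nat (z mod (int l + 1))"

definition step_weight :: "int \<Rightarrow> weight"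
  where "step_weight z = letter_weight l (letter z) +
    (real n / real m - real_of_int (z div (int l + 1))) *\<^sub>R delta"

text \<open>The pairing of \<open>step_weight z\<close> with the i-th coroot, that is, the sign
  attached to a tensor factor in the signature rule for crystals of the natural
  representation.\<close>

definition sig :: "nat \<Rightarrow> int \<Rightarrow> int"
  where "sig i z = (if letter (z + 1) = i then 1 else 0) - (if letter z = i then 1 else 0)"

lemma of_nat_letter: "int (letter z) = z mod (int l + 1)"
  unfolding letter_def by simp

lemma letter_le: "letter z \<le> l"
proof -
  have "int (letter z) < int l + 1"
    unfolding of_nat_letter by (rule pos_mod_bound) simp
  then show ?thesis by simp
qed

lemma letter_succ: "letter (z + 1) = (letter z + 1) mod (l + 1)"
proof -
  have "int (letter (z + 1)) = int ((letter z + 1) mod (l + 1))"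
    by (simp add: of_nat_letter zmod_int mod_add_left_eq add.commute[of 1])
  then show ?thesis by (simp only: of_nat_eq_iff)
qed

lemma letter_succ_neq: "letter (z + 1) \<noteq> letter z"
  using letter_le[of z] l unfolding letter_succ
  by (cases "letter z = l") auto

lemma letter_eq_iff: "letter y = letter z \<longleftrightarrow> (int l + 1) dvd y - z"
proof -
  have "letter y = letter z \<longleftrightarrow> int (letter y) = int (letter z)" by simp
  then show ?thesis by (simp only: of_nat_letter mod_eq_dvd_iff)
qed

lemma letter_succ_eq_iff: "letter (y + 1) = letter (z + 1) \<longleftrightarrow> letter y = letter z"
  by (simp add: letter_eq_iff)

lemma sig_values: "sig i z = 1 \<longleftrightarrow> letter (z + 1) = i" "sig i z = - 1 \<longleftrightarrow> letter z = i"
  "sig i z \<le> 1" "- 1 \<le> sig i z"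
  using letter_succ_neq[of z] by (auto simp: sig_def)

lemma coroot_step_weight:
  assumes "i \<le> l"
  shows "coroot i (step_weight z) = real_of_int (sig i z)"
  by (auto simp: step_weight_def coroot_def letter_weight_def fund_weight_def delta_def sig_def
      letter_succ scaleR_fun_def)

lemma pred_mod:
  assumes "a \<le> l"
  shows "((a + 1) mod (l + 1) + l) mod (l + 1) = a"
proof -
  have "((a + 1) mod (l + 1) + l) mod (l + 1) = (a + 1 + l) mod (l + 1)"
    by (rule mod_add_left_eq)
  also have "a + 1 + l = a + (l + 1)" by simp
  also have "(a + (l + 1)) mod (l + 1) = a"
    using assms by (simp only: mod_add_self2) simp
  finally show ?thesis .
qed

text \<open>Passing from letter l to letter 0 raises the quotient by 1, hence lowers the
  \<delta>-coefficient by 1; this accounts for the summand \<delta> of the simple root number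
  0.\<close>

lemma step_weight_succ: "step_weight (z + 1) = step_weight z - simple_root l (letter (z + 1))"
proof -
  let ?a = "letter z"
  have root: "simple_root l (letter (z + 1)) = 2 *\<^sub>R fund_weight (letter (z + 1)) - fund_weight ?a
      - fund_weight ((letter (z + 1) + 1) mod (l + 1)) + (if letter (z + 1) = 0 then delta else 0)"
    unfolding simple_root_def letter_succ pred_mod[OF letter_le] ..
  have "(z + 1) div (int l + 1) = z div (int l + 1) + (if letter (z + 1) = 0 then 1 else 0)"
  proof -
    define q r where "q = z div (int l + 1)" and "r = z mod (int l + 1)"
    have z: "z = q * (int l + 1) + r" and r: "0 \<le> r" "r \<le> int l"
      using pos_mod_bound[of "int l + 1" z] div_mult_mod_eq[of z "int l + 1"]
      by (simp_all add: q_def r_def)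
    show ?thesis
    proof (cases "r = int l")
      case True
      then have "z + 1 = (q + 1) * (int l + 1)" using z by (simp add: algebra_simps)
      then show ?thesis
        unfolding letter_def q_def[symmetric] by simp
    next
      case False
      have e: "z + 1 = (r + 1) + (int l + 1) * q" using z by (simp add: mult.commute)
      have "(z + 1) mod (int l + 1) = (r + 1) mod (int l + 1)"
        unfolding e by (rule mod_mult_self2)
      moreover have "(z + 1) div (int l + 1) = q + (r + 1) div (int l + 1)"
        unfolding e by (rule div_mult_self2) simp
      moreover have "(r + 1) mod (int l + 1) = r + 1" "(r + 1) div (int l + 1) = 0"
        using r False by auto
      ultimately have "(z + 1) mod (int l + 1) = r + 1" "(z + 1) div (int l + 1) = q"
        by simp_all
      then show ?thesis
        unfolding letter_def q_def[symmetric] using r by simp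
    qed
  qed
  then show ?thesis
    unfolding step_weight_def letter_weight_def root
    by (simp add: letter_succ[of z, simplified, symmetric] algebra_simps scaleR_2)
qed

lemma step_weight_refl_succ:
  assumes "letter (z + 1) = i"
  shows "simple_refl l i (step_weight z) = step_weight (z + 1)"
  using assms letter_le[of "z + 1"] sig_values(1)[of i z]
  by (simp add: simple_refl_def coroot_step_weight step_weight_succ)

lemma step_weight_refl_pred:
  assumes "letter z = i"
  shows "simple_refl l i (step_weight z) = step_weight (z - 1)"
proof -
  have "step_weight z = step_weight (z - 1) - simple_root l i"
    using step_weight_succ[of "z - 1"] assms by simp
  moreover have "coroot i (step_weight z) = - 1"
    using assms letter_le[of z] sig_values(2)[of i z] by (simp add: coroot_step_weight)
  ultimately show ?thesis by (simp add: simple_refl_def)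
qed

section \<open>Paths of integer sequences and their height functions\<close>

definition xpath :: "int list \<Rightarrow> real \<Rightarrow> weight"
  where "xpath x = poly_path m (\<lambda>j. step_weight (x ! j))"

definition endpoint :: "int list \<Rightarrow> weight"
  where "endpoint x = (\<Sum>j<m. step_weight (x ! j))"

definition cls :: "int list \<Rightarrow> path_class"
  where "cls x = path_class l (xpath x)"

text \<open>The values of \<open>h_fun i\<close> at the vertices, i.e. at the times \<open>k / m\<close>.\<close>

definition height :: "nat \<Rightarrow> int list \<Rightarrow> nat \<Rightarrow> int"
  where "height i x k = - (\<Sum>j<k. sig i (x ! j))"

lemma height_0 [simp]: "height i x 0 = 0"
  and height_Suc: "height i x (Suc k) = height i x k - sig i (x ! k)"
  by (simp_all add: height_def)

lemma xpath_0: "xpath x 0 = 0"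
  using m by (simp add: xpath_def poly_path_def clamp_def)

lemma xpath_vertex: "k \<le> m \<Longrightarrow> xpath x (real k / real m) = (\<Sum>j<k. step_weight (x ! j))"
  using m by (simp add: xpath_def poly_path_vertex')

lemma xpath_segment:
  assumes "k < m" "0 \<le> s" "s \<le> 1"
  shows "xpath x ((real k + s) / real m) = (\<Sum>j<k. step_weight (x ! j)) + s *\<^sub>R step_weight (x ! k)"
  unfolding xpath_def using assms by (rule poly_path_vertex)

lemma xpath_1: "xpath x 1 = endpoint x"
  using xpath_vertex[of m x] m by (simp add: endpoint_def)

lemma fst_step_weight:
  "l < k \<Longrightarrow> fst (step_weight z) k = 0" "fst (step_weight z) k \<in> \<int>"
proof -
  show "fst (step_weight z) k \<in> \<int>"
    by (simp add: step_weight_def letter_weight_def fund_weight_def delta_def scaleR_fun_def)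
  assume "l < k"
  moreover have "(letter z + 1) mod (l + 1) \<le> l" "letter z \<le> l"
    using letter_le[of "z + 1"] letter_le[of z] by (simp_all add: letter_succ)
  ultimately have "k \<noteq> (letter z + 1) mod (l + 1)" "k \<noteq> letter z" by linarith+
  then show "fst (step_weight z) k = 0"
    unfolding step_weight_def letter_weight_def
    by (simp add: fund_weight_def delta_def scaleR_fun_def)
qed

lemma snd_step_weight: "snd (step_weight z) = real n / real m - real_of_int (z div (int l + 1))"
  by (simp add: step_weight_def letter_weight_def fund_weight_def delta_def)

lemma snd_endpoint: "snd (endpoint x) = real n - real_of_int (\<Sum>j<m. x ! j div (int l + 1))"
  using m by (simp add: endpoint_def snd_sum_weight snd_step_weight sum_subtractf)

lemma endpoint_lattice: "endpoint x \<in> weight_lattice l"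
  unfolding weight_lattice_iff snd_endpoint
  by (auto simp: endpoint_def fst_sum_fun fst_step_weight intro!: Ints_sum)

lemma xpath_in_pl_paths: "xpath x \<in> pl_paths l"
proof -
  have "xpath x \<tau> \<in> real_weights l" for \<tau>
    by (simp add: real_weights_iff xpath_def poly_path_def fst_sum_fun scaleR_fun_def fst_step_weight)
  moreover have "piecewise_linear (xpath x)"
    unfolding xpath_def using m by (intro piecewise_linear_poly_path) simp
  ultimately show ?thesis
    using xpath_0 xpath_1 endpoint_lattice by (auto simp: pl_paths_def)
qed

lemma wt_cls: "wt (cls x) = endpoint x"
  unfolding cls_def wt_path_class[OF xpath_in_pl_paths] by (rule xpath_1)

lemma h_fun_xpath:
  assumes "i \<le> l" "k < m" "0 \<le> s" "s \<le> 1"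
  shows "h_fun i (xpath x) ((real k + s) / real m) =
    real_of_int (height i x k) - s * real_of_int (sig i (x ! k))"
  unfolding h_fun_def xpath_segment[OF assms(2-4)]
  using assms by (simp add: coroot_add coroot_sum coroot_scaleR coroot_step_weight height_def)

lemma h_fun_xpath_vertex:
  assumes "i \<le> l" "k \<le> m"
  shows "h_fun i (xpath x) (real k / real m) = real_of_int (height i x k)"
  unfolding h_fun_def xpath_vertex[OF assms(2)]
  using assms by (simp add: coroot_sum coroot_step_weight height_def)

lemma h_fun_xpath_convex:
  assumes "i \<le> l" "k < m" "0 \<le> s" "s \<le> 1"
  shows "h_fun i (xpath x) ((real k + s) / real m) =
    (1 - s) * real_of_int (height i x k) + s * real_of_int (height i x (Suc k))"
  using h_fun_xpath[OF assms, of x] by (simp add: height_Suc algebra_simps)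

lemma vertex_in_unit: "k \<le> m \<Longrightarrow> real k / real m \<in> {0..1}"
  using m by (simp add: divide_le_eq_1)

lemma h_fun_xpath_le:
  assumes "i \<le> l" "\<And>k. k \<le> m \<Longrightarrow> height i x k \<le> e" "\<tau> \<in> {0..1}"
  shows "h_fun i (xpath x) \<tau> \<le> real_of_int e"
proof -
  obtain k s where ks: "k < m" "0 \<le> s" "s \<le> 1" "\<tau> = (real k + s) / real m"
    by (rule unit_interval_segment[OF assms(3) m_pos]) (rule that)
  have "(1 - s) * real_of_int (height i x k) + s * real_of_int (height i x (Suc k)) \<le> real_of_int e"
    using ks assms(2)[of k] assms(2)[of "Suc k"] by (intro convex_bound_le) auto
  then show ?thesis
    unfolding ks(4) h_fun_xpath_convex[OF assms(1) ks(1-3)] .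
qed

text \<open>\<open>h_fun\<close> is affine between vertices and integral at them, so its maximum
  over the unit interval is an integer and is attained at a vertex.\<close>

lemma eps_xpath:
  assumes "i \<le> l" "K \<le> m" "\<And>k. k \<le> m \<Longrightarrow> height i x k \<le> height i x K"
  shows "eps i (xpath x) = real_of_int (height i x K)"
proof (rule eps_eqI[OF xpath_in_pl_paths])
  show "real_of_int (height i x K) \<in> h_fun i (xpath x) ` {0..1}"
    using h_fun_xpath_vertex[OF assms(1,2), of x, symmetric] vertex_in_unit[OF assms(2)] by (rule image_eqI)
  show "h_fun i (xpath x) \<tau> \<le> real_of_int (height i x K)" if "\<tau> \<in> {0..1}" for \<tau>
    by (rule h_fun_xpath_le[OF assms(1) assms(3) that])
qed simp

text \<open>K is the last vertex of maximal height. For K < m the operator reflects the segment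
  after this vertex, raising entry K; K = m means that the path is killed.\<close>

definition f_acts :: "nat \<Rightarrow> int list \<Rightarrow> nat \<Rightarrow> bool"
  where "f_acts i x K \<longleftrightarrow> K \<le> m \<and> (\<forall>k\<le>m. height i x k \<le> height i x K) \<and>
    (\<forall>k. K < k \<and> k \<le> m \<longrightarrow> height i x k < height i x K)"

text \<open>K is the first vertex of maximal height. The segment before it is reflected, so entry K
  - 1 is lowered; K = 0 means that the path is killed.\<close>

definition e_acts :: "nat \<Rightarrow> int list \<Rightarrow> nat \<Rightarrow> bool"
  where "e_acts i x K \<longleftrightarrow> K \<le> m \<and> (\<forall>k\<le>m. height i x k \<le> height i x K) \<and>
    (\<forall>k<K. height i x k < height i x K)"

lemma f_acts_exists: "\<exists>K. f_acts i x K"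
  using obtain_last_argmax[of m "height i x"] unfolding f_acts_def by metis

lemma e_acts_exists: "\<exists>K. e_acts i x K"
  using obtain_first_argmax[of m "height i x"] unfolding e_acts_def by metis

lemma f_acts_sig:
  assumes "f_acts i x K" "K < m"
  shows "sig i (x ! K) = 1" "letter (x ! K + 1) = i"
proof -
  have "height i x (Suc K) < height i x K" using assms by (auto simp: f_acts_def)
  then show "sig i (x ! K) = 1" using sig_values(3)[of i "x ! K"] by (simp add: height_Suc)
  then show "letter (x ! K + 1) = i" by (simp add: sig_values)
qed

lemma e_acts_sig:
  assumes "e_acts i x (Suc K)"
  shows "sig i (x ! K) = - 1" "letter (x ! K) = i"
proof -
  have "height i x K < height i x (Suc K)" using assms by (auto simp: e_acts_def)
  then show "sig i (x ! K) = - 1" using sig_values(4)[of i "x ! K"] by (simp add: height_Suc)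
  then show "letter (x ! K) = i" by (simp add: sig_values)
qed

lemma poly_path_cong: "(\<And>j. j < m \<Longrightarrow> v j = v' j) \<Longrightarrow> poly_path m v = poly_path m v'"
  by (simp add: poly_path_def fun_eq_iff)

lemma f_start_xpath:
  assumes i: "i \<le> l" and K: "f_acts i x K"
  shows "f_start i (xpath x) (real K / real m)"
proof -
  have Km: "K \<le> m" and max: "\<And>k. k \<le> m \<Longrightarrow> height i x k \<le> height i x K"
    and last: "\<And>k. K < k \<Longrightarrow> k \<le> m \<Longrightarrow> height i x k < height i x K"
    using K by (auto simp: f_acts_def)
  have eps: "eps i (xpath x) = real_of_int (height i x K)"
    by (rule eps_xpath[OF i Km max])
  have m0: "0 < real m" using m by simp
  have "\<tau> \<le> real K / real m" if \<tau>: "\<tau> \<in> {0..1}" "h_fun i (xpath x) \<tau> = real_of_int (height i x K)" for \<tau>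
  proof (rule ccontr)
    assume less: "\<not> \<tau> \<le> real K / real m"
    obtain k s where ks: "k < m" "0 \<le> s" "s \<le> 1" "\<tau> = (real k + s) / real m"
      by (rule unit_interval_segment[OF \<tau>(1) m_pos]) (rule that)
    have "real K < real k + s" using less m0 unfolding ks(4) by (simp add: divide_le_cancel not_le divide_less_cancel)
    \<comment> \<open>Either the interval containing \<tau> lies entirely beyond vertex K, or it
      starts there and \<tau> is not its left end.\<close>
    then have "K \<le> k" "K < k \<or> 0 < s" using ks(3) by linarith+
    then have "height i x k < height i x K \<and> height i x (Suc k) < height i x K \<or>
        height i x k \<le> height i x K \<and> height i x (Suc k) < height i x K \<and> 0 < s"
      using last[of k] last[of "Suc k"] max[of k] ks(1) by auto
    then have "(1 - s) * real_of_int (height i x k) + s * real_of_int (height i x (Suc k)) < real_of_int (height i x K)"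
    proof
      assume "height i x k < height i x K \<and> height i x (Suc k) < height i x K"
      then show ?thesis using ks by (intro convex_bound_lt) auto
    next
      assume *: "height i x k \<le> height i x K \<and> height i x (Suc k) < height i x K \<and> 0 < s"
      then have "(1 - s) * real_of_int (height i x k) \<le> (1 - s) * real_of_int (height i x K)"
        "s * real_of_int (height i x (Suc k)) < s * real_of_int (height i x K)"
        using ks by (auto intro: mult_left_mono)
      then have "(1 - s) * real_of_int (height i x k) + s * real_of_int (height i x (Suc k)) <
          (1 - s) * real_of_int (height i x K) + s * real_of_int (height i x K)"
        by (rule add_le_less_mono)
      then show ?thesis by (simp add: algebra_simps)
    qed
    with \<tau>(2) show False
      unfolding ks(4) h_fun_xpath_convex[OF i ks(1-3)] by simp
  qed
  then show ?thesis
    unfolding f_start_def eps using vertex_in_unit[OF Km] h_fun_xpath_vertex[OF i Km, of x] by simp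
qed

text \<open>After the last maximum \<open>h_fun\<close> descends with slope -m, so the level one
  below the maximum is reached exactly at the next vertex: whole segments are reflected and no new
  break points arise.\<close>

lemma f_end_xpath:
  assumes i: "i \<le> l" and K: "f_acts i x K" "K < m"
  shows "f_end i (xpath x) (real K / real m) (real (Suc K) / real m)"
proof -
  have max: "\<And>k. k \<le> m \<Longrightarrow> height i x k \<le> height i x K"
    using K by (auto simp: f_acts_def)
  have eps: "eps i (xpath x) = real_of_int (height i x K)"
    using eps_xpath[OF i _ max] K(2) by simp
  have m0: "0 < real m" using m by simp
  have h: "h_fun i (xpath x) (real (Suc K) / real m) = real_of_int (height i x K) - 1"
    using h_fun_xpath_vertex[of i "Suc K" x] i K f_acts_sig[OF K] by (simp add: height_Suc)
  have "real (Suc K) / real m \<le> \<tau>"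
    if \<tau>: "\<tau> \<in> {real K / real m..1}" "h_fun i (xpath x) \<tau> = real_of_int (height i x K) - 1" for \<tau>
  proof (rule ccontr)
    assume less: "\<not> real (Suc K) / real m \<le> \<tau>"
    define s where "s = real m * \<tau> - real K"
    have s: "0 \<le> s" "s < 1" "\<tau> = (real K + s) / real m"
      using less \<tau>(1) m0 by (auto simp: s_def field_simps)
    then have "h_fun i (xpath x) \<tau> = real_of_int (height i x K) - s"
      using h_fun_xpath[OF i K(2), of s x] f_acts_sig[OF K] by simp
    with \<tau>(2) s(2) show False by simp
  qed
  then show ?thesis
    unfolding f_end_def eps using h vertex_in_unit[of "Suc K"] K(2) m0 by (auto simp: divide_right_mono)
qed

lemma f_op_cls:
  assumes i: "i \<le> l" and K: "f_acts i x K" and len: "length x = m"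
  shows "f_op l i (Some (cls x)) = (if K = m then None else Some (cls (x[K := x ! K + 1])))"
proof -
  note start = f_start_xpath[OF i K]
  show ?thesis
  proof (cases "K = m")
    case True
    then have "f_path l i (xpath x) = None"
      using f_path_eq(1)[OF start] m by simp
    with True show ?thesis
      unfolding cls_def by (simp add: f_op_path_class[OF xpath_in_pl_paths i])
  next
    case False
    then have Km: "K < m" using K by (simp add: f_acts_def)
    have "real K / real m \<noteq> 1" using Km by simp
    then have "f_path l i (xpath x) = Some (seg_refl l i (real K / real m) (real (Suc K) / real m) (xpath x))"
      using f_path_eq(2)[OF start] f_end_xpath[OF i K Km] by blast
    also have "seg_refl l i (real K / real m) (real (Suc K) / real m) (xpath x) = xpath (x[K := x ! K + 1])"
      unfolding xpath_def seg_refl_poly_path[OF Km]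
      by (rule poly_path_cong)
        (use f_acts_sig[OF K Km] len in \<open>auto simp: step_weight_refl_succ nth_list_update\<close>)
    finally show ?thesis
      using False unfolding cls_def by (simp add: f_op_path_class[OF xpath_in_pl_paths i])
  qed
qed

lemma e_end_xpath:
  assumes i: "i \<le> l" and K: "e_acts i x K"
  shows "e_end i (xpath x) (real K / real m)"
proof -
  have Km: "K \<le> m" and max: "\<And>k. k \<le> m \<Longrightarrow> height i x k \<le> height i x K"
    and first: "\<And>k. k < K \<Longrightarrow> height i x k < height i x K"
    using K by (auto simp: e_acts_def)
  have eps: "eps i (xpath x) = real_of_int (height i x K)"
    by (rule eps_xpath[OF i Km max])
  have m0: "0 < real m" using m by simp
  have "real K / real m \<le> \<tau>" if \<tau>: "\<tau> \<in> {0..1}" "h_fun i (xpath x) \<tau> = real_of_int (height i x K)" for \<tau>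
  proof (rule ccontr)
    assume less: "\<not> real K / real m \<le> \<tau>"
    obtain k s where ks: "k < m" "0 \<le> s" "s \<le> 1" "\<tau> = (real k + s) / real m"
      by (rule unit_interval_segment[OF \<tau>(1) m_pos]) (rule that)
    have "real k + s < real K" using less m0 unfolding ks(4) by (simp add: divide_le_cancel not_le divide_less_cancel)
    then have "k < K" "Suc k < K \<or> s < 1" using ks(2) by linarith+
    then have "height i x k < height i x K \<and> height i x (Suc k) < height i x K \<or>
        height i x k < height i x K \<and> height i x (Suc k) \<le> height i x K \<and> s < 1"
      using first[of k] first[of "Suc k"] max[of "Suc k"] ks(1) by auto
    then have "(1 - s) * real_of_int (height i x k) + s * real_of_int (height i x (Suc k)) < real_of_int (height i x K)"
    proof
      assume "height i x k < height i x K \<and> height i x (Suc k) < height i x K"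
      then show ?thesis using ks by (intro convex_bound_lt) auto
    next
      assume *: "height i x k < height i x K \<and> height i x (Suc k) \<le> height i x K \<and> s < 1"
      then have "(1 - s) * real_of_int (height i x k) < (1 - s) * real_of_int (height i x K)"
        "s * real_of_int (height i x (Suc k)) \<le> s * real_of_int (height i x K)"
        using ks by (auto intro: mult_left_mono)
      then have "(1 - s) * real_of_int (height i x k) + s * real_of_int (height i x (Suc k)) <
          (1 - s) * real_of_int (height i x K) + s * real_of_int (height i x K)"
        by (rule add_less_le_mono)
      then show ?thesis by (simp add: algebra_simps)
    qed
    with \<tau>(2) show False
      unfolding ks(4) h_fun_xpath_convex[OF i ks(1-3)] by simp
  qed
  then show ?thesis
    unfolding e_end_def eps using vertex_in_unit[OF Km] h_fun_xpath_vertex[OF i Km, of x] by simp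
qed

lemma e_start_xpath:
  assumes i: "i \<le> l" and K: "e_acts i x (Suc K)"
  shows "e_start i (xpath x) (real (Suc K) / real m) (real K / real m)"
proof -
  have Km: "K < m" and max: "\<And>k. k \<le> m \<Longrightarrow> height i x k \<le> height i x (Suc K)"
    using K by (auto simp: e_acts_def)
  have eps: "eps i (xpath x) = real_of_int (height i x (Suc K))"
    using eps_xpath[OF i _ max] Km by simp
  have m0: "0 < real m" using m by simp
  have h: "h_fun i (xpath x) (real K / real m) = real_of_int (height i x (Suc K)) - 1"
    using h_fun_xpath_vertex[of i "K" x] i Km e_acts_sig[OF K] by (simp add: height_Suc)
  have "\<tau> \<le> real K / real m"
    if \<tau>: "\<tau> \<in> {0..real (Suc K) / real m}" "h_fun i (xpath x) \<tau> = real_of_int (height i x (Suc K)) - 1" for \<tau>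
  proof (rule ccontr)
    assume less: "\<not> \<tau> \<le> real K / real m"
    define s where "s = real m * \<tau> - real K"
    have s: "0 < s" "s \<le> 1" "\<tau> = (real K + s) / real m"
      using less \<tau>(1) m0 by (auto simp: s_def field_simps)
    then have "h_fun i (xpath x) \<tau> = real_of_int (height i x (Suc K)) - 1 + s"
      using h_fun_xpath[OF i Km, of s x] e_acts_sig[OF K] by (simp add: height_Suc)
    with \<tau>(2) s(1) show False by simp
  qed
  then show ?thesis
    unfolding e_start_def eps using h vertex_in_unit[of K] Km m0 by (auto simp: divide_right_mono)
qed

lemma e_op_cls:
  assumes i: "i \<le> l" and len: "length x = m"
  shows "e_acts i x 0 \<Longrightarrow> e_op l i (Some (cls x)) = None"
    "e_acts i x (Suc K) \<Longrightarrow> e_op l i (Some (cls x)) = Some (cls (x[K := x ! K - 1]))"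
proof -
  assume "e_acts i x 0"
  then have "e_path l i (xpath x) = None"
    using e_path_eq(1)[OF e_end_xpath[OF i, of x 0]] by simp
  then show "e_op l i (Some (cls x)) = None"
    unfolding cls_def by (simp add: e_op_path_class[OF xpath_in_pl_paths i])
next
  assume K: "e_acts i x (Suc K)"
  then have Km: "K < m" by (simp add: e_acts_def)
  have "real (Suc K) / real m \<noteq> 0" using m by simp
  then have "e_path l i (xpath x) = Some (seg_refl l i (real K / real m) (real (Suc K) / real m) (xpath x))"
    using e_path_eq(2)[OF e_end_xpath[OF i K]] e_start_xpath[OF i K] by blast
  also have "seg_refl l i (real K / real m) (real (Suc K) / real m) (xpath x) = xpath (x[K := x ! K - 1])"
    unfolding xpath_def seg_refl_poly_path[OF Km]
    by (rule poly_path_cong)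
      (use e_acts_sig[OF K] len in \<open>auto simp: step_weight_refl_pred nth_list_update\<close>)
  finally show "e_op l i (Some (cls x)) = Some (cls (x[K := x ! K - 1]))"
    unfolding cls_def by (simp add: e_op_path_class[OF xpath_in_pl_paths i])
qed

end

context loop_crystal
begin

section \<open>The subcrystal\<close>

definition seqs :: "int list set"
  where "seqs = {x. length x = m \<and> successively (\<lambda>a b. b \<le> a \<and> a \<le> b + int l) x}"

lemma successively_nth: "successively P x \<longleftrightarrow> (\<forall>j. Suc j < length x \<longrightarrow> P (x ! j) (x ! Suc j))"
proof (induction x rule: induct_list012)
  case (3 a b x)
  then show ?case
    by (auto simp: nth_Cons split: nat.splits)
qed simp_all

lemma seqs_iff: "x \<in> seqs \<longleftrightarrow> length x = m \<and> (\<forall>j. Suc j < m \<longrightarrow> x ! Suc j \<le> x ! j \<and> x ! j \<le> x ! Suc j + int l)"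
  by (auto simp: seqs_def successively_nth)

lemma letter_add_period: "letter (z + int l + 1) = letter z"
  by (simp add: letter_eq_iff)

text \<open>Raising entry K can fail in two ways only. If entry K - 1 equals entry K, the height
  also falls at K - 1, so vertex K - 1 is higher than K. If entry K exceeds its successor by l, the
  successor has letter i and the height recovers at K + 2, so K is not the last maximum.\<close>

lemma f_step_in_seqs:
  assumes x: "x \<in> seqs" and K: "f_acts i x K" "K < m"
  shows "x[K := x ! K + 1] \<in> seqs"
  unfolding seqs_iff
proof (intro conjI allI impI)
  have len: "length x = m" using x by (simp add: seqs_iff)
  then show "length (x[K := x ! K + 1]) = m" by simp
  fix j assume j: "Suc j < m"
  have *: "x ! Suc j \<le> x ! j" "x ! j \<le> x ! Suc j + int l" using x j by (auto simp: seqs_iff)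
  have max: "height i x k \<le> height i x K" if "k \<le> m" for k using K that by (auto simp: f_acts_def)
  have last: "height i x k < height i x K" if "K < k" "k \<le> m" for k using K that by (auto simp: f_acts_def)
  note sg = f_acts_sig[OF K]
  have "x[K := x ! K + 1] ! Suc j \<le> x[K := x ! K + 1] ! j \<and> x[K := x ! K + 1] ! j \<le> x[K := x ! K + 1] ! Suc j + int l"
  proof -
    consider "Suc j = K" | "j = K" | "Suc j \<noteq> K" "j \<noteq> K" by blast
    then show ?thesis
    proof cases
      case 1
      have "x ! j \<noteq> x ! K"
      proof
        assume "x ! j = x ! K"
        then have "height i x K = height i x j - 1" using sg height_Suc[of i x j] 1 by simp
        with max[of j] j show False by simp
      qed
      with 1 * len j show ?thesis by auto
    next
      case 2
      have "x ! K \<noteq> x ! Suc K + int l"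
      proof
        assume "x ! K = x ! Suc K + int l"
        then have "letter (x ! K + 1) = letter (x ! Suc K)" using letter_add_period by simp
        then have "sig i (x ! Suc K) = - 1" using sg by (simp add: sig_values)
        then have "height i x (Suc (Suc K)) = height i x K" using sg by (simp add: height_Suc)
        with last[of "Suc (Suc K)"] j 2 show False by simp
      qed
      with 2 * len j show ?thesis by auto
    next
      case 3
      with * show ?thesis by simp
    qed
  qed
  then show "x[K := x ! K + 1] ! Suc j \<le> x[K := x ! K + 1] ! j"
    "x[K := x ! K + 1] ! j \<le> x[K := x ! K + 1] ! Suc j + int l" by auto
qed

text \<open>Dual to the case of f: a predecessor larger by l makes vertex K - 1 an earlier maximum,
  and an equal successor makes vertex K + 2 higher than the maximum.\<close>

lemma e_step_in_seqs:
  assumes x: "x \<in> seqs" and K: "e_acts i x (Suc K)"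
  shows "x[K := x ! K - 1] \<in> seqs"
  unfolding seqs_iff
proof (intro conjI allI impI)
  have len: "length x = m" using x by (simp add: seqs_iff)
  then show "length (x[K := x ! K - 1]) = m" by simp
  have Km: "K < m" using K by (simp add: e_acts_def)
  fix j assume j: "Suc j < m"
  have *: "x ! Suc j \<le> x ! j" "x ! j \<le> x ! Suc j + int l" using x j by (auto simp: seqs_iff)
  have max: "height i x k \<le> height i x (Suc K)" if "k \<le> m" for k using K that by (auto simp: e_acts_def)
  have first: "height i x k < height i x (Suc K)" if "k < Suc K" for k using K that by (auto simp: e_acts_def)
  note sg = e_acts_sig[OF K]
  have "x[K := x ! K - 1] ! Suc j \<le> x[K := x ! K - 1] ! j \<and> x[K := x ! K - 1] ! j \<le> x[K := x ! K - 1] ! Suc j + int l"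
  proof -
    consider "Suc j = K" | "j = K" | "Suc j \<noteq> K" "j \<noteq> K" by blast
    then show ?thesis
    proof cases
      case 1
      have "x ! j \<noteq> x ! K + int l"
      proof
        assume "x ! j = x ! K + int l"
        then have "letter (x ! j + 1) = letter (x ! K)" using letter_add_period by simp
        then have "sig i (x ! j) = 1" using sg by (simp add: sig_values)
        then have "height i x (Suc K) = height i x j" using sg height_Suc[of i x j] 1 by (simp add: height_Suc)
        with first[of j] 1 show False by simp
      qed
      with 1 * len j show ?thesis by auto
    next
      case 2
      have "x ! Suc K \<noteq> x ! K"
      proof
        assume "x ! Suc K = x ! K"
        then have "height i x (Suc (Suc K)) = height i x (Suc K) + 1" using sg by (simp add: height_Suc)
        with max[of "Suc (Suc K)"] j 2 show False by simp
      qed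
      with 2 * len j show ?thesis by auto
    next
      case 3
      with * show ?thesis by simp
    qed
  qed
  then show "x[K := x ! K - 1] ! Suc j \<le> x[K := x ! K - 1] ! j"
    "x[K := x ! K - 1] ! j \<le> x[K := x ! K - 1] ! Suc j + int l" by auto
qed

lemma height_list_update:
  assumes "K < m" "length x = m"
  shows "height i (x[K := z]) k = height i x k + (if K < k then sig i (x ! K) - sig i z else 0)"
proof (cases "K < k")
  case True
  have "(\<Sum>j<k. sig i (x[K := z] ! j)) = (\<Sum>j<k. sig i (x ! j) + (if j = K then sig i z - sig i (x ! K) else 0))"
    using assms by (intro sum.cong refl) (auto simp: nth_list_update)
  also have "\<dots> = (\<Sum>j<k. sig i (x ! j)) + (sig i z - sig i (x ! K))"
    using True by (simp add: sum.distrib)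
  finally show ?thesis using True by (simp add: height_def)
next
  case False
  then have "(\<Sum>j<k. sig i (x[K := z] ! j)) = (\<Sum>j<k. sig i (x ! j))"
    by (intro sum.cong refl) (auto simp: nth_list_update)
  then show ?thesis using False by (simp add: height_def)
qed

text \<open>The f-step adds 2 to all heights beyond K, so the vertex K + 1, formerly one below the
  maximum, becomes the first maximum, and the e-operator undoes the step.\<close>

lemma e_acts_after_f:
  assumes K: "f_acts i x K" "K < m" and len: "length x = m"
  shows "e_acts i (x[K := x ! K + 1]) (Suc K)"
proof -
  let ?y = "x[K := x ! K + 1]"
  note sg = f_acts_sig[OF K]
  have "sig i (x ! K + 1) = - 1" using sg by (simp add: sig_values)
  then have h: "height i ?y k = height i x k + (if K < k then 2 else 0)" for k
    using sg by (simp add: height_list_update[OF K(2) len])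
  have SK: "height i x (Suc K) = height i x K - 1" using sg by (simp add: height_Suc)
  have max: "height i x k \<le> height i x K" if "k \<le> m" for k using K that by (auto simp: f_acts_def)
  have last: "height i x k < height i x K" if "K < k" "k \<le> m" for k using K that by (auto simp: f_acts_def)
  have hSK: "height i ?y (Suc K) = height i x K + 1" by (simp add: h SK)
  show ?thesis
    unfolding e_acts_def hSK
  proof (intro conjI allI impI)
    show "Suc K \<le> m" using K(2) by simp
    show "height i ?y k \<le> height i x K + 1" if "k \<le> m" for k
      using max[OF that] last[of k] that by (cases "K < k") (auto simp: h)
    show "height i ?y k < height i x K + 1" if "k < Suc K" for k
      using max[of k] that K(2) by (simp add: h)
  qed
qed

section \<open>Connectedness of the set of admissible sequences\<close>

definition reach :: "int list \<Rightarrow> bool"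
  where "reach x \<longleftrightarrow> cls x \<in> subcrystal l (cls (replicate m 0))"

lemma reach_0: "reach (replicate m 0)"
  unfolding reach_def subcrystal_def by (intro CollectI bexI[OF _ op_monoid.one]) simp

lemma reach_f:
  assumes "reach x" "i \<le> l" "f_acts i x K" "K < m" "length x = m"
  shows "reach (x[K := x ! K + 1])"
proof -
  obtain a where a: "a \<in> op_monoid l" "a (Some (cls (replicate m 0))) = Some (cls x)"
    using assms(1) by (auto simp: reach_def subcrystal_def)
  have "(f_op l i \<circ> a) (Some (cls (replicate m 0))) = Some (cls (x[K := x ! K + 1]))"
    using a f_op_cls[OF assms(2,3,5)] assms(4) by simp
  then show ?thesis
    unfolding reach_def subcrystal_def using op_monoid.f[OF assms(2) a(1)] by blast
qed

lemma reach_f_rev: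
  assumes "reach (x[K := x ! K + 1])" "i \<le> l" "f_acts i x K" "K < m" "length x = m"
  shows "reach x"
proof -
  let ?y = "x[K := x ! K + 1]"
  obtain a where a: "a \<in> op_monoid l" "a (Some (cls (replicate m 0))) = Some (cls ?y)"
    using assms(1) by (auto simp: reach_def subcrystal_def)
  have "?y[K := ?y ! K - 1] = x" using assms(4,5) by simp
  then have "(e_op l i \<circ> a) (Some (cls (replicate m 0))) = Some (cls x)"
    using a e_op_cls(2)[OF assms(2), of ?y K] e_acts_after_f[OF assms(3-5)] assms(5) by simp
  then show ?thesis
    unfolding reach_def subcrystal_def using op_monoid.e[OF assms(2) a(1)] by blast
qed

text \<open>The stages between the constant sequences c and c + 1, passed by applying one f-operator
  m times.\<close>

definition two_step :: "int \<Rightarrow> nat \<Rightarrow> int list"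
  where "two_step c j = replicate j (c + 1) @ replicate (m - j) c"

lemma two_step_nth: "j \<le> m \<Longrightarrow> k < m \<Longrightarrow> two_step c j ! k = (if k < j then c + 1 else c)"
  by (auto simp: two_step_def nth_append)

lemma length_two_step [simp]: "j \<le> m \<Longrightarrow> length (two_step c j) = m"
  by (simp add: two_step_def)

text \<open>The height rises by 1 at each entry c + 1 and falls by 1 at each entry c, so its only
  peak is at j.\<close>

lemma two_step_f_acts:
  assumes "j < m"
  shows "f_acts (letter (c + 1)) (two_step c j) j"
proof -
  let ?i = "letter (c + 1)"
  have sg: "sig ?i (c + 1) = - 1" "sig ?i c = 1" by (simp_all add: sig_values)
  have h: "height ?i (two_step c j) k = (if k \<le> j then int k else 2 * int j - int k)" if "k \<le> m" for k
    using that
  proof (induction k)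
    case (Suc k)
    then show ?case
      using assms by (simp add: height_Suc two_step_nth sg)
  qed simp
  show ?thesis unfolding f_acts_def using assms by (auto simp: h)
qed

lemma two_step_update:
  assumes "j < m"
  shows "(two_step c j)[j := two_step c j ! j + 1] = two_step c (Suc j)"
  using assms by (intro nth_equalityI) (auto simp: two_step_nth nth_list_update)

lemma reach_two_step:
  assumes "j \<le> m"
  shows "reach (two_step c j) \<longleftrightarrow> reach (two_step c 0)"
  using assms
proof (induction j)
  case (Suc j)
  then have j: "j < m" by simp
  have "reach (two_step c (Suc j)) \<longleftrightarrow> reach (two_step c j)"
    using reach_f[of "two_step c j", OF _ letter_le two_step_f_acts[OF j] j]
      reach_f_rev[of "two_step c j", OF _ letter_le two_step_f_acts[OF j] j] j
    unfolding two_step_update[OF j] by auto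
  with Suc show ?case by simp
qed simp

lemma reach_const: "reach (replicate m c)"
proof -
  have ends: "two_step c 0 = replicate m c" "two_step c m = replicate m (c + 1)" for c
    by (simp_all add: two_step_def)
  have step: "reach (replicate m (c + 1)) \<longleftrightarrow> reach (replicate m c)" for c
    using reach_two_step[of m c] by (simp add: ends)
  show ?thesis
  proof (induction c rule: int_induct[where k = 0])
    case base
    show ?case by (rule reach_0)
  next
    case (step1 c)
    then show ?case by (simp add: step)
  next
    case (step2 c)
    then show ?case using step[of "c - 1"] by simp
  qed
qed

abbreviation last_entry :: "int list \<Rightarrow> int"
  where "last_entry x \<equiv> x ! (m - 1)"

definition gap :: "int list \<Rightarrow> int"
  where "gap x = (\<Sum>j<m. x ! j) - int m * last_entry x"

text \<open>Congruence modulo l + 1, not equality, is what counts: only these entries can be raised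
  by the operator indexed by the letter following the last one.\<close>

definition ties :: "int list \<Rightarrow> nat"
  where "ties x = card {j. j < m \<and> letter (x ! j) = letter (last_entry x)}"

lemma seqs_antimono:
  assumes "x \<in> seqs" "j \<le> k" "k < m"
  shows "x ! k \<le> x ! j"
  using assms(2,3)
proof (induction k rule: dec_induct)
  case (step k)
  then show ?case using assms(1) by (force simp: seqs_iff)
qed simp

lemma gap_nonneg:
  assumes "x \<in> seqs"
  shows "0 \<le> gap x"
proof -
  have "(\<Sum>j<m. last_entry x) \<le> (\<Sum>j<m. x ! j)"
    using m by (intro sum_mono seqs_antimono[OF assms]) auto
  then show ?thesis by (simp add: gap_def)
qed

lemma ties_le: "ties x \<le> m" and ties_pos: "0 < ties x"
proof -
  have sub: "{j. j < m \<and> letter (x ! j) = letter (last_entry x)} \<subseteq> {..<m}" by auto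
  then show "ties x \<le> m" unfolding ties_def using card_mono[OF finite_lessThan sub] by simp
  have "m - 1 \<in> {j. j < m \<and> letter (x ! j) = letter (last_entry x)}" using m by simp
  then show "0 < ties x" unfolding ties_def using finite_subset[OF sub] by (auto simp: card_gt_0_iff)
qed

text \<open>Consecutive differences are multiples of l + 1 lying in \<open>{0..l}\<close>, hence
  0.\<close>

lemma ties_eq_m_imp_const:
  assumes x: "x \<in> seqs" and "ties x = m"
  shows "x = replicate m (last_entry x)"
proof -
  have sub: "{j. j < m \<and> letter (x ! j) = letter (last_entry x)} \<subseteq> {..<m}" by auto
  have "{j. j < m \<and> letter (x ! j) = letter (last_entry x)} = {..<m}"
    using card_subset_eq[OF finite_lessThan sub] assms(2) by (simp add: ties_def)
  then have let_eq: "letter (x ! j) = letter (last_entry x)" if "j < m" for j using that by blast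
  have adj: "x ! j = x ! Suc j" if j: "Suc j < m" for j
  proof -
    have "int l + 1 dvd x ! j - x ! Suc j"
      unfolding letter_eq_iff[symmetric] using let_eq[of j] let_eq[OF j] j by simp
    moreover have "0 \<le> x ! j - x ! Suc j" "x ! j - x ! Suc j \<le> int l"
      using x j by (auto simp: seqs_iff)
    ultimately show ?thesis
      using zdvd_imp_le[of "int l + 1" "x ! j - x ! Suc j"] by (cases "x ! j = x ! Suc j") auto
  qed
  have const: "x ! j = x ! (m - 1)" if "j \<le> m - 1" for j
    using that
  proof (induction j rule: inc_induct)
    case (step j)
    have "x ! j = x ! Suc j" by (rule adj) (use step in simp)
    with step show ?case by simp
  qed simp
  have len: "length x = m" using x by (simp add: seqs_iff)
  show ?thesis
  proof (rule nth_equalityI)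
    show "x ! j = replicate m (last_entry x) ! j" if "j < length x" for j
      using const[of j] that len by simp
  qed (simp add: len)
qed

lemma sum_list_update_nth:
  fixes x :: "int list"
  assumes "K < m" "length x = m"
  shows "(\<Sum>j<m. x[K := z] ! j) = (\<Sum>j<m. x ! j) + (z - x ! K)"
proof -
  have "(\<Sum>j<m. x[K := z] ! j) = (\<Sum>j<m. x ! j + (if j = K then z - x ! K else 0))"
    using assms by (intro sum.cong refl) (auto simp: nth_list_update)
  also have "\<dots> = (\<Sum>j<m. x ! j) + (z - x ! K)"
    using assms by (simp add: sum.distrib)
  finally show ?thesis .
qed

text \<open>
  Apply \<open>f\<^sub>i\<close>, where \<open>i\<close> is the letter following the last one.  As long as the last entry is
  not raised, \<open>gap\<close> grows by \<open>1\<close> and \<open>ties\<close> drops by \<open>1\<close>; raising the last entry lowers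
  \<open>gap\<close> by \<open>m - 1\<close> while \<open>ties \<le> m\<close>.  Hence \<open>(gap + ties, ties)\<close> decreases
  lexicographically until the sequence is constant.
\<close>

lemma reach_seqs: "x \<in> seqs \<Longrightarrow> reach x"
proof (induction x rule: measure_induct_rule[where f = "\<lambda>x. nat (gap x + int (ties x)) * (m + 1) + ties x"])
  case (less x)
  note x = less.prems
  have len: "length x = m" using x by (simp add: seqs_iff)
  show ?case
  proof (cases "x = replicate m (last_entry x)")
    case True
    then show ?thesis using reach_const by metis
  next
    case False
    define i where "i = letter (last_entry x + 1)"
    obtain K where K: "f_acts i x K" using f_acts_exists by blast
    \<comment> \<open>The choice of i makes the height fall at the last entry, so the last maximum
      is before m and the operator does not kill the path.\<close>
    have "height i x m = height i x (m - 1) - 1"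
      using height_Suc[of i x "m - 1"] m sig_values(1)[of i "last_entry x"] by (simp add: i_def)
    then have "K \<noteq> m" using K by (auto simp: f_acts_def dest!: spec[of _ "m - 1"])
    then have Km: "K < m" using K by (simp add: f_acts_def)
    let ?y = "x[K := x ! K + 1]"
    have y: "?y \<in> seqs" by (rule f_step_in_seqs[OF x K Km])
    have sumy: "(\<Sum>j<m. ?y ! j) = (\<Sum>j<m. x ! j) + 1"
      using sum_list_update_nth[OF Km len] by simp
    have "reach ?y"
    proof (cases "K = m - 1")
      case True
      then have lasty: "last_entry ?y = last_entry x + 1" using len m by simp
      have gapy: "gap ?y = gap x + 1 - int m"
        unfolding gap_def lasty sumy by (simp add: algebra_simps)
      show ?thesis
      proof (cases "ties ?y = m")
        case True
        from ties_eq_m_imp_const[OF y True] show ?thesis using reach_const by metis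
      next
        case False
        \<comment> \<open>\<open>gap\<close> falls by m - 1 and \<open>ties ?y\<close> is at most m
          - 1, so the new sum is at most \<open>gap x\<close>, which is less than the old sum as
          \<open>ties x\<close> is positive.\<close>
        then have "gap ?y + int (ties ?y) < gap x + int (ties x)"
          using gapy ties_le[of ?y] ties_pos[of x] by linarith
        then have "nat (gap ?y + int (ties ?y)) + 1 \<le> nat (gap x + int (ties x))"
          using gap_nonneg[OF y] by linarith
        then have le: "(nat (gap ?y + int (ties ?y)) + 1) * (m + 1) \<le> nat (gap x + int (ties x)) * (m + 1)"
          by (rule mult_le_mono1)
        \<comment> \<open>Since \<open>ties\<close> is less than m + 1, the weight m + 1 makes the
          natural-number measure behave lexicographically.\<close>
        have "nat (gap ?y + int (ties ?y)) * (m + 1) + ties ?y < (nat (gap ?y + int (ties ?y)) + 1) * (m + 1)"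
          using ties_le[of ?y] by (simp add: add_mult_distrib del: mult_Suc_right)
        also note le
        also have "nat (gap x + int (ties x)) * (m + 1) \<le> nat (gap x + int (ties x)) * (m + 1) + ties x"
          by (rule le_add1)
        finally have "nat (gap ?y + int (ties ?y)) * (m + 1) + ties ?y < nat (gap x + int (ties x)) * (m + 1) + ties x" .
        then show ?thesis using y by (rule less.IH)
      qed
    next
      case False
      then have lasty: "last_entry ?y = last_entry x" using len by simp
      have gapy: "gap ?y = gap x + 1" unfolding gap_def lasty sumy by simp
      have sg: "letter (x ! K + 1) = i" by (rule f_acts_sig[OF K Km])
      have xK: "letter (x ! K) = letter (last_entry x)"
        using sg letter_succ_eq_iff by (simp add: i_def)
      have yK: "letter (?y ! K) \<noteq> letter (last_entry x)"
        using sg letter_succ_neq Km len by (simp add: i_def)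
      have "{j. j < m \<and> letter (?y ! j) = letter (last_entry ?y)} =
          {j. j < m \<and> letter (x ! j) = letter (last_entry x)} - {K}"
        using yK Km len unfolding lasty by (auto simp: nth_list_update split: if_splits)
      then have tiesy: "ties ?y = ties x - 1"
        unfolding ties_def using xK Km by simp
      then have "gap ?y + int (ties ?y) = gap x + int (ties x)" "ties ?y < ties x"
        using gapy ties_pos[of x] by auto
      then have "nat (gap ?y + int (ties ?y)) * (m + 1) + ties ?y < nat (gap x + int (ties x)) * (m + 1) + ties x"
        by simp
      then show ?thesis using y by (rule less.IH)
    qed
    then show ?thesis
      by (rule reach_f_rev[OF _ _ K Km len]) (simp add: i_def letter_le)
  qed
qed

section \<open>Identification of the subcrystal\<close>

lemma e_op_None: "e_op l' i None = None" and f_op_None: "f_op l' i None = None"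
  by (simp_all add: e_op_def f_op_def on_classes_def)

lemma op_monoid_seqs:
  assumes "a \<in> op_monoid l"
  shows "a (Some (cls (replicate m 0))) \<in> insert None (Some ` cls ` seqs)"
  using assms
proof (induction rule: op_monoid.induct)
  case one
  have "replicate m 0 \<in> seqs" by (simp add: seqs_iff)
  then show ?case by simp
next
  case (e i a)
  show ?case
  proof (cases "a (Some (cls (replicate m 0)))")
    case None
    then show ?thesis by (simp add: e_op_None)
  next
    case (Some X)
    then obtain x where x: "x \<in> seqs" "X = cls x" using e.IH by auto
    then have len: "length x = m" by (simp add: seqs_iff)
    obtain K where K: "e_acts i x K" using e_acts_exists by blast
    show ?thesis
    proof (cases K)
      case 0
      then show ?thesis using e_op_cls(1)[OF e(1) len] K Some x by simp
    next
      case (Suc K')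
      then show ?thesis
        using e_op_cls(2)[OF e(1) len, of K'] e_step_in_seqs[OF x(1), of i K'] K Some x by simp
    qed
  qed
next
  case (f i a)
  show ?case
  proof (cases "a (Some (cls (replicate m 0)))")
    case None
    then show ?thesis by (simp add: f_op_None)
  next
    case (Some X)
    then obtain x where x: "x \<in> seqs" "X = cls x" using f.IH by auto
    then have len: "length x = m" by (simp add: seqs_iff)
    obtain K where K: "f_acts i x K" using f_acts_exists by blast
    then have "K = m \<or> K < m" by (auto simp: f_acts_def)
    then show ?thesis
      using f_op_cls[OF f(1) K len] f_step_in_seqs[OF x(1) K] Some x by auto
  qed
qed

text \<open>The entry 0 stands for the displacement \<omega> + (n / m) \<delta>, so m equal steps of
  this kind form the straight line.\<close>

lemma p_path_cls: "p_path l m n = cls (replicate m 0)"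
proof -
  let ?v = "real m *\<^sub>R omega + real n *\<^sub>R delta"
  have mod0: "(0 + 1) mod (l + 1) = 1" using l by simp
  have step0: "real m *\<^sub>R step_weight 0 = ?v"
    using m l by (simp add: step_weight_def letter_def letter_weight_def omega_def scaleR_right_distrib)
  have eq: "xpath (replicate m 0) \<tau> = \<tau> *\<^sub>R ?v" if \<tau>: "\<tau> \<in> {0..1}" for \<tau>
  proof -
    obtain k s where ks: "k < m" "0 \<le> s" "s \<le> 1" "\<tau> = (real k + s) / real m"
      by (rule unit_interval_segment[OF \<tau> m_pos]) (rule that)
    have "xpath (replicate m 0) \<tau> = (real k + s) *\<^sub>R step_weight 0"
      unfolding ks(4) xpath_segment[OF ks(1-3)] using ks(1)
      by (simp add: scaleR_left_distrib sum_constant_scaleR)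
    also have "\<dots> = \<tau> *\<^sub>R (real m *\<^sub>R step_weight 0)"
      using ks(4) m by simp
    finally show ?thesis by (simp only: step0)
  qed
  have "piecewise_linear (\<lambda>\<tau>. \<tau> *\<^sub>R ?v)"
    using piecewise_linear_affine[of 0 ?v] by simp
  then have "(\<lambda>\<tau>. \<tau> *\<^sub>R ?v) \<in> pl_paths l"
    using xpath_in_pl_paths[of "replicate m 0"] eq[of 1] eq[symmetric] by (auto simp: pl_paths_def)
  then show ?thesis
    unfolding p_path_def cls_def by (intro path_class_cong xpath_in_pl_paths) (simp_all add: eq)
qed

lemma subcrystal_eq: "subcrystal l (p_path l m n) = cls ` seqs"
proof
  show "subcrystal l (p_path l m n) \<subseteq> cls ` seqs"
    unfolding subcrystal_def p_path_cls using op_monoid_seqs by fastforce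
  show "cls ` seqs \<subseteq> subcrystal l (p_path l m n)"
    unfolding p_path_cls using reach_seqs by (auto simp: reach_def)
qed

text \<open>Invariant under reparametrization, and fine enough to separate the paths \<open>xpath x\<close>.\<close>

definition visits :: "(real \<Rightarrow> weight) \<Rightarrow> (nat \<Rightarrow> weight) \<Rightarrow> bool"
  where "visits b v \<longleftrightarrow> (\<exists>t. (\<forall>j\<le>m. t j \<in> {0..1} \<and> b (t j) = v j) \<and>
    (\<forall>j k. j \<le> k \<longrightarrow> k \<le> m \<longrightarrow> t j \<le> t k))"

lemma visits_reparametrizes:
  assumes "reparametrizes l b b'"
  shows "visits b v = visits b' v"
proof -
  from assms obtain \<phi> where phi: "b \<in> pl_paths l" "b' \<in> pl_paths l" "piecewise_linear \<phi>" "mono_on {0..1} \<phi>"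
    "\<phi> 0 = 0" "\<phi> 1 = 1" "\<forall>\<tau>\<in>{0..1}. b' \<tau> = b (\<phi> \<tau>)" "\<phi> ` {0..1} = {0..1}"
    "\<forall>i. \<forall>\<tau>\<in>{0..1}. h_fun i b' \<tau> = h_fun i b (\<phi> \<tau>)" "\<forall>i. eps i b' = eps i b"
    by (rule reparametrizesE)
  show ?thesis
  proof
    assume "visits b v"
    then obtain t where t: "\<And>j. j \<le> m \<Longrightarrow> t j \<in> {0..1}" "\<And>j. j \<le> m \<Longrightarrow> b (t j) = v j"
      "\<And>j k. j \<le> k \<Longrightarrow> k \<le> m \<Longrightarrow> t j \<le> t k" unfolding visits_def by blast
    \<comment> \<open>One fixed choice function sends equal times to equal preimages; this keeps s
      monotone where \<phi> is constant.\<close>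
    define s where "s j = inv_into {0..1} \<phi> (t j)" for j
    have s: "s j \<in> {0..1}" "\<phi> (s j) = t j" if "j \<le> m" for j
    proof -
      have "t j \<in> \<phi> ` {0..1}" using t(1)[OF that] phi(8) by simp
      then show "s j \<in> {0..1}" "\<phi> (s j) = t j"
        unfolding s_def by (rule inv_into_into, rule f_inv_into_f)
    qed
    have "s j \<le> s k" if "j \<le> k" "k \<le> m" for j k
    proof (rule ccontr)
      assume "\<not> s j \<le> s k"
      then have "\<phi> (s k) \<le> \<phi> (s j)"
        using s[of j] s[of k] that by (intro mono_onD[OF phi(4)]) auto
      then have "t j = t k" using s[of j] s[of k] t(3)[OF that] that by simp
      then have "s j = s k" by (simp add: s_def)
      with \<open>\<not> s j \<le> s k\<close> show False by simp
    qed
    moreover have "b' (s j) = v j" if "j \<le> m" for j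
      using s[OF that] t(2)[OF that] phi(7) by simp
    ultimately show "visits b' v" unfolding visits_def using s(1) by blast
  next
    assume "visits b' v"
    then obtain t where t: "\<And>j. j \<le> m \<Longrightarrow> t j \<in> {0..1}" "\<And>j. j \<le> m \<Longrightarrow> b' (t j) = v j"
      "\<And>j k. j \<le> k \<Longrightarrow> k \<le> m \<Longrightarrow> t j \<le> t k" unfolding visits_def by blast
    have "\<phi> (t j) \<in> {0..1}" if "j \<le> m" for j using t(1)[OF that] phi(8) by blast
    moreover have "b (\<phi> (t j)) = v j" if "j \<le> m" for j
      using t(1,2)[OF that] phi(7) by simp
    moreover have "\<phi> (t j) \<le> \<phi> (t k)" if "j \<le> k" "k \<le> m" for j k
      using t(1)[of j] t(1)[OF that(2)] t(3)[OF that] that by (intro mono_onD[OF phi(4)]) auto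
    ultimately show "visits b v" unfolding visits_def by (intro exI[of _ "\<lambda>j. \<phi> (t j)"]) blast
  qed
qed

section \<open>Injectivity of the coding by sequences\<close>

lemma step_weight_inj:
  assumes "step_weight y = step_weight z"
  shows "y = z"
proof -
  have "sig (letter z) y = sig (letter z) z"
    using arg_cong[OF assms, of "coroot (letter z)"] coroot_step_weight[OF letter_le] by simp
  then have "letter y = letter z" using sig_values(2)[of "letter z"] by metis
  then have "y mod (int l + 1) = z mod (int l + 1)" by (metis of_nat_letter)
  moreover have "y div (int l + 1) = z div (int l + 1)"
    using arg_cong[OF assms, of snd] by (simp add: snd_step_weight)
  ultimately show ?thesis by (metis div_mult_mod_eq)
qed

lemma step_weight_nonzero: "step_weight z \<noteq> 0"
proof
  assume "step_weight z = 0"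
  then have "sig (letter z) z = 0"
    using coroot_step_weight[OF letter_le[of z], of z] by simp
  then show False using sig_values(2)[of "letter z" z] by simp
qed

text \<open>Along a segment the coroot indexed by the letter of the current step pairs to -1 with
  the displacement, so the pairing runs strictly between consecutive integers inside the
  segment.\<close>

lemma integral_point_is_vertex:
  assumes "\<tau> \<in> {0..1}" "\<And>i. i \<le> l \<Longrightarrow> coroot i (xpath y \<tau>) \<in> \<int>"
  shows "\<exists>k\<le>m. \<tau> = real k / real m"
proof -
  obtain k s where ks: "k < m" "0 \<le> s" "s \<le> 1" "\<tau> = (real k + s) / real m"
    by (rule unit_interval_segment[OF assms(1) m_pos]) (rule that)
  let ?i = "letter (y ! k)"
  have "coroot ?i (xpath y \<tau>) = (\<Sum>j<k. real_of_int (sig ?i (y ! j))) + s * real_of_int (sig ?i (y ! k))"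
    unfolding ks(4) xpath_segment[OF ks(1-3)]
    by (simp only: coroot_add coroot_sum coroot_scaleR coroot_step_weight[OF letter_le])
  also have "sig ?i (y ! k) = - 1" by (simp add: sig_values)
  finally have "s = real_of_int (\<Sum>j<k. sig ?i (y ! j)) - coroot ?i (xpath y \<tau>)" by simp
  also have "\<dots> \<in> \<int>" using assms(2)[OF letter_le] by (intro Ints_diff Ints_of_int)
  finally have "s \<in> \<int>" .
  then obtain z where "s = of_int z" by (elim Ints_cases)
  with ks(2,3) have "z = 0 \<or> z = 1" by auto
  with \<open>s = of_int z\<close> have "s = 0 \<or> s = 1" by auto
  then show ?thesis
  proof
    assume "s = 0"
    with ks show ?thesis by (intro exI[of _ k]) simp
  next
    assume "s = 1"
    with ks show ?thesis by (intro exI[of _ "Suc k"]) (simp add: add.commute)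
  qed
qed

lemma strict_mono_nat_bounded_id:
  fixes \<kappa> :: "nat \<Rightarrow> nat"
  assumes "\<And>j. j < M \<Longrightarrow> \<kappa> j < \<kappa> (Suc j)" "\<kappa> M \<le> M" "j \<le> M"
  shows "\<kappa> j = j"
proof -
  have "j \<le> \<kappa> j" if "j \<le> M" for j
    using that
  proof (induction j)
    case (Suc j)
    then show ?case using assms(1)[of j] by simp
  qed simp
  moreover have "\<kappa> j \<le> j" if "j \<le> M" for j
    using that
  proof (induction j rule: inc_induct)
    case base
    show ?case by (rule assms(2))
  next
    case (step j)
    then show ?case using assms(1)[of j] by simp
  qed
  ultimately show ?thesis using assms(3) by (simp add: order_antisym)
qed

text \<open>The path of y passes through the vertices of the path of x in order. These are integral
  points, so this happens at vertices of the path of y, and at strictly increasing ones because no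
  displacement is 0. Strictly increasing indices from 0 to m leave no choice, so the partial sums
  agree.\<close>

lemma cls_inj:
  assumes "cls x = cls y" "length x = m" "length y = m"
  shows "x = y"
proof -
  define v where "v j = (\<Sum>i<j. step_weight (x ! i))" for j
  have mono: "real j / real m \<le> real k / real m" if "j \<le> k" for j k :: nat
    using that by (simp add: divide_right_mono)
  have "visits (xpath x) v"
    unfolding visits_def v_def
    by (rule exI[of _ "\<lambda>j. real j / real m"]) (use vertex_in_unit xpath_vertex mono in auto)
  moreover have "xpath y \<in> path_class l (xpath x)"
    using path_class_self[OF xpath_in_pl_paths[of y]] assms(1) by (simp add: cls_def)
  then have "visits (xpath y) v = visits (xpath x) v"
    by (rule path_class_invariant[of _ _ _ "\<lambda>b. visits b v"]) (rule visits_reparametrizes)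
  ultimately have "visits (xpath y) v" by simp
  then obtain t where t: "\<And>j. j \<le> m \<Longrightarrow> t j \<in> {0..1}" "\<And>j. j \<le> m \<Longrightarrow> xpath y (t j) = v j"
    "\<And>j k. j \<le> k \<Longrightarrow> k \<le> m \<Longrightarrow> t j \<le> t k" unfolding visits_def by blast
  have "\<exists>k\<le>m. t j = real k / real m" if "j \<le> m" for j
  proof (rule integral_point_is_vertex[OF t(1)[OF that]])
    fix i assume "i \<le> l"
    then show "coroot i (xpath y (t j)) \<in> \<int>"
      unfolding t(2)[OF that] v_def coroot_sum
      by (intro Ints_sum) (simp add: coroot_step_weight)
  qed
  then obtain \<kappa> where \<kappa>: "\<And>j. j \<le> m \<Longrightarrow> \<kappa> j \<le> m" "\<And>j. j \<le> m \<Longrightarrow> t j = real (\<kappa> j) / real m"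
    by metis
  have "\<kappa> j < \<kappa> (Suc j)" if j: "j < m" for j
  proof -
    have "v j \<noteq> v (Suc j)" using step_weight_nonzero by (simp add: v_def)
    then have "t j \<noteq> t (Suc j)" using t(2)[of j] t(2)[of "Suc j"] j by force
    moreover have "t j \<le> t (Suc j)" using t(3)[of j "Suc j"] j by simp
    ultimately have "t j < t (Suc j)" by linarith
    then have "real (\<kappa> j) / real m < real (\<kappa> (Suc j)) / real m"
      using \<kappa>(2)[of j] \<kappa>(2)[of "Suc j"] j by simp
    then show ?thesis using m by (simp add: divide_less_cancel)
  qed
  then have "\<kappa> j = j" if "j \<le> m" for j
    using strict_mono_nat_bounded_id[of m \<kappa> j] \<kappa>(1)[of m] that by simp
  then have v_y: "(\<Sum>i<j. step_weight (y ! i)) = v j" if "j \<le> m" for j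
    using t(2)[OF that] \<kappa>(2)[OF that] xpath_vertex[OF that, of y] that by simp
  have "y ! j = x ! j" if "j < m" for j
    using v_y[of j] v_y[of "Suc j"] that by (intro step_weight_inj) (simp add: v_def)
  then show ?thesis using assms(2,3) by (intro nth_equalityI) auto
qed

text \<open>Inverse to taking letters once the first quotient -k is known: as consecutive entries
  decrease by at most l, the quotient by l + 1 drops by 1 at an ascent of the word and stays the
  same otherwise.\<close>

fun lift_word :: "int \<Rightarrow> nat list \<Rightarrow> int list" where
  "lift_word k [] = []"
| "lift_word k [a] = [int a - k * (int l + 1)]"
| "lift_word k (a # b # w) = (int a - k * (int l + 1)) # lift_word (if a < b then k + 1 else k) (b # w)"

lemma letter_lift: "a \<le> l \<Longrightarrow> letter (int a - k * (int l + 1)) = a"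
  and div_lift: "a \<le> l \<Longrightarrow> (int a - k * (int l + 1)) div (int l + 1) = - k"
proof -
  assume a: "a \<le> l"
  have e: "int a - k * (int l + 1) = int a + (int l + 1) * (- k)" by (simp add: algebra_simps)
  have "(int a - k * (int l + 1)) mod (int l + 1) = int a mod (int l + 1)"
    unfolding e by (rule mod_mult_self2)
  then show "letter (int a - k * (int l + 1)) = a" using a by (simp add: letter_def)
  have "(int a - k * (int l + 1)) div (int l + 1) = - k + int a div (int l + 1)"
    unfolding e by (rule div_mult_self2) simp
  then show "(int a - k * (int l + 1)) div (int l + 1) = - k" using a by simp
qed

text \<open>An ascent lowers the quotients of all later entries by 1, so it contributes the length
  of the remaining word to the sum of quotients; this is where the comajor index comes from.\<close>

lemma lift_word_properties:
  assumes "set w \<subseteq> {..l}"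
  shows "map letter (lift_word k w) = w \<and> successively (\<lambda>a b. b \<le> a \<and> a \<le> b + int l) (lift_word k w) \<and>
    (w \<noteq> [] \<longrightarrow> hd (lift_word k w) = int (hd w) - k * (int l + 1)) \<and>
    sum_list (map (\<lambda>z. z div (int l + 1)) (lift_word k w)) = - (k * int (length w) + int (comaj w))"
  using assms
proof (induction w arbitrary: k rule: induct_list012)
  case (3 a b w)
  let ?k = "if a < b then k + 1 else k"
  have ab: "a \<le> l" "b \<le> l" using 3 by auto
  have ne: "lift_word ?k (b # w) \<noteq> []" by (cases w) simp_all
  note IH = 3(2)[of ?k]
  have "hd (lift_word ?k (b # w)) = int b - ?k * (int l + 1)"
    using IH 3(3) by simp
  moreover have "int b - ?k * (int l + 1) \<le> int a - k * (int l + 1)"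
    "int a - k * (int l + 1) \<le> int b - ?k * (int l + 1) + int l"
    using ab by (simp_all add: algebra_simps)
  moreover have "successively (\<lambda>a b. b \<le> a \<and> a \<le> b + int l) (lift_word ?k (b # w))"
    using IH 3(3) by simp
  ultimately have "successively (\<lambda>a b. b \<le> a \<and> a \<le> b + int l) (lift_word k (a # b # w))"
    unfolding lift_word.simps successively_Cons using ne by simp
  moreover have "map letter (lift_word k (a # b # w)) = a # b # w"
    using IH 3(3) unfolding lift_word.simps list.map letter_lift[OF ab(1)] by simp
  moreover have "sum_list (map (\<lambda>z. z div (int l + 1)) (lift_word k (a # b # w))) =
      - (k * int (length (a # b # w)) + int (comaj (a # b # w)))"
  proof -
    have S: "sum_list (map (\<lambda>z. z div (int l + 1)) (lift_word ?k (b # w))) =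
        - (?k * int (length (b # w)) + int (comaj (b # w)))"
      using IH 3(3) by simp
    show ?thesis
      unfolding lift_word.simps list.map sum_list.Cons div_lift[OF ab(1)] S
      by (simp add: algebra_simps)
  qed
  ultimately show ?case by simp
qed (simp_all add: letter_lift div_lift)

text \<open>The difference y - z lies in \<open>{0..l}\<close> and the remainders differ by at most
  l, so the quotients differ by 0 or 1; comparing the letters decides which.\<close>

lemma lift_word_of_seq:
  assumes "successively (\<lambda>a b. b \<le> a \<and> a \<le> b + int l) x" "x \<noteq> []"
  shows "lift_word (- (hd x div (int l + 1))) (map letter x) = x"
  using assms
proof (induction x rule: induct_list012)
  case (2 z)
  then show ?case by (simp add: of_nat_letter) (metis mod_div_mult_eq)
next
  case (3 y z x)
  define N where "N = int l + 1"
  define q r q' r' where "q = y div N" "r = y mod N" "q' = z div N" "r' = z mod N"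
  note defs = this
  have yz: "y = q * N + r" "z = q' * N + r'" by (simp_all add: defs)
  have r: "0 \<le> r" "r < N" "0 \<le> r'" "r' < N" using pos_mod_bound[of N] by (simp_all add: defs N_def)
  have le: "z \<le> y" "y \<le> z + int l" using 3(3) by auto
  have dq: "(q - q') * N = y - z - (r - r')" using yz by (simp add: algebra_simps)
  have "- N < (q - q') * N" "(q - q') * N < 2 * N"
    using dq r le by (simp_all add: N_def)
  then have "- 1 < q - q'" "q - q' < 2"
    using r(1,2) mult_less_cancel_right_pos[of N "- 1" "q - q'"] mult_less_cancel_right_pos[of N "q - q'" 2] by auto
  then have "q - q' = 0 \<or> q - q' = 1" by linarith
  then have "q' = (if letter y < letter z then q - 1 else q)"
  proof
    have lt: "letter y < letter z \<longleftrightarrow> r < r'"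
      using r(1) unfolding letter_def defs N_def by (rule nat_less_eq_zless)
    show ?thesis if "q - q' = 0" using that dq le lt by auto
    show ?thesis if "q - q' = 1" using that dq le lt r by (auto simp: N_def)
  qed
  then have k: "(if letter y < letter z then - q + 1 else - q) = - q'" by auto
  have "lift_word (- q) (map letter (y # z # x)) = (int (letter y) + q * N) # lift_word (- q') (map letter (z # x))"
    using k by (simp add: N_def)
  also have "lift_word (- q') (map letter (z # x)) = z # x"
    using 3(2,3) by (simp add: defs N_def)
  also have "int (letter y) + q * N = y"
    using yz by (simp add: of_nat_letter defs N_def)
  finally show ?case by (simp add: defs N_def)
qed simp

section \<open>Weights of sequences in terms of words\<close>

definition word_weight :: "nat list \<Rightarrow> weight"
  where "word_weight w = (\<Sum>j<length w. letter_weight l (w ! j))"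

lemma snd_word_weight: "snd (word_weight w) = 0"
  by (simp add: word_weight_def snd_sum_weight letter_weight_def fund_weight_def)

lemma sum_list_div: "length x = m \<Longrightarrow> sum_list (map (\<lambda>z. z div (int l + 1)) x) = (\<Sum>j<m. x ! j div (int l + 1))"
  by (simp add: sum_list_sum_nth atLeast0LessThan)

lemma fst_endpoint:
  assumes "length x = m"
  shows "fst (endpoint x) = fst (word_weight (map letter x))"
  using assms by (simp add: fun_eq_iff endpoint_def word_weight_def fst_sum_fun step_weight_def delta_def scaleR_fun_def)

lemma endpoint_eq_iff:
  assumes "length x = m"
  shows "endpoint x = \<nu> \<longleftrightarrow> word_weight (map letter x) = (fst \<nu>, 0) \<and>
    snd \<nu> = real_of_int (int n - sum_list (map (\<lambda>z. z div (int l + 1)) x))"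
  using fst_endpoint[OF assms] snd_endpoint[of x] snd_word_weight[of "map letter x"] sum_list_div[OF assms]
  by (auto simp: prod_eq_iff)

text \<open>If q is the quotient of the first entry by l + 1, the endpoint has degree n - q m plus
  the comajor index. Hence q is determined by the word and r, and it exists exactly under the
  congruence.\<close>

lemma bij_betw_seqs_endpoint:
  fixes r :: int
  assumes "snd \<nu> = real_of_int r"
  defines "S \<equiv> {w \<in> words l m. word_weight w = (fst \<nu>, 0) \<and> int m dvd (int n - r) + int (comaj w)}"
  shows "bij_betw (map letter) {x \<in> seqs. endpoint x = \<nu>} S"
proof (rule bij_betw_imageI)
  let ?k = "\<lambda>x. - (hd x div (int l + 1))"
  have x_eq: "lift_word (?k x) (map letter x) = x" "set (map letter x) \<subseteq> {..l}" "length x = m" if "x \<in> seqs" for x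
  proof -
    have "x \<noteq> []" "length x = m" using that m by (auto simp: seqs_def)
    then show "lift_word (?k x) (map letter x) = x" "set (map letter x) \<subseteq> {..l}" "length x = m"
      using that lift_word_of_seq[of x] letter_le by (auto simp: seqs_def)
  qed
  have deg: "r = int n + ?k x * int m + int (comaj (map letter x))" if "x \<in> seqs" "endpoint x = \<nu>" for x
  proof -
    have "sum_list (map (\<lambda>z. z div (int l + 1)) x) = - (?k x * int m + int (comaj (map letter x)))"
      using lift_word_properties[OF x_eq(2)[OF that(1)], of "?k x"] x_eq[OF that(1)] by simp
    moreover have "real_of_int r = real_of_int (int n - sum_list (map (\<lambda>z. z div (int l + 1)) x))"
      using endpoint_eq_iff[OF x_eq(3)[OF that(1)], of \<nu>] that(2) assms(1) by metis
    then have "r = int n - sum_list (map (\<lambda>z. z div (int l + 1)) x)"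
      by (simp only: of_int_eq_iff)
    ultimately show ?thesis by simp
  qed
  show "inj_on (map letter) {x \<in> seqs. endpoint x = \<nu>}"
  proof (rule inj_onI)
    fix x y assume xy: "x \<in> {x \<in> seqs. endpoint x = \<nu>}" "y \<in> {x \<in> seqs. endpoint x = \<nu>}"
      "map letter x = map letter y"
    then have "r = int n + ?k x * int m + int (comaj (map letter y))"
      "r = int n + ?k y * int m + int (comaj (map letter y))"
      using deg[of x] deg[of y] by auto
    then have e: "?k x * int m = ?k y * int m" by linarith
    have "int m \<noteq> 0" using m by simp
    from iffD1[OF mult_right_cancel[OF this] e] have k: "?k x = ?k y" .
    have "x = lift_word (?k x) (map letter x)" using x_eq(1)[of x] xy(1) by simp
    also have "\<dots> = y" unfolding k xy(3) using x_eq(1)[of y] xy(2) by simp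
    finally show "x = y" .
  qed
  show "map letter ` {x \<in> seqs. endpoint x = \<nu>} = S"
  proof (intro equalityI subsetI)
    fix w assume "w \<in> map letter ` {x \<in> seqs. endpoint x = \<nu>}"
    then obtain x where x: "x \<in> seqs" "endpoint x = \<nu>" "w = map letter x" by blast
    have "int n - r + int (comaj w) = - (int m * ?k x)" using deg[OF x(1,2)] x(3) by simp
    then have "int m dvd (int n - r) + int (comaj w)" by simp
    then show "w \<in> S"
      using x endpoint_eq_iff[OF x_eq(3)[OF x(1)], of \<nu>] x_eq[OF x(1)] by (auto simp: S_def words_def)
  next
    fix w assume w: "w \<in> S"
    \<comment> \<open>k becomes the quotient of the first entry of the lifted word, whence the
      argument -k below.\<close>
    then obtain k where k: "(int n - r) + int (comaj w) = int m * k" by (auto simp: S_def)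
    have ww: "set w \<subseteq> {..l}" "length w = m" using w by (auto simp: S_def words_def)
    let ?x = "lift_word (- k) w"
    note props = lift_word_properties[OF ww(1), of "- k"]
    then have mx: "map letter ?x = w" by simp
    then have lx: "length ?x = m" using ww by (metis length_map)
    then have "?x \<in> seqs" using props by (simp add: seqs_def)
    moreover have "endpoint ?x = \<nu>"
      unfolding endpoint_eq_iff[OF lx] mx
    proof
      show "word_weight w = (fst \<nu>, 0)" using w by (simp add: S_def)
      have "sum_list (map (\<lambda>z. z div (int l + 1)) ?x) = k * int m - int (comaj w)"
        using props ww by simp
      then show "snd \<nu> = real_of_int (int n - sum_list (map (\<lambda>z. z div (int l + 1)) ?x))"
        using assms(1) k by (simp add: algebra_simps)
    qed
    ultimately show "w \<in> map letter ` {x \<in> seqs. endpoint x = \<nu>}" using mx by force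
  qed
qed

lemma crystal_weight_set:
  "{X \<in> subcrystal l (p_path l m n). wt X = \<nu>} = cls ` {x \<in> seqs. endpoint x = \<nu>}"
  unfolding subcrystal_eq by (auto simp: wt_cls)

lemma card_crystal_weight_set:
  "card {X \<in> subcrystal l (p_path l m n). wt X = \<nu>} = card {x \<in> seqs. endpoint x = \<nu>}"
  unfolding crystal_weight_set by (rule card_image) (auto simp: inj_on_def seqs_iff intro: cls_inj)

end

section \<open>The loop module as an eigenspace of the twisted cyclic shift\<close>

lemma affine_act_add: "affine_act l m \<zeta> x (U + V) = affine_act l m \<zeta> x U + affine_act l m \<zeta> x V"
proof -
  have "factor_act l m j A (u + v) w = factor_act l m j A u w + factor_act l m j A v w" for j A u v w
    by (simp add: factor_act_def plus_fun_def distrib_left sum.distrib)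
  then have "affine_act l m \<zeta> x (U + V) r w = affine_act l m \<zeta> x U r w + affine_act l m \<zeta> x V r w" for r w
    by (simp only: affine_act_def plus_fun_apply distrib_left sum.distrib) (simp add: algebra_simps)
  then show ?thesis
    by (intro ext) (simp only: plus_fun_apply)
qed

lemma affine_act_scale: "affine_act l m \<zeta> x (scale_lt c U) = scale_lt c (affine_act l m \<zeta> x U)"
  by (simp add: affine_act_def factor_act_def scale_lt_def fun_eq_iff sum_distrib_left
      mult.left_commute distrib_left if_distrib cong: if_cong)

lemma affine_act_zero: "affine_act l m \<zeta> x 0 = 0"
  using affine_act_scale[of l m \<zeta> x 0 0] by (simp only: lt.scale_zero_left)

lemma affine_act_sum: "affine_act l m \<zeta> x (\<Sum>i\<in>I. U i) = (\<Sum>i\<in>I. affine_act l m \<zeta> x (U i))"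
  by (induction I rule: infinite_finite_induct)
    (simp_all only: affine_act_zero affine_act_add sum.infinite sum.empty sum.insert not_False_eq_True)

lemma sum_lt_apply: "(\<Sum>i\<in>I. U i) r w = (\<Sum>i\<in>I. U i r w)" for U :: "'i \<Rightarrow> laurent_tensor"
  by (induction I rule: infinite_finite_induct) simp_all

lemma finite_words: "finite (words l m)"
proof -
  have "words l m = {w. set w \<subseteq> {..l} \<and> length w = m}" by (auto simp: words_def)
  then show ?thesis by (simp add: finite_lists_length_eq)
qed

lemma rotate_in_words [simp]: "rotate i w \<in> words l m \<longleftrightarrow> w \<in> words l m"
  by (simp add: words_def)

lemma sum_nth_eq_sum_mset: "(\<Sum>j<length w. f (w ! j)) = (\<Sum>a\<in>#mset w. f a)"
proof -
  have "sum_list (map f w) = (\<Sum>j<length w. f (w ! j))"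
    by (simp add: sum_list_sum_nth atLeast0LessThan)
  then show ?thesis by (metis mset_map sum_mset_sum_list)
qed

lemma rotate1_in_words [simp]: "rotate1 w \<in> words l m \<longleftrightarrow> w \<in> words l m"
  by (simp add: words_def)

lemma words_nth_le: "w \<in> words l m \<Longrightarrow> j < m \<Longrightarrow> w ! j \<le> l"
  using nth_mem[of j w] by (auto simp: words_def simp del: nth_mem)

lemma words_update: "w \<in> words l m \<Longrightarrow> a \<le> l \<Longrightarrow> w[j := a] \<in> words l m"
  using set_update_subset_insert[of w j a] by (auto simp: words_def)

lemma rotate1_nth: "j < length w \<Longrightarrow> rotate1 w ! j = w ! (Suc j mod length w)"
  using nth_rotate[of j w 1] by (simp add: add.commute)

lemma rotate1_update:
  assumes "j < length w"
  shows "rotate1 (w[Suc j mod length w := a]) = (rotate1 w)[j := a]"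
proof (rule nth_equalityI)
  fix k assume "k < length (rotate1 (w[Suc j mod length w := a]))"
  then have k: "k < length w" by simp
  have "Suc k mod length w = Suc j mod length w \<longleftrightarrow> k = j"
    using assms k by (auto simp: mod_Suc split: if_splits)
  moreover have "0 < length w" using k by linarith
  then have "Suc k mod length w < length w" by (rule mod_less_divisor)
  ultimately show "rotate1 (w[Suc j mod length w := a]) ! k = (rotate1 w)[j := a] ! k"
    using assms k by (auto simp: rotate1_nth nth_list_update)
qed simp

section \<open>Basis vectors and test elements of the loop algebra\<close>

definition unit_lt :: "nat list \<Rightarrow> int \<Rightarrow> laurent_tensor"
  where "unit_lt w r = (\<lambda>r' v. if r' = r \<and> v = w then 1 else 0)"

lemma hw_generator_unit: "hw_generator m n = unit_lt (replicate m 0) (int n)"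
  by (simp add: hw_generator_def unit_lt_def fun_eq_iff)

definition loop_elt :: "nat \<Rightarrow> complex mat \<Rightarrow> int \<Rightarrow> affine"
  where "loop_elt l A k = Affine (\<lambda>k'. if k' = k then A else zero_sl l) 0 0"

lemma zero_sl_in_sl: "zero_sl l \<in> sl l"
  by (simp add: sl_def mat_trace_def)

lemma loop_elt_in_affine_algebra:
  assumes "A \<in> sl l"
  shows "loop_elt l A k \<in> affine_algebra l"
proof -
  have "loop_support l (loop_elt l A k) \<subseteq> {k}"
    by (auto simp: loop_support_def loop_elt_def split: if_splits)
  then have "finite (loop_support l (loop_elt l A k))" by (rule finite_subset) simp
  with assms zero_sl_in_sl show ?thesis
    by (auto simp: affine_algebra_def loop_elt_def)
qed

lemma affine_act_loop_elt:
  assumes "A \<noteq> zero_sl l"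
  shows "affine_act l m \<zeta> (loop_elt l A k) U r w =
    (\<Sum>j<m. (\<zeta> ^ (j + 1)) powi k * factor_act l m j A (U (r - k)) w)"
proof -
  have "loop_support l (loop_elt l A k) = {k}"
    using assms by (auto simp: loop_support_def loop_elt_def)
  then show ?thesis
    by (simp add: affine_act_def) (simp add: loop_elt_def)
qed

text \<open>Traceless for a > 0. It replaces a letter 0 by a, so every word can be built from the
  zero word.\<close>

definition lowering :: "nat \<Rightarrow> nat \<Rightarrow> complex mat"
  where "lowering l a = Matrix.mat (l + 1) (l + 1) (\<lambda>(p, q). if p = a \<and> q = 0 then 1 else 0)"

text \<open>Has eigenvalue 1 on the first basis vector and therefore moves the generator between
  degrees without changing its tensor part.\<close>

definition coroot_mat :: "nat \<Rightarrow> complex mat"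
  where "coroot_mat l = Matrix.mat (l + 1) (l + 1) (\<lambda>(p, q). if p = 0 \<and> q = 0 then 1 else if p = 1 \<and> q = 1 then - 1 else 0)"

lemma lowering_in_sl: "0 < a \<Longrightarrow> lowering l a \<in> sl l"
  by (auto simp: sl_def lowering_def mat_trace_def intro!: sum.neutral)

lemma coroot_mat_in_sl:
  assumes "1 \<le> l"
  shows "coroot_mat l \<in> sl l"
proof -
  have "mat_trace (coroot_mat l) = (\<Sum>p<l + 1. (if p = 0 then 1 else 0) + (if p = 1 then - 1 else 0))"
    unfolding mat_trace_def coroot_mat_def by (auto intro!: sum.cong)
  also have "\<dots> = 0" using assms by (simp add: sum.distrib)
  finally show ?thesis by (simp add: sl_def coroot_mat_def)
qed

lemma mat_entry_neq_zero_sl: "a \<le> l \<Longrightarrow> b \<le> l \<Longrightarrow> A $$ (a, b) \<noteq> 0 \<Longrightarrow> A \<noteq> zero_sl l"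
  by auto

lemma factor_act_lowering:
  assumes "a \<le> l" "j < m"
  shows "factor_act l m j (lowering l a) u w =
    (if w \<in> words l m \<and> w ! j = a then u (w[j := 0]) else 0)"
proof (cases "w \<in> words l m")
  case True
  have "(\<Sum>b\<le>l. lowering l a $$ (w ! j, b) * u (w[j := b])) =
      (\<Sum>b\<le>l. if b = 0 then (if w ! j = a then u (w[j := 0]) else 0) else 0)"
    using words_nth_le[OF True assms(2)] by (intro sum.cong refl) (auto simp: lowering_def)
  then show ?thesis using True by (simp add: factor_act_def)
qed (simp add: factor_act_def)

lemma factor_act_diagonal:
  assumes "A \<in> carrier_mat (l + 1) (l + 1)" "diagonal_mat A" "j < m" "w \<in> words l m"
  shows "factor_act l m j A u w = A $$ (w ! j, w ! j) * u w"
proof -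
  have wj: "w ! j \<le> l" by (rule words_nth_le[OF assms(4,3)])
  have "(\<Sum>b\<le>l. A $$ (w ! j, b) * u (w[j := b])) =
      (\<Sum>b\<le>l. if b = w ! j then A $$ (w ! j, w ! j) * u w else 0)"
    using assms(1,2) wj by (intro sum.cong refl) (auto simp: diagonal_mat_def)
  then show ?thesis using assms(4) wj by (simp add: factor_act_def)
qed

text \<open>Letter j of the rotated word is letter j + 1 of the word, cyclically; hence the shifted
  factor number on the left.\<close>

lemma factor_act_rotate:
  assumes "j < m"
  shows "factor_act l m (Suc j mod m) A (\<lambda>v. c * u (rotate1 v)) w = c * factor_act l m j A u (rotate1 w)"
proof (cases "w \<in> words l m")
  case True
  then have "length w = m" by (simp add: words_def)
  with True assms show ?thesis
    using rotate1_update[of j w] rotate1_nth[of j w]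
    by (simp add: factor_act_def sum_distrib_left mult.left_commute)
qed (simp add: factor_act_def)

locale quantum_loop_module =
  fixes l m n :: nat and \<zeta> :: complex
  assumes l: "1 \<le> l" and m: "1 \<le> m" and prim: "primitive_root m \<zeta>"
begin

lemma zeta_pow_m: "\<zeta> ^ m = 1" and zeta_nonzero: "\<zeta> \<noteq> 0"
  using prim m by (auto simp: primitive_root_def power_0_left split: if_splits)

lemma zeta_powi_eq_1_iff: "\<zeta> powi i = 1 \<longleftrightarrow> int m dvd i"
proof -
  have "\<zeta> ^ k = 1 \<longleftrightarrow> m dvd k" for k
    using prim m by (intro power_eq_1_iff_dvd) (auto simp: primitive_root_def)
  then show ?thesis
    by (cases i rule: int_cases2) (auto simp: power_int_minus)
qed

lemma sum_zeta_powi: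
  "(\<Sum>k<m. \<zeta> powi (int k * i)) = (if int m dvd i then of_nat m else 0)"
proof (cases "int m dvd i")
  case True
  then have "\<zeta> powi (int k * i) = 1" for k by (simp add: zeta_powi_eq_1_iff)
  with True show ?thesis by simp
next
  case False
  have "(1 - \<zeta> powi i) * (\<Sum>k<m. (\<zeta> powi i) ^ k) = 1 - (\<zeta> powi i) ^ m"
    by (simp add: one_diff_power_eq)
  also have "(\<zeta> powi i) ^ m = 1"
    using zeta_powi_eq_1_iff[of "i * int m"] by (simp add: power_int_power')
  finally have "(\<Sum>k<m. (\<zeta> powi i) ^ k) = 0"
    using False zeta_powi_eq_1_iff by simp
  then show ?thesis
    using False by (simp add: power_int_power' mult.commute)
qed

text \<open>The degree is counted from n so that the generator is fixed. A plain shift does not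
  commute with the action, as each factor carries its own power of \<zeta>; the degree twist
  compensates.\<close>

definition tau :: "laurent_tensor \<Rightarrow> laurent_tensor"
  where "tau U = (\<lambda>r w. \<zeta> powi (r - int n) * U r (rotate1 w))"

lemma tau_funpow: "(tau ^^ s) U r w = \<zeta> powi (int s * (r - int n)) * U r (rotate s w)"
proof (induction s arbitrary: w)
  case (Suc s)
  have "rotate s (rotate1 w) = rotate (Suc s) w"
    by (simp add: rotate1_rotate_swap)
  moreover have "(tau ^^ Suc s) U r w = \<zeta> powi (r - int n) * (tau ^^ s) U r (rotate1 w)"
    by (simp add: tau_def[of "(tau ^^ s) U"])
  ultimately show ?case
    using zeta_nonzero by (simp add: Suc power_int_add distrib_right del: rotate_Suc)
qed simp

text \<open>Passing to the next factor multiplies the scalar at z^k by \<zeta>^k, which is the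
  change of the twist when the degree rises by k. The step from the last factor to the first uses
  \<zeta>^m = 1.\<close>

lemma affine_act_tau: "affine_act l m \<zeta> x (tau U) = tau (affine_act l m \<zeta> x U)"
proof (intro ext)
  fix r w
  have "(\<Sum>j<m. (\<zeta> ^ (j + 1)) powi k * factor_act l m j (loop x k) (tau U (r - k)) w) =
      \<zeta> powi (r - int n) * (\<Sum>j<m. (\<zeta> ^ (j + 1)) powi k * factor_act l m j (loop x k) (U (r - k)) (rotate1 w))" for k
  proof -
    let ?f = "\<lambda>j. (\<zeta> ^ (j + 1)) powi k * factor_act l m j (loop x k) (tau U (r - k)) w"
    have "(\<Sum>j<m. ?f j) = (\<Sum>j<m. ?f (Suc j mod m))"
      using sum.reindex_bij_betw[OF bij_betw_add_mod, of m ?f 1] m by simp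
    also have "\<dots> = (\<Sum>j<m. \<zeta> powi (r - int n) *
        ((\<zeta> ^ (j + 1)) powi k * factor_act l m j (loop x k) (U (r - k)) (rotate1 w)))"
    proof (rule sum.cong[OF refl])
      fix j assume "j \<in> {..<m}"
      then have j: "j < m" by simp
      have "\<zeta> ^ (Suc j mod m + 1) = \<zeta> ^ (j + 1) * \<zeta>"
        using j zeta_pow_m by (cases "Suc j = m") (auto simp: mult.commute)
      then have "(\<zeta> ^ (Suc j mod m + 1)) powi k * \<zeta> powi (r - k - int n) =
          (\<zeta> ^ (j + 1)) powi k * (\<zeta> powi k * \<zeta> powi (r - k - int n))"
        by (simp only: power_int_mult_distrib mult.assoc)
      also have "\<zeta> powi k * \<zeta> powi (r - k - int n) = \<zeta> powi (r - int n)"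
        using zeta_nonzero by (simp flip: power_int_add)
      finally have z: "(\<zeta> ^ (Suc j mod m + 1)) powi k * \<zeta> powi (r - k - int n) =
          \<zeta> powi (r - int n) * (\<zeta> ^ (j + 1)) powi k" by (simp only: mult.commute)
      have "?f (Suc j mod m) = ((\<zeta> ^ (Suc j mod m + 1)) powi k * \<zeta> powi (r - k - int n)) *
          factor_act l m j (loop x k) (U (r - k)) (rotate1 w)"
        unfolding tau_def factor_act_rotate[OF j] by (simp only: mult.assoc)
      then show "?f (Suc j mod m) = \<zeta> powi (r - int n) *
          ((\<zeta> ^ (j + 1)) powi k * factor_act l m j (loop x k) (U (r - k)) (rotate1 w))"
        unfolding z by (simp only: mult.assoc)
    qed
    finally show ?thesis by (simp only: sum_distrib_left)
  qed
  then show "affine_act l m \<zeta> x (tau U) r w = tau (affine_act l m \<zeta> x U) r w"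
    unfolding affine_act_def tau_def[of "\<lambda>r w. _ r w"]
    by (simp add: sum_distrib_left distrib_left)
qed

lemma affine_act_tau_funpow: "affine_act l m \<zeta> x ((tau ^^ s) U) = (tau ^^ s) (affine_act l m \<zeta> x U)"
  by (induction s) (simp_all add: affine_act_tau)

definition eigen :: "laurent_tensor set"
  where "eigen = {U \<in> loop_module l m. tau U = U}"

lemma eigen_rotate:
  assumes "U \<in> eigen"
  shows "\<zeta> powi (int s * (r - int n)) * U r (rotate s w) = U r w"
proof -
  have "(tau ^^ s) U = U" using assms by (induction s) (simp_all add: eigen_def)
  then show ?thesis using tau_funpow[of s U r w] by simp
qed

lemma subspace_loop_module: "lt.subspace (loop_module l m)"
proof (rule lt.subspaceI)
  show "0 \<in> loop_module l m" by (simp add: loop_module_def tensor_power_def)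
  show "U + V \<in> loop_module l m" if "U \<in> loop_module l m" "V \<in> loop_module l m" for U V
  proof -
    have "{r. (U + V) r \<noteq> 0} \<subseteq> {r. U r \<noteq> 0} \<union> {r. V r \<noteq> 0}" by auto
    moreover have "finite ({r. U r \<noteq> 0} \<union> {r. V r \<noteq> 0})" using that by (simp add: loop_module_def)
    ultimately have "finite {r. (U + V) r \<noteq> 0}" by (rule finite_subset)
    then show ?thesis using that by (auto simp: loop_module_def tensor_power_def image_subset_iff)
  qed
  show "scale_lt c U \<in> loop_module l m" if "U \<in> loop_module l m" for c U
  proof -
    have "{r. scale_lt c U r \<noteq> 0} \<subseteq> {r. U r \<noteq> 0}" by (auto simp: scale_lt_def fun_eq_iff)
    moreover have "finite {r. U r \<noteq> 0}" using that by (simp add: loop_module_def)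
    ultimately have "finite {r. scale_lt c U r \<noteq> 0}" by (rule finite_subset)
    then show ?thesis using that by (auto simp: loop_module_def tensor_power_def image_subset_iff scale_lt_def)
  qed
qed

lemma subspace_eigen: "lt.subspace eigen"
proof (rule lt.subspaceI)
  show "0 \<in> eigen"
    using lt.subspace_0[OF subspace_loop_module] by (simp add: eigen_def tau_def fun_eq_iff)
  show "U + V \<in> eigen" if "U \<in> eigen" "V \<in> eigen" for U V
  proof -
    have "tau (U + V) = tau U + tau V" by (simp add: tau_def fun_eq_iff distrib_left)
    then show ?thesis
      using that lt.subspace_add[OF subspace_loop_module] by (simp add: eigen_def)
  qed
  show "scale_lt c U \<in> eigen" if "U \<in> eigen" for c U
  proof -
    have "tau (scale_lt c U) = scale_lt c (tau U)" by (simp add: tau_def scale_lt_def fun_eq_iff)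
    then show ?thesis
      using that lt.subspace_scale[OF subspace_loop_module] by (simp add: eigen_def)
  qed
qed

lemma affine_act_loop_module:
  assumes "x \<in> affine_algebra l" "U \<in> loop_module l m"
  shows "affine_act l m \<zeta> x U \<in> loop_module l m"
proof -
  have fin: "finite (loop_support l x)" "finite {r. U r \<noteq> 0}"
    using assms by (auto simp: affine_algebra_def loop_module_def)
  have "{r. affine_act l m \<zeta> x U r \<noteq> 0} \<subseteq>
      {r. U r \<noteq> 0} \<union> (\<lambda>(k, r). k + r) ` (loop_support l x \<times> {r. U r \<noteq> 0})"
  proof (rule subsetI, rule ccontr)
    fix r assume r: "r \<in> {r. affine_act l m \<zeta> x U r \<noteq> 0}"
      "r \<notin> {r. U r \<noteq> 0} \<union> (\<lambda>(k, r). k + r) ` (loop_support l x \<times> {r. U r \<noteq> 0})"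
    have "U (r - k) = 0" if "k \<in> loop_support l x" for k
    proof (rule ccontr)
      assume "U (r - k) \<noteq> 0"
      with that have "(\<lambda>(k, r). k + r) (k, r - k) \<in> (\<lambda>(k, r). k + r) ` (loop_support l x \<times> {r. U r \<noteq> 0})"
        by (intro imageI) simp
      with r(2) show False by simp
    qed
    then have "affine_act l m \<zeta> x U r = 0"
      using r(2) by (auto simp: affine_act_def factor_act_def fun_eq_iff intro!: sum.neutral)
    with r(1) show False by simp
  qed
  moreover have "finite ({r. U r \<noteq> 0} \<union> (\<lambda>(k, r). k + r) ` (loop_support l x \<times> {r. U r \<noteq> 0}))"
    using fin by simp
  ultimately have "finite {r. affine_act l m \<zeta> x U r \<noteq> 0}"
    by (rule finite_subset)
  moreover have "affine_act l m \<zeta> x U r \<in> tensor_power l m" for r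
    using assms(2) by (auto simp: affine_act_def tensor_power_def factor_act_def loop_module_def image_subset_iff)
  ultimately show ?thesis by (auto simp: loop_module_def)
qed

lemma unit_lt_in_loop_module: "w \<in> words l m \<Longrightarrow> unit_lt w r \<in> loop_module l m"
proof -
  assume "w \<in> words l m"
  moreover have "{r'. unit_lt w r r' \<noteq> 0} \<subseteq> {r}" by (auto simp: unit_lt_def fun_eq_iff)
  then have "finite {r'. unit_lt w r r' \<noteq> 0}" by (rule finite_subset) simp
  ultimately show ?thesis by (auto simp: loop_module_def tensor_power_def unit_lt_def)
qed

lemma zero_word: "replicate m 0 \<in> words l m"
  by (auto simp: words_def)

lemma is_submodule_eigen: "is_submodule l m \<zeta> eigen"
  unfolding is_submodule_def using subspace_eigen affine_act_loop_module
  by (auto simp: eigen_def simp flip: affine_act_tau)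

lemma rotate1_replicate: "rotate1 w = replicate m a \<longleftrightarrow> w = replicate m a"
proof
  assume "rotate1 w = replicate m a"
  then have "set w \<subseteq> {a}" "length w = m"
    by (metis set_rotate1 set_replicate_conv_if empty_subsetI order_refl) (metis length_rotate1 length_replicate \<open>rotate1 w = replicate m a\<close>)
  then show "w = replicate m a"
    by (intro replicate_eqI) auto
qed (simp add: rotate1_replicate)

lemma hw_in_eigen: "hw_generator m n \<in> eigen"
  unfolding eigen_def hw_generator_unit
  using unit_lt_in_loop_module[OF zero_word]
  by (auto simp: tau_def unit_lt_def fun_eq_iff rotate1_replicate)

text \<open>m times the projection of a basis vector to the fixed space of \<open>tau\<close>. It
  can be 0, namely when the stabilizer character of the word is nontrivial.\<close>

definition orbit_sum :: "nat list \<Rightarrow> int \<Rightarrow> laurent_tensor"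
  where "orbit_sum w r = (\<Sum>s<m. (tau ^^ s) (unit_lt w r))"

lemma orbit_sum_apply:
  "orbit_sum w r r' v = (if r' = r then \<Sum>s<m. if rotate s v = w then \<zeta> powi (int s * (r - int n)) else 0 else 0)"
  by (simp add: orbit_sum_def sum_lt_apply tau_funpow unit_lt_def if_distrib cong: if_cong)

lemma L_module_subset_eigen: "L_module l m n \<zeta> \<subseteq> eigen"
  unfolding L_module_def using is_submodule_eigen hw_in_eigen by blast

lemma affine_act_orbit_sum:
  "affine_act l m \<zeta> x (orbit_sum w r) = (\<Sum>s<m. (tau ^^ s) (affine_act l m \<zeta> x (unit_lt w r)))"
  by (simp only: orbit_sum_def affine_act_sum affine_act_tau_funpow)

lemma tau_funpow_zero: "(tau ^^ s) 0 = 0"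
  by (intro ext) (simp add: tau_funpow)

lemma tau_funpow_add: "(tau ^^ s) (U + V) = (tau ^^ s) U + (tau ^^ s) V"
  by (intro ext) (simp add: tau_funpow distrib_left)

lemma tau_funpow_sum: "(tau ^^ s) (\<Sum>i\<in>I. U i) = (\<Sum>i\<in>I. (tau ^^ s) (U i))"
  by (induction I rule: infinite_finite_induct)
    (simp_all only: tau_funpow_zero tau_funpow_add sum.infinite sum.empty sum.insert not_False_eq_True)

lemma tau_funpow_scale: "(tau ^^ s) (scale_lt c U) = scale_lt c ((tau ^^ s) U)"
  by (intro ext) (simp add: tau_funpow scale_lt_def)

lemma affine_act_lowering_unit:
  assumes a: "0 < a" "a \<le> l" and w: "w \<in> words l m"
  shows "affine_act l m \<zeta> (loop_elt l (lowering l a) k) (unit_lt w r) =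
    (\<Sum>i | i < m \<and> w ! i = 0. scale_lt ((\<zeta> ^ (i + 1)) powi k) (unit_lt (w[i := a]) (r + k)))"
proof (intro ext)
  fix r' v
  have "lowering l a $$ (a, 0) \<noteq> 0" using a by (simp add: lowering_def)
  then have nz: "lowering l a \<noteq> zero_sl l"
    using a by (intro mat_entry_neq_zero_sl[of a l 0]) auto
  have len: "length w = m" using w by (simp add: words_def)
  have eq: "v \<in> words l m \<and> v ! i = a \<and> v[i := 0] = w \<longleftrightarrow> w ! i = 0 \<and> v = w[i := a]" if i: "i < m" for i
  proof
    assume *: "v \<in> words l m \<and> v ! i = a \<and> v[i := 0] = w"
    then have "length v = m" by (simp add: words_def)
    with * i show "w ! i = 0 \<and> v = w[i := a]" by auto
  next
    assume *: "w ! i = 0 \<and> v = w[i := a]"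
    with i len have "v ! i = a" "v[i := 0] = w" using list_update_id[of w i] by auto
    with * w a show "v \<in> words l m \<and> v ! i = a \<and> v[i := 0] = w" by (simp add: words_update)
  qed
  have "affine_act l m \<zeta> (loop_elt l (lowering l a) k) (unit_lt w r) r' v =
      (\<Sum>i<m. if w ! i = 0 then if r' = r + k \<and> v = w[i := a] then (\<zeta> ^ (i + 1)) powi k else 0 else 0)"
    unfolding affine_act_loop_elt[OF nz]
  proof (intro sum.cong refl)
    fix i assume "i \<in> {..<m}"
    then have i: "i < m" by simp
    have "factor_act l m i (lowering l a) (unit_lt w r (r' - k)) v =
        (if (v \<in> words l m \<and> v ! i = a \<and> v[i := 0] = w) \<and> r' = r + k then 1 else 0)"
      unfolding factor_act_lowering[OF a(2) i] by (auto simp: unit_lt_def)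
    then show "(\<zeta> ^ (i + 1)) powi k * factor_act l m i (lowering l a) (unit_lt w r (r' - k)) v =
        (if w ! i = 0 then if r' = r + k \<and> v = w[i := a] then (\<zeta> ^ (i + 1)) powi k else 0 else 0)"
      unfolding eq[OF i] by simp
  qed
  also have "\<dots> = (\<Sum>i | i < m \<and> w ! i = 0. if r' = r + k \<and> v = w[i := a] then (\<zeta> ^ (i + 1)) powi k else 0)"
    by (rule sum.mono_neutral_cong_right) auto
  finally show "affine_act l m \<zeta> (loop_elt l (lowering l a) k) (unit_lt w r) r' v =
      (\<Sum>i | i < m \<and> w ! i = 0. scale_lt ((\<zeta> ^ (i + 1)) powi k) (unit_lt (w[i := a]) (r + k))) r' v"
    by (simp add: sum_lt_apply scale_lt_def unit_lt_def if_distrib cong: if_cong)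
qed

lemma affine_act_lowering_orbit_sum:
  assumes a: "0 < a" "a \<le> l" and w: "w \<in> words l m"
  shows "affine_act l m \<zeta> (loop_elt l (lowering l a) k) (orbit_sum w r) =
    (\<Sum>i | i < m \<and> w ! i = 0. scale_lt ((\<zeta> ^ (i + 1)) powi k) (orbit_sum (w[i := a]) (r + k)))"
  unfolding affine_act_orbit_sum affine_act_lowering_unit[OF assms] tau_funpow_sum tau_funpow_scale
  by (subst sum.swap) (simp only: orbit_sum_def lt.scale_sum_right)

text \<open>At exponents divisible by m all parameters of the tensor factors become 1, so the m
  factors contribute equally.\<close>

lemma affine_act_coroot_mat:
  "affine_act l m \<zeta> (loop_elt l (coroot_mat l) (int m * t)) (hw_generator m n) =
    scale_lt (of_nat m) (unit_lt (replicate m 0) (int n + int m * t))"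
proof (intro ext)
  fix r v
  have ent: "coroot_mat l $$ (0, 0) = 1" using l by (simp add: coroot_mat_def)
  then have nz: "coroot_mat l \<noteq> zero_sl l"
    by (intro mat_entry_neq_zero_sl[of 0 l 0]) auto
  have diag: "coroot_mat l \<in> carrier_mat (l + 1) (l + 1)" "diagonal_mat (coroot_mat l)"
    by (auto simp: coroot_mat_def diagonal_mat_def)
  have one: "(\<zeta> ^ (j + 1)) powi (int m * t) = 1" for j
    unfolding power_int_power using zeta_powi_eq_1_iff[of "int (j + 1) * (int m * t)"] by simp
  have "factor_act l m j (coroot_mat l) (unit_lt (replicate m 0) (int n) (r - int m * t)) v =
      unit_lt (replicate m 0) (int n + int m * t) r v" if j: "j < m" for j
  proof (cases "v \<in> words l m")
    case True
    then show ?thesis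
      unfolding factor_act_diagonal[OF diag j True] using j ent by (auto simp: unit_lt_def)
  next
    case False
    then have "v \<noteq> replicate m 0" using zero_word by auto
    with False show ?thesis by (simp add: factor_act_def unit_lt_def)
  qed
  then show "affine_act l m \<zeta> (loop_elt l (coroot_mat l) (int m * t)) (hw_generator m n) r v =
      scale_lt (of_nat m) (unit_lt (replicate m 0) (int n + int m * t)) r v"
    unfolding affine_act_loop_elt[OF nz] hw_generator_unit one by (simp add: scale_lt_def)
qed

section \<open>Generation of the eigenspace from the highest weight vector\<close>

context
  fixes W :: "laurent_tensor set"
  assumes W: "is_submodule l m \<zeta> W" "hw_generator m n \<in> W"
begin

lemma subspace_W: "lt.subspace W"
  using W by (simp add: is_submodule_def)

lemma act_W: "x \<in> affine_algebra l \<Longrightarrow> U \<in> W \<Longrightarrow> affine_act l m \<zeta> x U \<in> W"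
  using W by (simp add: is_submodule_def)

text \<open>The zero word is fixed by all rotations, so its orbit sum carries a full character sum:
  0 unless r is congruent to n modulo m, and in that case a multiple of a translate of the
  generator.\<close>

lemma orbit_sum_zero_word_in_W: "orbit_sum (replicate m 0) r \<in> W"
proof (cases "int m dvd r - int n")
  case True
  then obtain t where t: "r = int n + int m * t" by (metis add_diff_cancel_left' diff_add_cancel dvdE add.commute)
  have "scale_lt (of_nat m) (unit_lt (replicate m 0) r) \<in> W"
    using act_W[OF loop_elt_in_affine_algebra[OF coroot_mat_in_sl[OF l]] W(2), of "int m * t"]
    by (simp add: affine_act_coroot_mat t)
  moreover have "orbit_sum (replicate m 0) r = scale_lt (of_nat m) (unit_lt (replicate m 0) r)"
  proof -
    have "\<zeta> powi (int s * (r - int n)) = 1" for s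
      using True zeta_powi_eq_1_iff by simp
    moreover have "rotate s v = replicate m 0 \<longleftrightarrow> v = replicate m 0" for s and v :: "nat list"
      by (induction s arbitrary: v) (simp_all add: rotate1_replicate)
    ultimately show ?thesis
      by (simp add: fun_eq_iff orbit_sum_apply scale_lt_def unit_lt_def)
  qed
  ultimately show ?thesis by simp
next
  case False
  have "rotate s v = replicate m 0 \<longleftrightarrow> v = replicate m 0" for s and v :: "nat list"
    by (induction s arbitrary: v) (simp_all add: rotate1_replicate)
  then have "orbit_sum (replicate m 0) r r' v = 0" for r' v
    using False sum_zeta_powi[of "r - int n"]
    by (cases "v = replicate m 0") (simp_all add: orbit_sum_apply)
  then have "orbit_sum (replicate m 0) r = 0"
    by (simp add: fun_eq_iff)
  then show ?thesis using lt.subspace_0[OF subspace_W] by simp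
qed

text \<open>Induction on the letter sum: setting one nonzero letter of w to 0 gives a smaller word
  u, and lowering leads back to w, but it acts at every zero of u at once.\<close>

lemma orbit_sum_in_W: "w \<in> words l m \<Longrightarrow> orbit_sum w r \<in> W"
proof (induction w arbitrary: r rule: measure_induct_rule[where f = sum_list])
  case (less w)
  have len: "length w = m" using less.prems by (simp add: words_def)
  show ?case
  proof (cases "\<exists>j<m. w ! j \<noteq> 0")
    case False
    then have "w = replicate m 0" using len by (intro nth_equalityI) auto
    then show ?thesis by (simp add: orbit_sum_zero_word_in_W)
  next
    case True
    then obtain j where j: "j < m" "w ! j \<noteq> 0" by blast
    define a where "a = w ! j"
    define u where "u = w[j := 0]"
    have a: "0 < a" "a \<le> l" using j words_nth_le[OF less.prems j(1)] by (simp_all add: a_def)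
    have u: "u \<in> words l m" "u ! j = 0" "u[j := a] = w"
      using less.prems j len by (simp_all add: u_def a_def words_update)
    have "sum_list u < sum_list w"
      using j len member_le_sum_list[of "w ! j" w] by (simp add: u_def sum_list_update)
    then have IH: "orbit_sum u r \<in> W" for r by (rule less.IH) (rule u(1))
    let ?I = "{i. i < m \<and> u ! i = 0}"
    \<comment> \<open>All powers of \<open>z\<close> are available, so a discrete Fourier transform in \<open>k\<close> isolates the factor \<open>j\<close>.\<close>
    let ?S = "\<lambda>k. \<Sum>i\<in>?I. scale_lt ((\<zeta> ^ (i + 1)) powi k) (orbit_sum (u[i := a]) r)"
    \<comment> \<open>Starting in degree r - k cancels the shift by k, so the same vectors of degree
      r occur for every k and only their scalars vary.\<close>
    have S: "?S k \<in> W" for k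
      using act_W[OF loop_elt_in_affine_algebra[OF lowering_in_sl[OF a(1)]] IH[of "r - k"], of k]
      by (simp add: affine_act_lowering_orbit_sum[OF a u(1)])
    have "(\<Sum>k<m. scale_lt ((\<zeta> ^ (j + 1)) powi (- int k)) (?S (int k))) =
        (\<Sum>i\<in>?I. scale_lt (\<Sum>k<m. (\<zeta> ^ (j + 1)) powi (- int k) * (\<zeta> ^ (i + 1)) powi int k) (orbit_sum (u[i := a]) r))"
      unfolding lt.scale_sum_right lt.scale_sum_left lt.scale_scale by (rule sum.swap)
    also have "\<dots> = (\<Sum>i\<in>?I. scale_lt (if i = j then of_nat m else 0) (orbit_sum (u[i := a]) r))"
    proof (intro sum.cong refl arg_cong2[of _ _ _ _ scale_lt])
      fix i assume "i \<in> ?I"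
      then have i: "i < m" by simp
      have "(\<zeta> ^ (j + 1)) powi (- int k) * (\<zeta> ^ (i + 1)) powi int k = \<zeta> powi (int k * (int i - int j))" for k
      proof -
        have "(\<zeta> ^ (j + 1)) powi (- int k) * (\<zeta> ^ (i + 1)) powi int k =
            \<zeta> powi (int (j + 1) * (- int k) + int (i + 1) * int k)"
          unfolding power_int_power using zeta_nonzero by (simp only: power_int_add simp_thms)
        also have "int (j + 1) * (- int k) + int (i + 1) * int k = int k * (int i - int j)"
          by (simp add: algebra_simps)
        finally show ?thesis .
      qed
      then have "(\<Sum>k<m. (\<zeta> ^ (j + 1)) powi (- int k) * (\<zeta> ^ (i + 1)) powi int k) =
          (if int m dvd int i - int j then of_nat m else 0)"
        by (simp only: sum_zeta_powi)
      moreover have "int m dvd int i - int j \<longleftrightarrow> i = j"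
        using i j(1) zdvd_imp_le[of "int m" "int i - int j"] zdvd_imp_le[of "int m" "int j - int i"]
          dvd_minus_iff[of "int m" "int i - int j"]
        by (cases i j rule: linorder_cases) auto
      ultimately show "(\<Sum>k<m. (\<zeta> ^ (j + 1)) powi (- int k) * (\<zeta> ^ (i + 1)) powi int k) =
          (if i = j then of_nat m else 0)" by simp
    qed
    also have "\<dots> = (\<Sum>i\<in>?I. if i = j then scale_lt (of_nat m) (orbit_sum w r) else 0)"
      using u(3) by (intro sum.cong refl) auto
    also have "\<dots> = scale_lt (of_nat m) (orbit_sum w r)"
      using j(1) u(2) by simp
    finally have calc: "(\<Sum>k<m. scale_lt ((\<zeta> ^ (j + 1)) powi (- int k)) (?S (int k))) =
        scale_lt (of_nat m) (orbit_sum w r)" .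
    have "scale_lt (of_nat m) (orbit_sum w r) \<in> W"
    proof -
      have "(\<Sum>k<m. scale_lt ((\<zeta> ^ (j + 1)) powi (- int k)) (?S (int k))) \<in> W"
        by (rule lt.subspace_sum[OF subspace_W], rule lt.subspace_scale[OF subspace_W], rule S)
      then show ?thesis by (simp only: calc)
    qed
    then have "scale_lt (1 / of_nat m) (scale_lt (of_nat m) (orbit_sum w r)) \<in> W"
      by (rule lt.subspace_scale[OF subspace_W])
    then show ?thesis using m by simp
  qed
qed

text \<open>Averaging over the powers of \<open>tau\<close> returns an invariant element unchanged;
  applied to the basis expansion of U, it produces orbit sums.\<close>

lemma eigen_expansion:
  assumes "U \<in> eigen"
  shows "U = (\<Sum>r\<in>{r. U r \<noteq> 0}. \<Sum>w\<in>words l m. scale_lt (U r w / of_nat m) (orbit_sum w r))"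
proof (intro ext)
  fix r v
  have supp: "U r w = 0" if "w \<notin> words l m" for r w
    using assms that by (auto simp: eigen_def loop_module_def tensor_power_def image_subset_iff)
  have fin: "finite {r. U r \<noteq> 0}"
    using assms by (auto simp: eigen_def loop_module_def)
  have inner: "(\<Sum>w\<in>words l m. U r w / of_nat m * orbit_sum w r r v) = U r v"
  proof -
    have "(\<Sum>w\<in>words l m. U r w / of_nat m * orbit_sum w r r v) =
        (\<Sum>w\<in>words l m. \<Sum>s<m. if rotate s v = w then U r w / of_nat m * \<zeta> powi (int s * (r - int n)) else 0)"
      by (simp add: orbit_sum_apply sum_distrib_left if_distrib cong: if_cong)
    also have "\<dots> = (\<Sum>s<m. \<Sum>w\<in>words l m. if rotate s v = w then U r w / of_nat m * \<zeta> powi (int s * (r - int n)) else 0)"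
      by (rule sum.swap)
    also have "\<dots> = (\<Sum>s<m. U r (rotate s v) / of_nat m * \<zeta> powi (int s * (r - int n)))"
      using supp by (intro sum.cong refl) (simp add: sum.delta finite_words)
    also have "\<dots> = (\<Sum>s<m. U r v / of_nat m)"
      using eigen_rotate[OF assms, of _ r v] by (intro sum.cong refl) (simp add: mult.commute)
    also have "\<dots> = U r v" using m by simp
    finally show ?thesis .
  qed
  have "(\<Sum>r'\<in>{r. U r \<noteq> 0}. \<Sum>w\<in>words l m. U r' w / of_nat m * orbit_sum w r' r v) =
      (\<Sum>r'\<in>{r. U r \<noteq> 0}. if r' = r then U r v else 0)"
  proof (rule sum.cong[OF refl])
    fix r'
    show "(\<Sum>w\<in>words l m. U r' w / of_nat m * orbit_sum w r' r v) = (if r' = r then U r v else 0)"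
      by (cases "r' = r") (simp_all only: inner, simp_all add: orbit_sum_apply)
  qed
  also have "\<dots> = U r v" using fin by simp
  finally show "U r v = (\<Sum>r\<in>{r. U r \<noteq> 0}. \<Sum>w\<in>words l m. scale_lt (U r w / of_nat m) (orbit_sum w r)) r v"
    by (simp add: sum_lt_apply scale_lt_def)
qed

lemma eigen_subset_W: "eigen \<subseteq> W"
proof
  fix U assume U: "U \<in> eigen"
  have "scale_lt (U r w / of_nat m) (orbit_sum w r) \<in> W" if "w \<in> words l m" for r w
    using that by (intro lt.subspace_scale[OF subspace_W] orbit_sum_in_W)
  then have "(\<Sum>r\<in>{r. U r \<noteq> 0}. \<Sum>w\<in>words l m. scale_lt (U r w / of_nat m) (orbit_sum w r)) \<in> W"
    by (intro lt.subspace_sum[OF subspace_W])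
  then show "U \<in> W"
    using eigen_expansion[OF U] by simp
qed

end

lemma L_module_eq_eigen: "L_module l m n \<zeta> = eigen"
  using L_module_subset_eigen eigen_subset_W unfolding L_module_def by blast

end

section \<open>Weight spaces\<close>

lemma weight_eval_add: "weight_eval l (\<mu> + \<nu>) h = weight_eval l \<mu> h + weight_eval l \<nu> h"
  by (simp add: weight_eval_def sum.distrib algebra_simps)

lemma weight_eval_sum: "weight_eval l (\<Sum>i\<in>I. f i) h = (\<Sum>i\<in>I. weight_eval l (f i) h)"
proof (induction I rule: infinite_finite_induct)
  case (insert i I)
  show ?case unfolding sum.insert[OF insert.hyps] weight_eval_add insert.IH ..
qed (simp_all add: weight_eval_def)

lemma weight_eval_delta: "weight_eval l (r *\<^sub>R delta) h = of_real r * D_coeff h"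
  by (simp add: weight_eval_def delta_def scaleR_fun_def)

lemma weight_eval_fund_weight:
  assumes "i \<le> l"
  shows "weight_eval l (fund_weight i) h = K_coeff h + (\<Sum>a<i. loop h 0 $$ (a, a))"
proof -
  have "(\<Sum>k\<le>l. of_real (fst (fund_weight i) k) * (K_coeff h + (\<Sum>a<k. loop h 0 $$ (a, a)))) =
      (\<Sum>k\<le>l. if k = i then K_coeff h + (\<Sum>a<k. loop h 0 $$ (a, a)) else 0)"
    by (intro sum.cong refl) (simp add: fund_weight_def)
  moreover have "snd (fund_weight i) = 0" by (simp add: fund_weight_def)
  ultimately show ?thesis unfolding weight_eval_def using assms by simp
qed

lemma weight_eval_diff: "weight_eval l (\<mu> - \<nu>) h = weight_eval l \<mu> h - weight_eval l \<nu> h"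
  using weight_eval_add[of l "\<mu> - \<nu>" \<nu> h] by simp

lemma cartan_trace:
  assumes "h \<in> cartan l"
  shows "(\<Sum>a<l + 1. loop h 0 $$ (a, a)) = 0"
proof -
  have "loop h 0 \<in> sl l" using assms by (auto simp: cartan_def affine_algebra_def)
  then show ?thesis by (auto simp: sl_def mat_trace_def)
qed

text \<open>For a < l the partial diagonal sums telescope; for a = l vanishing of the trace supplies
  the last diagonal entry.\<close>

lemma weight_eval_letter_weight:
  assumes "h \<in> cartan l" "a \<le> l"
  shows "weight_eval l (letter_weight l a) h = loop h 0 $$ (a, a)"
proof (cases "a = l")
  case True
  then show ?thesis
    using cartan_trace[OF assms(1)]
    by (simp add: letter_weight_def weight_eval_diff weight_eval_fund_weight) (simp add: add_eq_0_iff)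
next
  case False
  then show ?thesis
    using assms(2) by (simp add: letter_weight_def weight_eval_diff weight_eval_fund_weight)
qed

lemma coroot_elt_in_cartan:
  assumes "1 \<le> l" "i \<le> l"
  shows "coroot_elt l i \<in> cartan l"
proof -
  obtain p where p: "p = (i + l) mod (l + 1)" "p \<le> l"
    by (simp add: less_Suc_eq_le[symmetric])
  have "mat_trace (loop (coroot_elt l i) 0) =
      (\<Sum>a<l + 1. (if a = p then 1 else 0) - (if a = i then 1 else 0))"
    unfolding mat_trace_def coroot_elt_def p(1) by (auto intro!: sum.cong)
  also have "\<dots> = 0"
    using p(2) assms by (simp add: sum_subtractf)
  finally have "loop (coroot_elt l i) k \<in> sl l" for k
    using zero_sl_in_sl by (auto simp: sl_def coroot_elt_def)
  moreover have supp: "loop_support l (coroot_elt l i) \<subseteq> {0}"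
    by (auto simp: loop_support_def coroot_elt_def)
  moreover have "finite (loop_support l (coroot_elt l i))"
    using supp by (rule finite_subset) simp
  ultimately show ?thesis
    by (auto simp: cartan_def affine_algebra_def) (auto simp: diagonal_mat_def coroot_elt_def)
qed

lemma D_elt_in_cartan: "D_elt l \<in> cartan l"
  using zero_sl_in_sl by (auto simp: cartan_def affine_algebra_def D_elt_def loop_support_def diagonal_mat_def)

context quantum_loop_module
begin

definition basis_weight :: "int \<Rightarrow> nat list \<Rightarrow> weight"
  where "basis_weight r w = (\<Sum>j<m. letter_weight l (w ! j)) + of_int r *\<^sub>R delta"

lemma affine_act_cartan:
  assumes h: "h \<in> cartan l" and U: "U \<in> loop_module l m"
  shows "affine_act l m \<zeta> h U r w = weight_eval l (basis_weight r w) h * U r w"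
proof (cases "w \<in> words l m")
  case False
  then have "U r w = 0" using U by (auto simp: loop_module_def tensor_power_def image_subset_iff)
  with False show ?thesis by (simp add: affine_act_def factor_act_def)
next
  case True
  have supp: "loop_support l h \<subseteq> {0}" and diag: "diagonal_mat (loop h 0)"
    and car: "loop h 0 \<in> carrier_mat (l + 1) (l + 1)"
    using h by (auto simp: cartan_def affine_algebra_def sl_def)
  have fac: "factor_act l m j (loop h 0) u w = loop h 0 $$ (w ! j, w ! j) * u w" if "j < m" for j u
    by (rule factor_act_diagonal[OF car diag that True])
  have "(\<Sum>k\<in>loop_support l h. \<Sum>j<m. ((\<zeta> ^ (j + 1)) powi k) * factor_act l m j (loop h k) (U (r - k)) w) =
      (\<Sum>k\<in>{0}. \<Sum>j<m. ((\<zeta> ^ (j + 1)) powi k) * factor_act l m j (loop h k) (U (r - k)) w)"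
  \<comment> \<open>The support is empty rather than \<open>{0}\<close> when the loop part of h is
    0.\<close>
  proof (rule sum.mono_neutral_left[OF _ supp])
    show "\<forall>k\<in>{0} - loop_support l h. (\<Sum>j<m. ((\<zeta> ^ (j + 1)) powi k) * factor_act l m j (loop h k) (U (r - k)) w) = 0"
    proof
      fix k assume "k \<in> {0} - loop_support l h"
      then have k: "k = 0" "loop h 0 = zero_sl l" by (auto simp: loop_support_def)
      have "factor_act l m j (loop h 0) u w = 0" if "j < m" for j u
        unfolding fac[OF that] using words_nth_le[OF True that] by (simp add: k(2))
      then show "(\<Sum>j<m. ((\<zeta> ^ (j + 1)) powi k) * factor_act l m j (loop h k) (U (r - k)) w) = 0"
        unfolding k(1) by (intro sum.neutral) simp
    qed
  qed simp
  also have "\<dots> = (\<Sum>j<m. loop h 0 $$ (w ! j, w ! j)) * U r w"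
    by (simp add: fac sum_distrib_right)
  also have "(\<Sum>j<m. loop h 0 $$ (w ! j, w ! j)) = (\<Sum>j<m. weight_eval l (letter_weight l (w ! j)) h)"
    by (intro sum.cong refl) (simp add: weight_eval_letter_weight[OF h] words_nth_le[OF True])
  finally show ?thesis
    unfolding affine_act_def basis_weight_def weight_eval_add weight_eval_sum weight_eval_delta
    by (simp add: algebra_simps)
qed

lemma basis_weight_fst_out: "w \<in> words l m \<Longrightarrow> l < i \<Longrightarrow> fst (basis_weight r w) i = 0"
proof -
  assume w: "w \<in> words l m" and i: "l < i"
  have "fst (letter_weight l a) i = 0" if "a \<le> l" for a
  proof -
    have "(a + 1) mod (l + 1) < l + 1" by simp
    then have "i \<noteq> (a + 1) mod (l + 1)" "i \<noteq> a" using i that by linarith+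
    then show ?thesis unfolding letter_weight_def by (simp add: fund_weight_def)
  qed
  then show ?thesis
    using words_nth_le[OF w] by (simp add: basis_weight_def fst_sum_fun delta_def scaleR_fun_def)
qed

text \<open>The coroots and D separate weights in the coordinates up to l, and on both sides the
  coordinates beyond l vanish.\<close>

lemma basis_weight_eq_iff:
  assumes "w \<in> words l m" "\<nu> \<in> weight_lattice l"
  shows "(\<forall>h\<in>cartan l. weight_eval l (basis_weight r w) h = weight_eval l \<nu> h) \<longleftrightarrow> basis_weight r w = \<nu>"
proof
  assume *: "\<forall>h\<in>cartan l. weight_eval l (basis_weight r w) h = weight_eval l \<nu> h"
  have "fst (basis_weight r w) i = fst \<nu> i" for i
  proof (cases "i \<le> l")
    case True
    then have "complex_of_real (coroot i (basis_weight r w)) = of_real (coroot i \<nu>)"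
      using *[THEN bspec, OF coroot_elt_in_cartan[OF l True]] by (simp add: weight_eval_coroot_elt[OF l])
    then show ?thesis by (simp add: coroot_def)
  next
    case False
    then show ?thesis using basis_weight_fst_out[OF assms(1)] assms(2) by (simp add: weight_lattice_iff)
  qed
  moreover have "snd (basis_weight r w) = snd \<nu>"
  proof -
    have "complex_of_real (snd (basis_weight r w)) = of_real (snd \<nu>)"
      using *[THEN bspec, OF D_elt_in_cartan] by (simp only: weight_eval_D_elt)
    then show ?thesis by (simp only: of_real_eq_iff)
  qed
  ultimately show "basis_weight r w = \<nu>" by (simp add: prod_eq_iff fun_eq_iff)
qed simp

lemma weight_space_iff:
  assumes "\<nu> \<in> weight_lattice l"
  shows "U \<in> weight_space l m \<zeta> eigen \<nu> \<longleftrightarrow> U \<in> eigen \<and> (\<forall>r w. U r w \<noteq> 0 \<longrightarrow> basis_weight r w = \<nu>)"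
proof (cases "U \<in> eigen")
  case True
  then have U: "U \<in> loop_module l m" by (simp add: eigen_def)
  have words: "w \<in> words l m" if "U r w \<noteq> 0" for r w
    using U that by (auto simp: loop_module_def tensor_power_def image_subset_iff)
  have "affine_act l m \<zeta> h U = scale_lt (weight_eval l \<nu> h) U \<longleftrightarrow>
      (\<forall>r w. U r w \<noteq> 0 \<longrightarrow> weight_eval l (basis_weight r w) h = weight_eval l \<nu> h)" if "h \<in> cartan l" for h
    by (auto simp: fun_eq_iff affine_act_cartan[OF that U] scale_lt_def)
  then have "U \<in> weight_space l m \<zeta> eigen \<nu> \<longleftrightarrow>
      (\<forall>r w. U r w \<noteq> 0 \<longrightarrow> (\<forall>h\<in>cartan l. weight_eval l (basis_weight r w) h = weight_eval l \<nu> h))"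
    using True unfolding weight_space_def by blast
  then show ?thesis
    using True words basis_weight_eq_iff[OF _ assms] by blast
qed (simp add: weight_space_def)

section \<open>A basis of orbit sums in each weight space\<close>

lemma orbit_sum_in_eigen:
  assumes "w \<in> words l m"
  shows "orbit_sum w r \<in> eigen"
  using orbit_sum_in_W[OF is_submodule_eigen hw_in_eigen assms] .

lemma orbit_sum_other_orbit:
  assumes "length w = m" "rot_orbit v \<noteq> rot_orbit w"
  shows "orbit_sum v r r w = 0"
proof -
  have "rotate s w \<noteq> v" for s
    using assms(2) rot_orbit_rotate[of s w] by auto
  then show ?thesis by (simp add: orbit_sum_apply)
qed

lemma orbit_sum_self:
  assumes "length w = m" "rot_good (\<zeta> powi (r - int n)) w"
  shows "orbit_sum w r r w \<noteq> 0"
proof -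
  have "orbit_sum w r r w = (\<Sum>s<m. if rotate s w = w then 1 else 0)"
    unfolding orbit_sum_apply using assms(2)
    by (auto simp: rot_good_def power_int_power' mult.commute intro!: sum.cong)
  also have "\<dots> = of_nat (card {s \<in> {..<m}. rotate s w = w})"
    by (simp add: sum.If_cases Int_def)
  finally have "orbit_sum w r r w = of_nat (card {s \<in> {..<m}. rotate s w = w})" .
  moreover have "0 \<in> {s \<in> {..<m}. rotate s w = w}" using m by simp
  then have "card {s \<in> {..<m}. rotate s w = w} \<noteq> 0"
    by (auto simp: card_eq_0_iff)
  ultimately show ?thesis by simp
qed

text \<open>An invariant element is determined on an orbit by its value at one word and vanishes on
  orbits that are not good. Hence the orbit sums of one representative per good orbit form a
  basis.\<close>

lemma weight_space_dim:
  assumes \<nu>: "\<nu> \<in> weight_lattice l" and r: "snd \<nu> = of_int r"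
  defines "A \<equiv> {w \<in> words l m. basis_weight r w = \<nu>}"
  shows "finite_dim (weight_space l m \<zeta> eigen \<nu>) \<and>
    lt.dim (weight_space l m \<zeta> eigen \<nu>) = card (rot_orbit ` {w \<in> A. rot_good (\<zeta> powi (r - int n)) w})"
proof -
  let ?\<theta> = "\<zeta> powi (r - int n)" and ?V = "weight_space l m \<zeta> eigen \<nu>"
  define G where "G = {w \<in> A. rot_good ?\<theta> w}"
  define rp where "rp Q = (SOME v :: nat list. v \<in> Q)" for Q
  define B where "B = (\<lambda>Q. orbit_sum (rp Q) r) ` (rot_orbit ` G)"
  have finA: "finite A" unfolding A_def using finite_words by simp
  then have finO: "finite (rot_orbit ` G)" by (simp add: G_def)
  have lenA: "length w = m" if "w \<in> A" for w using that by (simp add: A_def words_def)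
  have chi: "\<zeta> powi (int s * (r - int n)) = ?\<theta> ^ s" for s
    by (simp add: power_int_power' mult.commute)
  have basis_rot: "basis_weight r' (rotate s w) = basis_weight r' w" if "length w = m" for r' s w
  proof -
    have "(\<Sum>j<m. letter_weight l (w ! j)) = sum_mset (image_mset (letter_weight l) (mset w))" if "length w = m" for w
      using that sum_nth_eq_sum_mset[of "letter_weight l" w] by simp
    moreover have "mset (rotate s w) = mset w"
      by (metis append_take_drop_id mset_append rotate_drop_take union_commute)
    ultimately show ?thesis using that by (simp add: basis_weight_def)
  qed
  have rotA: "rotate s w \<in> A" if "w \<in> A" for s w
    using that lenA[OF that] by (simp add: A_def basis_rot)
  have rotG: "rotate s w \<in> G" if "w \<in> G" for s w
    using that rotA by (simp add: G_def rot_good_rotate)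
  have rp: "rp Q \<in> G" "rot_orbit (rp Q) = Q" if "Q \<in> rot_orbit ` G" for Q
  proof -
    from that obtain w where w: "w \<in> G" "Q = rot_orbit w" by blast
    have "w \<in> Q" using w rot_orbit_self by simp
    then have "rp Q \<in> Q" unfolding rp_def by (rule someI[of "\<lambda>v. v \<in> Q"])
    then obtain s where "rp Q = rotate s w" using w(2) by (auto simp: rot_orbit_def)
    then show "rp Q \<in> G" "rot_orbit (rp Q) = Q" using rotG w by (simp_all add: rot_orbit_rotate)
  qed
  \<comment> \<open>Evaluation at the representatives is diagonal on the orbit sums with nonzero
    diagonal; independence and the coordinates in \<open>span\<close> both come from this.\<close>
  have eval: "orbit_sum (rp Q) r r (rp Q') = (if Q = Q' then orbit_sum (rp Q) r r (rp Q) else 0)"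
    "orbit_sum (rp Q) r r (rp Q) \<noteq> 0"
    if "Q \<in> rot_orbit ` G" "Q' \<in> rot_orbit ` G" for Q Q'
    using orbit_sum_other_orbit[of "rp Q'" "rp Q"] orbit_sum_self[of "rp Q"] rp[OF that(1)] rp[OF that(2)] lenA
    by (auto simp: G_def)
  have V_sub: "lt.subspace ?V"
  proof (rule lt.subspaceI)
    show "0 \<in> ?V"
      using lt.subspace_0[OF subspace_eigen] by (simp add: weight_space_iff[OF \<nu>])
    show "U + U' \<in> ?V" if "U \<in> ?V" "U' \<in> ?V" for U U'
      using that lt.subspace_add[OF subspace_eigen] unfolding weight_space_iff[OF \<nu>]
      by (metis plus_fun_apply add.right_neutral)
    show "scale_lt c U \<in> ?V" if "U \<in> ?V" for c U
      using that lt.subspace_scale[OF subspace_eigen] unfolding weight_space_iff[OF \<nu>]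
      by (auto simp: scale_lt_def)
  qed
  have B_V: "B \<subseteq> ?V"
  proof
    fix U assume "U \<in> B"
    then obtain Q where Q: "Q \<in> rot_orbit ` G" "U = orbit_sum (rp Q) r" by (auto simp: B_def)
    have w: "rp Q \<in> A" using rp(1)[OF Q(1)] by (simp add: G_def)
    have "basis_weight r' v = \<nu>" if "U r' v \<noteq> 0" for r' v
    proof -
      from that Q(2) have "r' = r" by (auto simp: orbit_sum_apply split: if_splits)
      moreover have "\<exists>s. rotate s v = rp Q"
      proof (rule ccontr)
        assume "\<nexists>s. rotate s v = rp Q"
        then have "U r' v = 0" unfolding Q(2) by (simp add: orbit_sum_apply)
        with that show False by simp
      qed
      then obtain s where s: "rotate s v = rp Q" ..
      then have "length v = m" using lenA[OF w] by (metis length_rotate)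
      then show ?thesis using basis_rot[of v r' s] s w \<open>r' = r\<close> by (simp add: A_def)
    qed
    then show "U \<in> ?V"
      unfolding weight_space_iff[OF \<nu>] using orbit_sum_in_eigen w Q(2) by (auto simp: A_def)
  qed
  have vanish: "U = 0" if U: "U \<in> ?V" and zero: "\<And>Q. Q \<in> rot_orbit ` G \<Longrightarrow> U r (rp Q) = 0" for U
  proof (intro ext)
    fix r' w
    have E: "U \<in> eigen" using U by (simp add: weight_space_iff[OF \<nu>])
    show "U r' w = 0 r' w"
    proof (cases "U r' w = 0")
      case False
      then have bw: "basis_weight r' w = \<nu>" using U weight_space_iff[OF \<nu>] by blast
      have "w \<in> words l m"
        using False E by (auto simp: eigen_def loop_module_def tensor_power_def image_subset_iff)
      moreover have "real_of_int r' = real_of_int r"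
        using arg_cong[OF bw, of snd] r
        by (simp add: basis_weight_def snd_sum_weight letter_weight_def fund_weight_def delta_def)
      then have r': "r' = r" by simp
      ultimately have wA: "w \<in> A" using bw by (simp add: A_def)
      have rot: "?\<theta> ^ s * U r (rotate s w) = U r w" for s
        using eigen_rotate[OF E, of s r w] by (simp only: chi)
      \<comment> \<open>For a rotation s fixing w, invariance says that \<theta>^s fixes the nonzero
        number \<open>U r w\<close>.\<close>
      have "rot_good ?\<theta> w"
        unfolding rot_good_def using rot False r' by (metis mult_cancel_right1)
      then have "w \<in> G" using wA by (simp add: G_def)
      then have Q: "rot_orbit w \<in> rot_orbit ` G" by blast
      have "rp (rot_orbit w) \<in> rot_orbit w"
        unfolding rp_def by (rule someI[of "\<lambda>v. v \<in> rot_orbit w"]) (rule rot_orbit_self)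
      then obtain s where "rp (rot_orbit w) = rotate s w" by (auto simp: rot_orbit_def)
      then have "U r w = 0" using rot[of s] zero[OF Q] by simp
      with False r' show ?thesis by simp
    qed simp
  qed
  have inj: "inj_on (\<lambda>Q. orbit_sum (rp Q) r) (rot_orbit ` G)"
  proof (rule inj_onI)
    fix Q Q' assume Q: "Q \<in> rot_orbit ` G" "Q' \<in> rot_orbit ` G"
      and eq: "orbit_sum (rp Q) r = orbit_sum (rp Q') r"
    show "Q = Q'"
    proof (rule ccontr)
      assume "Q \<noteq> Q'"
      then have "orbit_sum (rp Q') r r (rp Q') = 0"
        using eval(1)[OF Q] eq by simp
      with eval(2)[OF Q(2) Q(2)] show False by simp
    qed
  qed
  have indep: "lt.independent B"
  proof (rule lt.independent_if_scalars_zero)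
    show "finite B" using finO by (simp add: B_def)
    fix f U assume sum0: "(\<Sum>x\<in>B. scale_lt (f x) x) = 0" and "U \<in> B"
    then obtain Q where Q: "Q \<in> rot_orbit ` G" "U = orbit_sum (rp Q) r" by (auto simp: B_def)
    have "0 = (\<Sum>x\<in>B. scale_lt (f x) x) r (rp Q)" by (simp add: sum0)
    also have "\<dots> = (\<Sum>Q'\<in>rot_orbit ` G. f (orbit_sum (rp Q') r) * orbit_sum (rp Q') r r (rp Q))"
      unfolding B_def sum.reindex[OF inj] by (simp add: sum_lt_apply scale_lt_def)
    also have "\<dots> = (\<Sum>Q'\<in>rot_orbit ` G. if Q' = Q then f U * orbit_sum (rp Q) r r (rp Q) else 0)"
    proof (rule sum.cong[OF refl])
      fix Q' assume "Q' \<in> rot_orbit ` G"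
      from eval(1)[OF this Q(1)] show "f (orbit_sum (rp Q') r) * orbit_sum (rp Q') r r (rp Q) =
          (if Q' = Q then f U * orbit_sum (rp Q) r r (rp Q) else 0)" using Q(2) by auto
    qed
    also have "\<dots> = f U * orbit_sum (rp Q) r r (rp Q)" using finO Q(1) by simp
    finally show "f U = 0" using eval(2)[OF Q(1) Q(1)] by simp
  qed
  have span: "?V \<subseteq> lt.span B"
  proof
    fix U assume U: "U \<in> ?V"
    \<comment> \<open>S interpolates U at the representatives, so the difference vanishes by the
      preceding uniqueness.\<close>
    define S where "S = (\<Sum>Q\<in>rot_orbit ` G. scale_lt (U r (rp Q) / orbit_sum (rp Q) r r (rp Q)) (orbit_sum (rp Q) r))"
    have SB: "S \<in> lt.span B"
      unfolding S_def by (rule lt.span_sum, rule lt.span_scale, rule lt.span_base) (simp add: B_def)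
    have "S \<in> ?V"
      unfolding S_def by (rule lt.subspace_sum[OF V_sub], rule lt.subspace_scale[OF V_sub]) (use B_V B_def in blast)
    then have "U - S \<in> ?V" using U by (intro lt.subspace_diff[OF V_sub])
    moreover have "(U - S) r (rp Q) = 0" if Q: "Q \<in> rot_orbit ` G" for Q
    proof -
      have "S r (rp Q) = (\<Sum>Q'\<in>rot_orbit ` G. U r (rp Q') / orbit_sum (rp Q') r r (rp Q') * orbit_sum (rp Q') r r (rp Q))"
        by (simp add: S_def sum_lt_apply scale_lt_def)
      also have "\<dots> = (\<Sum>Q'\<in>rot_orbit ` G. if Q' = Q then U r (rp Q) else 0)"
      proof (rule sum.cong[OF refl])
        fix Q' assume Q': "Q' \<in> rot_orbit ` G"
        show "U r (rp Q') / orbit_sum (rp Q') r r (rp Q') * orbit_sum (rp Q') r r (rp Q) =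
            (if Q' = Q then U r (rp Q) else 0)"
          using eval[OF Q' Q] by (cases "Q' = Q") auto
      qed
      also have "\<dots> = U r (rp Q)" using finO Q by simp
      finally show ?thesis by simp
    qed
    ultimately have "U - S = 0" by (rule vanish)
    then show "U \<in> lt.span B" using SB by simp
  qed
  have "lt.dim ?V = card B"
    by (rule lt.dim_unique[OF B_V span indep refl])
  also have "card B = card (rot_orbit ` G)"
    unfolding B_def by (rule card_image[OF inj])
  finally have "lt.dim ?V = card (rot_orbit ` G)" .
  moreover have "finite_dim ?V"
    unfolding finite_dim_def using span finO by (intro exI[of _ B]) (simp add: B_def)
  ultimately show ?thesis by (simp add: G_def)
qed

end

text \<open>Reconciles the exponent n - r of the path side with the exponent r - n of the module
  side.\<close>

lemma rot_good_inverse: "rot_good (inverse \<theta>) w \<longleftrightarrow> rot_good \<theta> w"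
  by (simp add: rot_good_def power_inverse)

theorem theorem1p5:
  fixes l m n :: nat and \<zeta> :: complex
  assumes "1 \<le> l" and "1 \<le> m" and "n < m" and "primitive_root m \<zeta>"
  shows "(\<forall>\<nu>. finite {X \<in> subcrystal l (p_path l m n). wt X = \<nu>}) \<and>
    (\<forall>\<nu>\<in>weight_lattice l. finite_dim (weight_space l m \<zeta> (L_module l m n \<zeta>) \<nu>)) \<and>
    crystal_char (subcrystal l (p_path l m n)) = module_char l m \<zeta> (L_module l m n \<zeta>)"
proof -
  interpret C: loop_crystal l m n
    using assms by unfold_locales
  interpret M: quantum_loop_module l m n \<zeta>
    using assms by unfold_locales
  let ?crystal = "\<lambda>\<nu>. {X \<in> subcrystal l (p_path l m n). wt X = \<nu>}"
  have main: "finite (?crystal \<nu>) \<and> finite_dim (weight_space l m \<zeta> M.eigen \<nu>) \<and>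
      card (?crystal \<nu>) = lt.dim (weight_space l m \<zeta> M.eigen \<nu>)" if \<nu>: "\<nu> \<in> weight_lattice l" for \<nu>
  proof -
    obtain r where r: "snd \<nu> = real_of_int r"
      using \<nu> by (auto simp: weight_lattice_iff elim: Ints_cases)
    define A where "A = {w \<in> words l m. M.basis_weight r w = \<nu>}"
    have A_iff: "w \<in> A \<longleftrightarrow> w \<in> words l m \<and> C.word_weight w = (fst \<nu>, 0)" for w
    proof -
      have "M.basis_weight r w = \<nu> \<longleftrightarrow> C.word_weight w = (fst \<nu>, 0)" if "length w = m"
        using that C.snd_word_weight[of w] r
        by (auto simp: M.basis_weight_def C.word_weight_def delta_def prod_eq_iff scaleR_fun_def fun_eq_iff)
      then show ?thesis by (auto simp: A_def words_def)
    qed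
    have finA: "finite A" by (simp add: A_def finite_words)
    have lenA: "length w = m" if "w \<in> A" for w using that by (simp add: A_def words_def)
    \<comment> \<open>The weight of a word depends on its content only; closure under rearrangement
      is what sieving requires.\<close>
    have msetA: "v \<in> A" if "w \<in> A" "mset v = mset w" for v w
    proof -
      have "C.word_weight w = (\<Sum>a\<in>#mset w. letter_weight l a)" for w
        unfolding C.word_weight_def
        by (rule sum_nth_eq_sum_mset)
      moreover have "length v = length w" "set v = set w"
        using that(2) by (metis size_mset, metis set_mset_mset)
      ultimately show ?thesis using that by (simp add: A_iff words_def)
    qed
    have bij: "bij_betw (map C.letter) {x \<in> C.seqs. C.endpoint x = \<nu>} {w \<in> A. int m dvd (int n - r) + int (comaj w)}"
      using C.bij_betw_seqs_endpoint[OF r] by (simp add: A_iff conj_assoc)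
    then have fin: "finite {x \<in> C.seqs. C.endpoint x = \<nu>}"
      using finA by (simp add: bij_betw_finite)
    have "card (?crystal \<nu>) = card {w \<in> A. int m dvd (int n - r) + int (comaj w)}"
      unfolding C.card_crystal_weight_set by (rule bij_betw_same_card[OF bij])
    also have "\<dots> = card (rot_orbit ` {w \<in> A. rot_good (\<zeta> powi (int n - r)) w})"
      by (rule card_comaj_eq_card_rot_orbits[OF assms(4,2) finA lenA msetA])
    also have "\<zeta> powi (int n - r) = inverse (\<zeta> powi (r - int n))"
      by (simp flip: power_int_minus)
    finally have "card (?crystal \<nu>) = card (rot_orbit ` {w \<in> A. rot_good (\<zeta> powi (r - int n)) w})"
      by (simp only: rot_good_inverse)
    moreover have "finite (?crystal \<nu>)"
      unfolding C.crystal_weight_set using fin by simp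
    ultimately show ?thesis
      using M.weight_space_dim[OF \<nu> r] by (simp add: A_def)
  qed
  \<comment> \<open>Outside the lattice the module coefficient is 0 by definition, and no path of
    the crystal ends there.\<close>
  have out: "finite (?crystal \<nu>) \<and> card (?crystal \<nu>) = 0" if "\<nu> \<notin> weight_lattice l" for \<nu>
  proof -
    have "?crystal \<nu> = {}"
      unfolding C.crystal_weight_set using that C.endpoint_lattice by auto
    then show ?thesis by (simp only: card.empty finite.emptyI)
  qed
  have "crystal_char (subcrystal l (p_path l m n)) \<nu> = module_char l m \<zeta> (L_module l m n \<zeta>) \<nu>" for \<nu>
    unfolding crystal_char_def module_char_def M.L_module_eq_eigen
    using main[of \<nu>] out[of \<nu>] by (cases "\<nu> \<in> weight_lattice l") simp_all
  moreover have "finite (?crystal \<nu>)" for \<nu>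
    using main[of \<nu>] out[of \<nu>] by (cases "\<nu> \<in> weight_lattice l") simp_all
  ultimately show ?thesis
    using main unfolding M.L_module_eq_eigen by blast
qed

end
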